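(* Let $d\in\mathbb{N}$ and $s>1/2$, and let $H^s_{\rm mix}(\mathbb{T}^d)$ be the Sobolev space of dominating mixed smoothness $s$ on the $d$-dimensional torus. Then \[ e_n\big(H^s_{\rm mix}(\mathbb{T}^d)\big)\,\lesssim\, n^{-s}\log^{sd}(n), \] that is, there is a constant $K>0$ (which may depend on $s$ and $d$ but not on $n$) such that $e_n\big(H^s_{\rm mix}(\mathbb{T}^d)\big)\le K\,n^{-s}(\log n)^{sd}$ for all $n\ge 2$.
   Context: $\mathbb{T}^d\cong[0,1)^d$ is the $d$-dimensional torus with Lebesgue measure, $L_2(\mathbb{T}^d)$ is the space of real-valued square-integrable functions on it, $\mathbb{N}=\{1,2,\dots\}$ and $\mathbb{N}_0=\mathbb{N}\cup\{0\}$. Define an orthonormal basis of $L_2(\mathbb{T})$ by $b^{(1)}_0=1$, $b^{(1)}_{2m}(x)=\sqrt{2}\cos(2\pi m x)$ and $b^{(1)}_{2m-1}(x)=\sqrt{2}\sin(2\pi m x)$ for $m\in\mathbb{N}$, and an orthonormal basis of $L_2(\mathbb{T}^d)$ by the tensor products $\mathbf{b}_{\mathbf{m}}:=\bigotimes_{j=1}^d b^{(1)}_{m_j}$, i.e. $\mathbf{b}_{\mathbf{m}}(x)=\prod_{j=1}^d b^{(1)}_{m_j}(x_j)$, for $\mathbf{m}=(m_1,\dots,m_d)\in\mathbb{N}_0^d$. The Sobolev space with dominating mixed smoothness $s>0$ is the Hilbert space \[ H=H^s_{\rm mix}(\mathbb{T}^d):=\Big\{f\in L_2(\mathbb{T}^d)\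 \Big|\ \|f\|_H^2:=\sum_{\mathbf{m}\in\mathbb{N}_0^d}\ \prod_{j=1}^d\big(1+|m_j|^{2s}\big)\,\langle f,\mathbf{b}_{\mathbf{m}}\rangle_{L_2}^2<\infty\Big\}. \] For $s>1/2$ every element of $H$ has a unique continuous representative, with which it is identified; in this way $H$ is a Hilbert space of real-valued functions on $\mathbb{T}^d$ on which point evaluations are continuous. For $n\in\mathbb{N}$, the sampling numbers of $H$ are \[ e_n(H) := \inf_{\substack{x_1,\dots,x_n\in \mathbb{T}^d\\ \varphi_1,\dots,\varphi_n\in L_2(\mathbb{T}^d)}}\ \sup_{f\in H\colon \|f\|_H\le 1}\ \Big\|f-\sum_{i=1}^n f(x_i)\,\varphi_i\Big\|_{L_2(\mathbb{T}^d)}. \] *)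

theory Defs
  imports "HOL-Analysis.Analysis"
begin

text \<open>
  The torus is represented by the fundamental domain \<open>[0,1)\<close>^d, with \<open>d = CARD('d)\<close>.
  Functions on it are functions on all of \<open>real ^ 'd\<close>; every notion below only depends on
  their values on the fundamental domain.
\<close>

definition torus :: "(real ^ 'd) set" where
  "torus = {x. \<forall>j. 0 \<le> x $ j \<and> x $ j < 1}"

definition L2_torus :: "(real ^ 'd \<Rightarrow> real) set" where
  "L2_torus = {f. f \<in> borel_measurable (lebesgue_on torus) \<and>
                  integrable (lebesgue_on torus) (\<lambda>x. (f x)\<^sup>2)}"

definition L2_inner :: "(real ^ 'd \<Rightarrow> real) \<Rightarrow> (real ^ 'd \<Rightarrow> real) \<Rightarrow> real" where
  "L2_inner f g = (LINT x|lebesgue_on torus. f x * g x)"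

definition L2_norm :: "(real ^ 'd \<Rightarrow> real) \<Rightarrow> real" where
  "L2_norm f = sqrt (L2_inner f f)"

definition basis1 :: "nat \<Rightarrow> real \<Rightarrow> real" where
  "basis1 k x =
     (if k = 0 then 1
      else if even k then sqrt 2 * cos (2 * pi * real (k div 2) * x)
      else sqrt 2 * sin (2 * pi * real ((k + 1) div 2) * x))"

definition basis :: "nat ^ 'd \<Rightarrow> real ^ 'd \<Rightarrow> real" where
  "basis m x = (\<Prod>j\<in>UNIV. basis1 (m $ j) (x $ j))"

definition mix_term :: "real \<Rightarrow> (real ^ 'd \<Rightarrow> real) \<Rightarrow> nat ^ 'd \<Rightarrow> real" where
  "mix_term s f m = (\<Prod>j\<in>UNIV. 1 + real (m $ j) powr (2 * s)) * (L2_inner f (basis m))\<^sup>2"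

definition mix_norm :: "real \<Rightarrow> (real ^ 'd \<Rightarrow> real) \<Rightarrow> real" where
  "mix_norm s f = sqrt (\<Sum>\<^sub>\<infinity>m. mix_term s f m)"

text \<open>
  Continuity for the quotient topology of the torus, i.e. continuity of the 1-periodic
  extension (continuity on the fundamental domain alone would not see the identification
  of opposite faces).
\<close>

definition torus_continuous :: "(real ^ 'd \<Rightarrow> real) \<Rightarrow> bool" where
  "torus_continuous f \<longleftrightarrow> continuous_on UNIV (\<lambda>x. f (\<chi> j. frac (x $ j)))"

text \<open>
  For \<open>s > 1/2\<close> each class in the Sobolev space has exactly one continuous representative;
  the space consists of these representatives, so that point values make sense.
\<close>

definition H_mix :: "real \<Rightarrow> (real ^ 'd \<Rightarrow> real) set" where
  "H_mix s = {f \<in> L2_torus. mix_term s f summable_on UNIV \<and> torus_continuous f}"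

text \<open>
  The \<open>n\<close>-th sampling number of a space \<open>H\<close> of functions with norm \<open>N\<close>. Infimum and
  supremum are taken in \<open>[0,\<infinity>]\<close>, so a choice of points and functions with unbounded error
  contributes \<open>\<infinity>\<close>.
\<close>

definition sampling_number ::
  "(real ^ 'd \<Rightarrow> real) set \<Rightarrow> ((real ^ 'd \<Rightarrow> real) \<Rightarrow> real) \<Rightarrow> nat \<Rightarrow> ennreal" where
  "sampling_number H N n =
     (INF x \<in> {1..n} \<rightarrow> torus. INF \<phi> \<in> {1..n} \<rightarrow> L2_torus.
        SUP f \<in> {f \<in> H. N f \<le> 1}.
          ennreal (L2_norm (\<lambda>y. f y - (\<Sum>i=1..n. f (x i) * \<phi> i y))))"

end

theory Submission
  imports Defs "HOL-Computational_Algebra.Primes" "HOL-Real_Asymp.Real_Asymp"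
begin

text \<open>
  The coefficients of \<open>f\<close> are estimated by averaging over several random rank-1 lattices. Write
  \<open>W m\<close> for the product of the numbers \<open>max 1 (m $ j)\<close>. On the unit ball of the Sobolev space the
  coefficients \<open>a m\<close> of \<open>f\<close> satisfy \<open>\<Sum> W(m)^(2s) a(m)\<^sup>2 \<le> 1\<close>, so the coefficients outside the
  hyperbolic cross \<open>I = {m. W m \<le> R}\<close> contribute at most \<open>R^(-2s)\<close> to the squared \<open>L\<^sub>2\<close> norm. It
  remains to recover the coefficients in \<open>I\<close> from samples with a total squared error \<open>O(R^(-2s))\<close>.

  For a prime \<open>p\<close> and an integer vector \<open>z\<close>, the mean of \<open>b\<^sub>h f\<close> over the \<open>p\<close> points \<open>i z / p\<close> equals
  \<open>\<Sum> a(k) D(h,k)\<close>, where \<open>D(h,k)\<close> is the lattice mean of \<open>b\<^sub>h b\<^sub>k\<close>. Expanding into exponentials,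
  \<open>D(h,k)\<close> differs from the Kronecker delta only if some nonzero frequency \<open>v\<close> of \<open>b\<^sub>h b\<^sub>k\<close>
  is annihilated, \<open>v \<cdot> z \<equiv> 0 (mod p)\<close>; this is called aliasing. For random \<open>z\<close> it has probability
  at most \<open>4^d / p\<close>, except when \<open>v\<close> itself vanishes modulo \<open>p\<close>. The cross has
  \<open>O(R (log R)^(d-1))\<close> elements and the decay \<open>W^(-2s)\<close> summed outside of it is
  \<open>O(R^(1-2s) (log R)^(d-1))\<close>. So if \<open>p\<close> is a large multiple of \<open>R (log R)^(d-1)\<close> then each \<open>h\<close> in
  \<open>I\<close> is good for all but a sixteenth of the generators \<open>z\<close>: it aliases with no element of \<open>I\<close>,
  itself included, and the decay summed over all \<open>k\<close> outside \<open>I\<close> that alias with \<open>h\<close> is \<open>O(R^(-2s))\<close>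
  (\<open>bad_generators_rare\<close>).

  A single lattice does not serve all \<open>h\<close>, but \<open>L = O(log n)\<close> of them can be chosen such that every
  \<open>h\<close> is good for at least half of them (\<open>exists_rarely_bad_sequence\<close>), and the coefficient at \<open>h\<close>
  is estimated by the average of the lattice means over the lattices that are good for \<open>h\<close>. The
  averaging is what prevents the loss of a factor \<open>L\<close>: for one lattice, the functions \<open>b\<^sub>h\<close> with
  \<open>h\<close> good for it are orthonormal in the discrete inner product, so Bessel's inequality bounds
  \<open>\<Sum> D(h,k)\<^sup>2\<close> over these \<open>h\<close> by \<open>2^d\<close>; with the Cauchy-Schwarz inequality every lattice contributes
  \<open>O(R^(-2s))\<close>, and the error of the averages is at most twice the mean of these contributions
  (\<open>averaged_coeff_partial_sum_error\<close>).

  In total \<open>L p = O(R (log n)^d)\<close> samples are used, that is, \<open>R\<close> may be a constant multiple of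
  \<open>n / (log n)^d\<close>, and the error is \<open>O(R^(-s))\<close>. Two classical facts are needed on the way: a prime
  between \<open>x\<close> and \<open>C x\<close> (\<open>prime_between_multiples\<close>), and that a continuous periodic function is
  determined by its coefficients (\<open>periodic_eq_0_if_orthogonal\<close>), which identifies \<open>f\<close> pointwise
  with its Fourier series.
\<close>

section \<open>Primes between x and C x\<close>

text \<open>
  The reciprocals of \<open>k * (n choose k)\<close> form the Leibniz harmonic triangle, in which each entry
  is the difference of two entries with a smaller \<open>k\<close>. Starting from the entries \<open>1/n\<close>, all
  denominators therefore divide \<open>Lcm {1..n}\<close>.
\<close>
lemma times_binomial_dvd_Lcm:
  assumes "1 \<le> k" "k \<le> n"
  shows "k * (n choose k) dvd Lcm {1..n}"
  using assms
proof (induction k arbitrary: n rule: nat_induct_at_least)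
  case base
  have "n dvd Lcm {1..n}" using base by (intro dvd_Lcm) auto
  then show ?case by simp
next
  case (Suc k)
  obtain m where n: "n = Suc m" using Suc by (cases n) auto
  let ?D = "Lcm {1..n}"
  have km: "k \<le> m" "k \<ge> 1" using Suc n by auto
  have 1: "k * (n choose k) dvd ?D" using Suc.IH[of n] Suc.prems by auto
  have "k * (m choose k) dvd Lcm {1..m}" using Suc.IH[of m] km by auto
  also have "Lcm {1..m} dvd ?D" unfolding n by (rule Lcm_subset) auto
  finally have 2: "k * (m choose k) dvd ?D" .
  obtain a where a: "?D = k * (n choose k) * a" using 1 by (rule dvdE)
  obtain b where b: "?D = k * (m choose k) * b" using 2 by (rule dvdE)
  have "?D \<noteq> 0" by (simp add: Lcm_0_iff_nat)
  \<comment> \<open>The recursion of the triangle: \<open>b - a\<close> is the cofactor of the new entry.\<close>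
  have c: "Suc k * (n choose Suc k) = n * (m choose k)"
    unfolding n using Suc_times_binomial_eq[of m k] by (simp only: mult.commute)
  have d: "(n - k) * (n choose k) = n * (m choose k)"
    using km binomial_absorb_comp[of n k] by (simp add: n)
  have pos: "real (m choose k) > 0" "real (n choose k) > 0" "real k > 0" "real n > real k"
    using km n by (auto simp: zero_less_binomial_iff)
  have rd: "(real n - real k) * real (n choose k) = real n * real (m choose k)"
  proof -
    have "real (n - k) * real (n choose k) = real n * real (m choose k)"
      using d by (simp only: flip: of_nat_mult)
    then show ?thesis using km n by (simp add: of_nat_diff)
  qed
  have ra: "real ?D = real k * real (n choose k) * real a"
    using arg_cong[OF a, of real] by simp
  have rb: "real ?D = real k * real (m choose k) * real b"
    using arg_cong[OF b, of real] by simp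
  have "real k * real b * real (m choose k) = real k * real (n choose k) * real a" using ra rb by (metis mult.assoc mult.commute)
  then have e1: "real b * real (m choose k) = real (n choose k) * real a"
    using pos(3) by (simp add: mult.assoc)
  have "(real n - real k) * (real b * real (m choose k)) = real n * real (m choose k) * real a"
    using e1 rd by (simp add: algebra_simps)
  then have e2: "(real n - real k) * real b = real n * real a" using pos by simp
  have "real n * (real b - real a) = real k * real b" using e2 by (simp add: algebra_simps)
  moreover have "real ?D = (real k * real b) * real (m choose k)" using rb by (simp add: mult_ac)
  ultimately have "real ?D = real n * real (m choose k) * (real b - real a)"
    by (metis mult.assoc mult.commute)
  also have "\<dots> = real (Suc k * (n choose Suc k)) * (real b - real a)" using c by simp
  finally have f: "real ?D = real (Suc k * (n choose Suc k)) * (real b - real a)" .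
  have "real a \<le> real b"
  proof (rule ccontr)
    assume "\<not> ?thesis"
    then have "real n * (real b - real a) < 0" using pos by (intro mult_pos_neg) auto
    with \<open>real n * (real b - real a) = real k * real b\<close> show False using pos by (smt (verit) mult_nonneg_nonneg of_nat_0_le_iff)
  qed
  then have "real ?D = real (Suc k * (n choose Suc k) * (b - a))" using f by (simp add: of_nat_diff)
  then have "?D = Suc k * (n choose Suc k) * (b - a)" by (simp only: of_nat_eq_iff)
  then show ?case by (metis dvd_triv_left)
qed

lemma prime_power_dvd_Lcm:
  assumes "prime (p::nat)" "finite A" "0 \<notin> A" "p ^ e dvd Lcm A" "e > 0"
  shows "\<exists>a\<in>A. p ^ e dvd a"
  using assms(2,3,4)
proof (induction A rule: finite_induct)
  case empty
  then show ?case using assms by (simp add: prime_nat_iff)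
next
  case (insert x A)
  have nz: "x \<noteq> 0" "Lcm A \<noteq> 0" using insert by (auto simp: Lcm_0_iff_nat)
  have "e \<le> multiplicity p (lcm x (Lcm A))"
    using insert nz assms(1) by (intro multiplicity_geI) (auto simp: not_prime_1 not_is_unit_0 prime_gt_1_nat)
  also have "\<dots> = max (multiplicity p x) (multiplicity p (Lcm A))"
    using nz assms(1) by (intro multiplicity_lcm) auto
  finally have "p ^ e dvd x \<or> p ^ e dvd Lcm A"
    by (auto simp: le_max_iff_disj intro: multiplicity_dvd')
  then show ?case using insert by auto
qed

text \<open>
  A prime power dividing \<open>n choose k\<close> divides \<open>Lcm {1..n}\<close>, hence one of the numbers up to \<open>n\<close>.
  This replaces Legendre's formula for the exponents of primes in factorials.
\<close>
lemma prime_power_dvd_binomial_le: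
  assumes "prime (p::nat)" "1 \<le> k" "k \<le> n" "p ^ e dvd (n choose k)"
  shows "p ^ e \<le> n"
proof (cases "e = 0")
  case False
  have "p ^ e dvd Lcm {1..n}"
    using times_binomial_dvd_Lcm[OF assms(2,3)] assms(4) by (meson dvd_trans dvd_triv_right)
  then obtain a where "a \<in> {1..n}" "p ^ e dvd a"
    using prime_power_dvd_Lcm[OF assms(1), of "{1..n}" e] False by auto
  then show ?thesis by (auto dest!: dvd_imp_le)
qed (use assms in auto)

lemma prod_primes_dvd:
  assumes "finite A" "\<And>p. p \<in> A \<Longrightarrow> prime (p::nat)" "\<And>p. p \<in> A \<Longrightarrow> p dvd n"
  shows "\<Prod>A dvd n"
  using assms
proof (induction A rule: finite_induct)
  case (insert p A)
  have "coprime p (\<Prod>A)"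
    using insert by (intro prod_coprime_right) (metis insertCI primes_coprime)
  then show ?case using insert by (auto intro: divides_mult)
qed auto

text \<open>
  Erdos' induction: the primes in \<open>{m+2..2*m+1}\<close> all divide the binomial coefficient
  \<open>(2*m+1) choose m\<close>, which occurs twice in a row with sum \<open>2 * 4^m\<close>.
\<close>
lemma primorial_le: "\<Prod>{p. prime p \<and> p \<le> n} \<le> (4::nat) ^ n"
proof (induction n rule: less_induct)
  case (less n)
  have [simp]: "finite {p. prime p \<and> p \<le> n}" for n :: nat by simp
  consider "n = 0" | "n = 1" | "n = 2" | "n > 2" "even n" | m where "n = 2 * m + 1" "m \<ge> 1"
    by (metis One_nat_def Suc_eq_plus1 Suc_lessI add.commute less_one linorder_not_less mult.commute mult_0 nat_neq_iff numeral_2_eq_2 oddE)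
  then show ?case
  proof cases
    case 1
    then have "{p. prime p \<and> p \<le> n} = {}" by auto
    then show ?thesis by (simp only: prod.empty) simp
  next
    case 2
    have "\<not> (prime p \<and> p \<le> n)" for p using prime_ge_2_nat[of p] 2 by auto
    then have "{p. prime p \<and> p \<le> n} = {}" by blast
    then show ?thesis by (simp only: prod.empty) simp
  next
    case 3
    have "prime p \<and> p \<le> n \<longleftrightarrow> p = 2" for p using prime_ge_2_nat[of p] 3 by auto
    then have "{p. prime p \<and> p \<le> n} = {2}" by blast
    then show ?thesis using 3 by simp
  next
    case 4
    have "\<not> prime n" using 4 prime_odd_nat by auto
    then have "{p. prime p \<and> p \<le> n} = {p. prime p \<and> p \<le> n - 1}"
      by (metis (no_types, lifting) Collect_cong One_nat_def Suc_pred 4(1) le_Suc_eq less_imp_Suc_add zero_less_Suc le_less_trans not_less)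
    then show ?thesis using less.IH[of "n - 1"] 4(1)
      by (simp add: le_trans[OF _ power_increasing[of "n - 1" n "4::nat"]])
  next
    case 5
    let ?B = "{p. prime p \<and> m + 1 < p \<and> p \<le> n}"
    have eq: "{p. prime p \<and> p \<le> n} = {p. prime p \<and> p \<le> m + 1} \<union> ?B" using 5 by auto
    have "\<Prod>?B dvd (n choose m)"
    proof (rule prod_primes_dvd)
      fix p assume p: "p \<in> ?B"
      have "fact m * fact (n - m) * (n choose m) = (fact n :: nat)"
        using 5 by (intro binomial_fact_lemma) auto
      moreover have "p dvd (fact n :: nat)" using p by (auto simp: prime_dvd_fact_iff)
      moreover have "n - m = m + 1" using 5 by simp
      then have "\<not> p dvd (fact m :: nat)" "\<not> p dvd (fact (n - m) :: nat)"
        using p by (simp_all add: prime_dvd_fact_iff del: fact_Suc)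
      ultimately show "p dvd (n choose m)"
        using p by (metis (no_types, lifting) mem_Collect_eq prime_dvd_mult_iff)
    qed auto
    moreover have "(n choose m) > 0" using 5 by simp
    ultimately have B: "\<Prod>?B \<le> (n choose m)" by (rule dvd_imp_le)
    have "2 * (n choose m) = (n choose m) + (n choose (m+1))"
      using 5 binomial_symmetric[of m n] by simp
    also have "\<dots> = (\<Sum>k\<in>{m,m+1}. n choose k)" by simp
    also have "\<dots> \<le> (\<Sum>k\<le>n. n choose k)" using 5 by (intro sum_mono2) auto
    also have "\<dots> = 2 * 4 ^ m" using choose_row_sum[of n] 5 by (simp add: power_mult)
    finally have C: "(n choose m) \<le> 4 ^ m" by simp
    have "\<Prod>{p. prime p \<and> p \<le> n} = \<Prod>{p. prime p \<and> p \<le> m + 1} * \<Prod>?B"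
      unfolding eq by (rule prod.union_disjoint) auto
    also have "\<dots> \<le> 4 ^ (m + 1) * 4 ^ m"
      using less.IH[of "m + 1"] B C 5 by (intro mult_mono) auto
    also have "\<dots> = 4 ^ n" using 5 by (simp flip: power_add)
    finally show ?thesis .
  qed
qed

text \<open>
  Primes up to \<open>sqrt (2*n)\<close> contribute at most \<open>2*n\<close> each; larger primes occur with exponent one,
  and being at most \<open>y\<close> they contribute at most the primorial of \<open>y\<close>.
\<close>
lemma central_binomial_le_of_no_prime:
  assumes n: "n > 0" and no: "\<And>p. prime p \<Longrightarrow> p \<le> 2 * n \<Longrightarrow> p \<le> y"
  shows "real (2 * n choose n) \<le> (2 * real n) powr (sqrt (2 * real n)) * 4 ^ y"
proof -
  let ?N = "2 * n" let ?C = "2 * n choose n"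
  let ?F = "prime_factors ?C"
  let ?S = "{p\<in>?F. p\<^sup>2 \<le> ?N}" let ?T = "{p\<in>?F. p\<^sup>2 > ?N}"
  have C0: "?C \<noteq> 0" by simp
  have pe: "p ^ multiplicity p ?C \<le> ?N" if "p \<in> ?F" for p
    using that n prime_power_dvd_binomial_le[of p n ?N "multiplicity p ?C"]
    by (auto simp: in_prime_factors_iff multiplicity_dvd)
  have p1: "multiplicity p ?C \<le> 1" if "p \<in> ?T" for p
  proof (rule ccontr)
    assume "\<not> ?thesis"
    then have "p ^ 2 \<le> p ^ multiplicity p ?C"
      using that by (intro power_increasing) (auto simp: in_prime_factors_iff prime_gt_0_nat Suc_le_eq)
    then show False using that pe[of p] by auto
  qed
  have "?C = (\<Prod>p\<in>?F. p ^ multiplicity p ?C)"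
    using prod_prime_factors[OF C0] by simp
  also have "\<dots> = (\<Prod>p\<in>?S. p ^ multiplicity p ?C) * (\<Prod>p\<in>?T. p ^ multiplicity p ?C)"
    by (subst prod.union_disjoint[symmetric]) (auto intro!: prod.cong)
  also have "\<dots> \<le> (\<Prod>p\<in>?S. ?N) * (\<Prod>p\<in>?T. p)"
  proof (intro mult_mono prod_mono conjI)
    fix p assume "p \<in> ?T"
    then show "p ^ multiplicity p ?C \<le> p" using p1[of p]
      by (metis (no_types, lifting) in_prime_factors_iff mem_Collect_eq power_increasing power_one_right prime_ge_1_nat)
  qed (use pe in auto)
  also have "(\<Prod>p\<in>?T. p) \<le> \<Prod>{p. prime p \<and> p \<le> y}"
  proof (rule dvd_imp_le[OF prod_dvd_prod_subset])
    show "?T \<subseteq> {p. prime p \<and> p \<le> y}"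
    proof
      fix p assume p: "p \<in> ?T"
      then have "p ^ 1 \<le> ?N" using n prime_power_dvd_binomial_le[of p n ?N 1]
        by (auto simp: in_prime_factors_iff)
      then show "p \<in> {p. prime p \<and> p \<le> y}" using p no[of p] by (auto simp: in_prime_factors_iff)
    qed
  qed (auto intro!: prod_pos simp: prime_gt_0_nat)
  also have "\<dots> \<le> 4 ^ y" by (rule primorial_le)
  finally have 1: "?C \<le> ?N ^ card ?S * 4 ^ y" by (simp add: mult_mono)
  have "?S \<subseteq> {1..nat \<lfloor>sqrt ?N\<rfloor>}"
  proof
    fix p assume "p \<in> ?S"
    then have p: "p\<^sup>2 \<le> ?N" "prime p" by (auto simp: in_prime_factors_iff)
    have "real p \<le> sqrt ?N" using p(1) by (metis of_nat_mono of_nat_power real_le_rsqrt)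
    then show "p \<in> {1..nat \<lfloor>sqrt ?N\<rfloor>}" using prime_ge_1_nat[OF p(2)] by (auto simp: le_nat_floor)
  qed
  then have "card ?S \<le> nat \<lfloor>sqrt ?N\<rfloor>" using card_mono[of "{1..nat \<lfloor>sqrt ?N\<rfloor>}" ?S] by auto
  then have 2: "real (card ?S) \<le> sqrt ?N" by (meson le_nat_floor of_nat_floor of_nat_le_iff order_trans real_sqrt_ge_zero of_nat_0_le_iff)
  have "real ?C \<le> real (?N ^ card ?S * 4 ^ y)" using 1 by (simp only: of_nat_le_iff)
  also have "\<dots> = (2 * real n) powr real (card ?S) * 4 ^ y" using n by (simp add: powr_realpow)
  also have "\<dots> \<le> (2 * real n) powr (sqrt (2 * real n)) * 4 ^ y"
    using 2 n by (intro mult_right_mono powr_mono) auto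
  finally show ?thesis .
qed

text \<open>
  With \<open>y = n div 2\<close> the previous bound is roughly \<open>2^n\<close>, which contradicts the size \<open>4^n / (2*n)\<close>
  of the central binomial coefficient.
\<close>
lemma eventually_prime_between:
  "eventually (\<lambda>n. \<exists>p. prime p \<and> n div 2 < p \<and> p \<le> 2 * n) sequentially"
proof -
  have "eventually (\<lambda>n. (2 * real n) powr (sqrt (2 * real n)) * 4 powr (real n / 2) * (2 * real n)
      < 4 powr real n) sequentially"
    by real_asymp
  with eventually_gt_at_top[of 0] show ?thesis
  proof eventually_elim
    case (elim n)
    show ?case
    proof (rule ccontr)
      assume "\<not> ?thesis"
      then have no: "prime p \<Longrightarrow> p \<le> 2 * n \<Longrightarrow> p \<le> n div 2" for p by (meson not_le)
      have "(4::real) ^ (n div 2) = 4 powr real (n div 2)" by (simp add: powr_realpow)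
      also have "\<dots> \<le> 4 powr (real n / 2)" by (intro powr_mono) auto
      finally have y: "(4::real) ^ (n div 2) \<le> 4 powr (real n / 2)" .
      have "4 powr real n \<le> 2 * real n * real (2 * n choose n)"
        using central_binomial_lower_bound[of n] elim(1) by (simp add: powr_realpow field_simps)
      also have "\<dots> \<le> 2 * real n * ((2 * real n) powr (sqrt (2 * real n)) * 4 powr (real n / 2))"
        using central_binomial_le_of_no_prime[OF elim(1) no] y
        by (intro mult_left_mono order_trans[OF central_binomial_le_of_no_prime[OF elim(1) no]]) auto
      finally show False using elim(2) by (simp add: mult_ac)
    qed
  qed
qed

lemma prime_between_multiples:
  obtains C :: real where "C \<ge> 1" "\<And>x. x \<ge> 1 \<Longrightarrow> \<exists>p. prime p \<and> x \<le> real p \<and> real p \<le> C * x"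
proof -
  obtain n0 :: nat where n0: "\<And>n. n \<ge> n0 \<Longrightarrow> \<exists>p. prime p \<and> n div 2 < p \<and> p \<le> 2 * n"
    using eventually_prime_between[unfolded eventually_sequentially] by (elim exE) (meson)
  have "\<exists>p. prime p \<and> x \<le> real p \<and> real p \<le> (2 * real n0 + 8) * x" if x: "x \<ge> 1" for x
  proof -
    \<comment> \<open>Doubling makes the lower end \<open>n div 2\<close> of the range at least \<open>x\<close>.\<close>
    define n where "n = max n0 (2 * nat \<lceil>x\<rceil>)"
    obtain p where p: "prime p" "n div 2 < p" "p \<le> 2 * n" using n0[of n] by (auto simp: n_def)
    have "2 * nat \<lceil>x\<rceil> \<le> n" unfolding n_def by (rule max.cobounded2)
    then have "nat \<lceil>x\<rceil> \<le> n div 2" by linarith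
    then have "nat \<lceil>x\<rceil> \<le> p" using p(2) by simp
    then have "real (nat \<lceil>x\<rceil>) \<le> real p" by (simp only: of_nat_le_iff)
    then have "x \<le> real p" using real_nat_ceiling_ge[of x] by (rule order_trans[rotated])
    have "real (nat \<lceil>x\<rceil>) \<le> x + 1" using x by linarith
    moreover have "n \<le> n0 + 2 * nat \<lceil>x\<rceil>" by (simp add: n_def)
    then have "real n \<le> real n0 + 2 * real (nat \<lceil>x\<rceil>)"
      by (metis of_nat_add of_nat_le_iff of_nat_mult of_nat_numeral)
    ultimately have "real n \<le> real n0 + 2 * (x + 1)" by argo
    moreover have "real p \<le> 2 * real n"
      using p(3) by (metis of_nat_le_iff of_nat_mult of_nat_numeral)
    ultimately have "real p \<le> 2 * (real n0 + 2 * (x + 1))" by argo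
    also have "\<dots> \<le> (2 * real n0 + 8) * x"
      using x mult_left_mono[of 1 x "2 * real n0"] by (simp add: algebra_simps)
    finally have "real p \<le> (2 * real n0 + 8) * x" .
    with \<open>x \<le> real p\<close> show ?thesis using p(1) by blast
  qed
  then show ?thesis using that[of "2 * real n0 + 8"] by auto
qed

section \<open>Hyperbolic crosses\<close>

lemma bij_betw_vec_lambda_PiE:
  "bij_betw vec_lambda (PiE UNIV A) {u :: 'a ^ 'd. \<forall>j. u $ j \<in> A j}"
  by (rule bij_betw_byWitness[where f' = vec_nth]) (auto simp: vec_lambda_beta)

lemma finite_vec_set:
  assumes "\<And>j. finite (A j)"
  shows "finite {u :: 'a ^ 'd. \<forall>j. u $ j \<in> A j}"
  using bij_betw_finite[OF bij_betw_vec_lambda_PiE[of A]] assms by (auto intro: finite_PiE)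

lemma card_vec_set:
  "card {u :: 'a ^ 'd. \<forall>j. u $ j \<in> A j} = (\<Prod>j\<in>UNIV. card (A j))"
  using bij_betw_same_card[OF bij_betw_vec_lambda_PiE[of A]] by (simp add: card_PiE)

lemma prod_sum_vec:
  fixes F :: "'d::finite \<Rightarrow> 'a \<Rightarrow> 'c :: comm_semiring_1"
  assumes "\<And>j. finite (A j)"
  shows "(\<Prod>j\<in>UNIV. \<Sum>a\<in>A j. F j a) = (\<Sum>u\<in>{u :: 'a ^ 'd. \<forall>j. u $ j \<in> A j}. \<Prod>j\<in>UNIV. F j (u $ j))"
proof -
  have "(\<Prod>j\<in>UNIV. \<Sum>a\<in>A j. F j a) = (\<Sum>g\<in>PiE UNIV A. \<Prod>j\<in>UNIV. F j (g j))"
    using assms by (intro prod_sum_PiE) auto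
  also have "\<dots> = (\<Sum>g\<in>PiE UNIV A. \<Prod>j\<in>UNIV. F j (vec_lambda g $ j))" by simp
  also have "\<dots> = (\<Sum>u\<in>{u :: 'a ^ 'd. \<forall>j. u $ j \<in> A j}. \<Prod>j\<in>UNIV. F j (u $ j))"
    by (rule sum.reindex_bij_betw[OF bij_betw_vec_lambda_PiE])
  finally show ?thesis .
qed

lemma sum_UN_le:
  fixes f :: "'a \<Rightarrow> real"
  assumes "finite I" "\<And>i. i \<in> I \<Longrightarrow> finite (A i)" "\<And>i x. i \<in> I \<Longrightarrow> x \<in> A i \<Longrightarrow> 0 \<le> f x"
  shows "sum f (\<Union>i\<in>I. A i) \<le> (\<Sum>i\<in>I. sum f (A i))"
  using assms
proof (induction I rule: finite_induct)
  case (insert i I)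
  have "sum f (\<Union>i\<in>insert i I. A i) = sum f (A i \<union> (\<Union>i\<in>I. A i))" by simp
  also have "\<dots> = sum f (A i) + sum f (\<Union>i\<in>I. A i) - sum f (A i \<inter> (\<Union>i\<in>I. A i))"
    using insert by (intro sum_Un) auto
  also have "\<dots> \<le> sum f (A i) + sum f (\<Union>i\<in>I. A i)"
    using insert by (simp, intro sum_nonneg) auto
  also have "\<dots> \<le> sum f (A i) + (\<Sum>i\<in>I. sum f (A i))"
    using insert.IH insert.prems by (intro add_left_mono) blast
  finally show ?case using insert by simp
qed auto

text \<open>
  The factor \<open>1 + m^(2s)\<close> of the Sobolev norm is at least \<open>max 1 m ^ (2s)\<close>, so an integer-valued
  weight suffices for upper bounds.
\<close>
definition hc_weight :: "nat ^ 'd \<Rightarrow> nat" where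
  "hc_weight m = (\<Prod>j\<in>UNIV. max 1 (m $ j))"

definition hyperbolic_cross :: "nat \<Rightarrow> (nat ^ 'd) set" where
  "hyperbolic_cross R = {m. hc_weight m \<le> R}"

lemma hc_weight_ge_1: "hc_weight m \<ge> 1"
  unfolding hc_weight_def by (intro prod_ge_1) auto

lemma hc_weight_split:
  "hc_weight m = max 1 (m $ j) * (\<Prod>i\<in>UNIV-{j}. max 1 (m $ i))"
  unfolding hc_weight_def by (subst prod.remove[of _ j]) auto

lemma component_le_hc_weight: "m $ j \<le> hc_weight m"
proof -
  have "max 1 (m $ j) * 1 \<le> hc_weight m"
    unfolding hc_weight_split[of m j] by (intro mult_left_mono prod_ge_1) auto
  then show ?thesis by simp
qed

lemma finite_hyperbolic_cross: "finite (hyperbolic_cross R :: (nat ^ 'd) set)"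
proof (rule finite_subset)
  show "(hyperbolic_cross R :: (nat ^ 'd) set) \<subseteq> {m. \<forall>j. m $ j \<in> {..R}}"
    unfolding hyperbolic_cross_def using component_le_hc_weight order_trans by fastforce
qed (rule finite_vec_set, simp)

lemma sum_inverse_max_le:
  assumes "R \<ge> 1"
  shows "(\<Sum>a\<in>{0..R}. 1 / real (max 1 a)) \<le> 2 + ln (real R)"
proof -
  have "{0..R} = insert 0 {1..R}" by auto
  then have "(\<Sum>a\<in>{0..R}. 1 / real (max 1 a)) = 1 + (\<Sum>a\<in>{1..R}. 1 / real (max 1 a))" by simp
  also have "(\<Sum>a\<in>{1..R}. 1 / real (max 1 a)) = harm R"
    unfolding harm_def by (intro sum.cong) (auto simp: inverse_eq_divide)
  also have "harm R \<le> ln (real R) + 1"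
    using euler_mascheroni_sequence_decreasing[of 1 R] assms by (simp add: harm_expand)
  finally show ?thesis by simp
qed

text \<open>
  Induction on the set of coordinates that may be nonzero: fixing one more coordinate to \<open>a\<close>
  leaves the cross of radius \<open>R div max 1 a\<close>, and the sum of \<open>1 / max 1 a\<close> costs one factor
  \<open>2 + ln R\<close>. The first coordinate costs only the factor \<open>2 R\<close>, whence the exponent \<open>d - 1\<close>.
\<close>
lemma card_hyperbolic_cross_supported:
  fixes S :: "'d::finite set"
  assumes "finite S" "S \<noteq> {}" "R \<ge> 1"
  shows "real (card {m \<in> hyperbolic_cross R. \<forall>j. j \<notin> S \<longrightarrow> m $ j = 0})
           \<le> 2 * real R * (2 + ln (real R)) ^ (card S - 1)"
  using assms
proof (induction S arbitrary: R rule: finite_ne_induct)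
  case (singleton j)
  have "inj_on (\<lambda>m. m $ j) {m \<in> hyperbolic_cross R. \<forall>i. i \<notin> {j} \<longrightarrow> m $ i = 0}"
    by (auto simp: inj_on_def vec_eq_iff) metis
  moreover have "(\<lambda>m. m $ j) ` {m \<in> hyperbolic_cross R. \<forall>i. i \<notin> {j} \<longrightarrow> m $ i = 0} \<subseteq> {0..R}"
    using component_le_hc_weight order_trans by (fastforce simp: hyperbolic_cross_def)
  ultimately have "card {m \<in> hyperbolic_cross R. \<forall>i. i \<notin> {j} \<longrightarrow> m $ i = 0} \<le> card {0..R}"
    by (intro card_inj_on_le) auto
  then show ?case using singleton by simp
next
  case (insert j S)
  let ?C = "\<lambda>S R. {m \<in> hyperbolic_cross R. \<forall>j. j \<notin> S \<longrightarrow> m $ j = 0}"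
  define u where "u a m = (\<chi> i. if i = j then a else m $ i)" for a and m :: "nat ^ 'd"
  have sub: "?C (insert j S) R \<subseteq> (\<Union>a\<in>{0..R}. u a ` ?C S (R div max 1 a))"
  proof
    fix m assume m: "m \<in> ?C (insert j S) R"
    let ?m = "u 0 m"
    have "hc_weight ?m = (\<Prod>i\<in>UNIV-{j}. max 1 (m $ i))"
      unfolding hc_weight_split[of ?m j] by (auto simp: u_def intro!: prod.cong)
    then have "max 1 (m $ j) * hc_weight ?m \<le> R"
      using m hc_weight_split[of m j] by (simp add: hyperbolic_cross_def)
    then have "hc_weight ?m \<le> R div max 1 (m $ j)"
      by (simp add: less_eq_div_iff_mult_less_eq mult.commute)
    then have "?m \<in> ?C S (R div max 1 (m $ j))" using m insert.hyps
      by (auto simp: hyperbolic_cross_def u_def)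
    then have "u (m $ j) ?m \<in> u (m $ j) ` ?C S (R div max 1 (m $ j))" by (rule imageI)
    moreover have "u (m $ j) ?m = m" by (auto simp: u_def vec_eq_iff)
    ultimately have 1: "m \<in> u (m $ j) ` ?C S (R div max 1 (m $ j))" by (simp only:)
    have 2: "m $ j \<in> {0..R}" using m component_le_hc_weight[of m j] by (simp add: hyperbolic_cross_def)
    show "m \<in> (\<Union>a\<in>{0..R}. u a ` ?C S (R div max 1 a))"
      by (rule UN_I[where a = "m $ j"]) (rule 2, rule 1)
  qed
  have fin: "finite (?C S R)" for R by (simp add: finite_hyperbolic_cross)
  have "card (?C (insert j S) R) \<le> card (\<Union>a\<in>{0..R}. u a ` ?C S (R div max 1 a))"
    using sub fin by (intro card_mono) auto
  also have "\<dots> \<le> (\<Sum>a\<in>{0..R}. card (u a ` ?C S (R div max 1 a)))" by (rule card_UN_le) simp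
  also have "\<dots> \<le> (\<Sum>a\<in>{0..R}. card (?C S (R div max 1 a)))"
    by (intro sum_mono card_image_le fin)
  finally have "real (card (?C (insert j S) R)) \<le> real (\<Sum>a\<in>{0..R}. card (?C S (R div max 1 a)))"
    by (rule of_nat_mono)
  also have "\<dots> = (\<Sum>a\<in>{0..R}. real (card (?C S (R div max 1 a))))" by (rule of_nat_sum)
  also have "\<dots> \<le> (\<Sum>a\<in>{0..R}. (2 * real R * (2 + ln (real R)) ^ (card S - 1)) * (1 / real (max 1 a)))"
  proof (intro sum_mono)
    fix a assume a: "a \<in> {0..R}"
    let ?R = "R div max 1 a"
    have R1: "?R \<ge> 1" using a insert.prems by (simp add: less_eq_div_iff_mult_less_eq)
    have "ln (real ?R) \<le> ln (real R)" using R1 by (intro ln_mono) (auto simp: div_le_dividend)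
    moreover have "ln (real ?R) \<ge> 0" using R1 by (intro ln_ge_zero) linarith
    moreover have "real ?R \<le> real R / real (max 1 a)" by (rule of_nat_div_le_of_nat)
    ultimately have "2 * real ?R * (2 + ln (real ?R)) ^ (card S - 1)
      \<le> 2 * (real R / real (max 1 a)) * (2 + ln (real R)) ^ (card S - 1)"
      by (intro mult_mono power_mono) auto
    then show "real (card (?C S ?R)) \<le> (2 * real R * (2 + ln (real R)) ^ (card S - 1)) * (1 / real (max 1 a))"
      using insert.IH[OF R1] by simp
  qed
  also have "\<dots> = (2 * real R * (2 + ln (real R)) ^ (card S - 1)) * (\<Sum>a\<in>{0..R}. 1 / real (max 1 a))"
    by (simp add: sum_distrib_left)
  also have "\<dots> \<le> (2 * real R * (2 + ln (real R)) ^ (card S - 1)) * (2 + ln (real R))"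
    using insert.prems by (intro mult_left_mono sum_inverse_max_le) auto
  also have "\<dots> = 2 * real R * (2 + ln (real R)) ^ (card (insert j S) - 1)"
    using insert.hyps by (cases "card S") (auto simp: card_gt_0_iff)
  finally show ?case .
qed

lemma card_hyperbolic_cross:
  assumes "R \<ge> 1"
  shows "real (card (hyperbolic_cross R :: (nat ^ 'd) set)) \<le> 2 * real R * (2 + ln (real R)) ^ (CARD('d) - 1)"
  using card_hyperbolic_cross_supported[of "UNIV :: 'd set" R] assms by simp

definition hc_decay :: "real \<Rightarrow> nat ^ 'd \<Rightarrow> real" where
  "hc_decay s m = real (hc_weight m) powr (- 2 * s)"

lemma hc_decay_nonneg: "hc_decay s m \<ge> 0" by (simp add: hc_decay_def)
lemma hc_decay_pos: "hc_decay s m > 0" using hc_weight_ge_1[of m] by (simp add: hc_decay_def)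

text \<open>
  On the dyadic layer between the radii \<open>2^l R\<close> and \<open>2^(l+1) R\<close> the decay is at most
  \<open>(2^l R)^(-2s)\<close> and the number of elements is bounded by \<open>card_hyperbolic_cross\<close>; since \<open>2s > 1\<close>
  the layers sum up. Only finite sums occur, so that the bound can be used without discussing
  summability.
\<close>
lemma sum_hc_decay_tail_le:
  assumes "s > 1/2"
  obtains C where "C > 0" "\<And>R F. R \<ge> 1 \<Longrightarrow> finite F \<Longrightarrow> F \<inter> hyperbolic_cross R = {} \<Longrightarrow>
      sum (hc_decay s) (F :: (nat ^ 'd) set) \<le> C * (2 + ln (real R)) ^ (CARD('d) - 1) * real R powr (1 - 2 * s)"
proof -
  define k where "k = CARD('d) - 1"
  define c where "c l = 4 * (2 powr (1 - 2 * s)) ^ l * (real l + 2) ^ k" for l :: nat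
  have "summable c"
  proof -
    define q where "q = 2 powr (1 - 2 * s)"
    have q: "0 < q" "q < 1" using assms by (auto simp: q_def powr_less_one)
    have "summable (\<lambda>l. norm (1 / (real l + 1) ^ 2 :: real))"
      using inverse_power_summable[of 2, where 'a = real] summable_Suc_iff[of "\<lambda>l. inverse (real l ^ 2)"]
      by (simp add: field_simps)
    moreover have "(\<lambda>l. 4 * q ^ l * (real l + 2) ^ k) \<in> O(\<lambda>l. 1 / (real l + 1) ^ 2)" using q by real_asymp
    ultimately have "summable (\<lambda>l. 4 * q ^ l * (real l + 2) ^ k)"
      by (rule summable_comparison_test_bigo)
    then show ?thesis by (simp add: c_def[abs_def] q_def)
  qed
  have c0: "c l \<ge> 0" for l by (simp add: c_def)
  define C where "C = suminf c + 1"
  have "suminf c \<ge> 0" by (rule suminf_nonneg) fact+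
  then have "C > 0" by (simp add: C_def)
  moreover have "sum (hc_decay s) (F :: (nat ^ 'd) set) \<le> C * (2 + ln (real R)) ^ k * real R powr (1 - 2 * s)"
    if R: "R \<ge> 1" and F: "finite F" "F \<inter> hyperbolic_cross R = {}" for R F
  proof -
    obtain L where L: "\<And>m. m \<in> F \<Longrightarrow> hc_weight m \<le> L" using F(1)
      by (metis finite_imageI finite_nat_set_iff_bounded_le image_eqI)
    define A where "A l = {m \<in> F. 2 ^ l * R < hc_weight m \<and> hc_weight m \<le> 2 ^ Suc l * R}" for l
    have lnR: "ln (real R) \<ge> 0" using R by simp
    have "F \<subseteq> (\<Union>l\<in>{..<L}. A l)"
    proof
      fix m assume m: "m \<in> F"
      \<comment> \<open>Positive because \<open>m\<close> is outside the cross, so its predecessor is a layer.\<close>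
      define l where "l = (LEAST l. hc_weight m \<le> 2 ^ l * R)"
      have "L \<le> 2 ^ L * 1" using less_exp[of L] by simp
      also have "\<dots> \<le> 2 ^ L * R" using R by (intro mult_left_mono) auto
      finally have LL: "hc_weight m \<le> 2 ^ L * R" using L[OF m] by simp
      have 1: "hc_weight m \<le> 2 ^ l * R" unfolding l_def by (rule LeastI[of _ L]) (rule LL)
      have 2: "l \<le> L" unfolding l_def by (rule Least_le) (rule LL)
      have "\<not> hc_weight m \<le> R" using m F(2) by (auto simp: hyperbolic_cross_def)
      then have "l \<noteq> 0" using 1 by (metis mult_1 power_0)
      then obtain l' where l': "l = Suc l'" by (cases l) auto
      have "\<not> hc_weight m \<le> 2 ^ l' * R"
        using not_less_Least[of l' "\<lambda>l. hc_weight m \<le> 2 ^ l * R"] unfolding l_def[symmetric] l' by auto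
      then have "m \<in> A l'" using m 1 l' by (auto simp: A_def)
      then show "m \<in> (\<Union>l\<in>{..<L}. A l)" using 2 l' by auto
    qed
    then have "sum (hc_decay s) F \<le> sum (hc_decay s) (\<Union>l\<in>{..<L}. A l)"
      using F(1) by (intro sum_mono2) (auto simp: A_def hc_decay_nonneg)
    also have "\<dots> \<le> (\<Sum>l<L. sum (hc_decay s) (A l))"
      using F(1) by (intro sum_UN_le) (auto simp: A_def hc_decay_nonneg)
    also have "\<dots> \<le> (\<Sum>l<L. c l * ((2 + ln (real R)) ^ k * real R powr (1 - 2 * s)))"
    proof (intro sum_mono)
      fix l
      have r0: "real (2 ^ l * R) > 0" using R by simp
      have "sum (hc_decay s) (A l) \<le> of_nat (card (A l)) * real (2 ^ l * R) powr (- 2 * s)"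
      proof (rule sum_bounded_above)
        fix m assume "m \<in> A l"
        then have "2 ^ l * R \<le> hc_weight m" by (auto simp: A_def)
        then have "real (2 ^ l * R) \<le> real (hc_weight m)" by (simp only: of_nat_le_iff)
        then show "hc_decay s m \<le> real (2 ^ l * R) powr (- 2 * s)"
          unfolding hc_decay_def using r0 assms by (intro powr_mono2') auto
      qed
      also have "real (card (A l)) \<le> real (card (hyperbolic_cross (2 ^ Suc l * R) :: (nat ^ 'd) set))"
        by (intro of_nat_mono card_mono finite_hyperbolic_cross) (auto simp: A_def hyperbolic_cross_def)
      also have "\<dots> \<le> 2 * real (2 ^ Suc l * R) * (2 + ln (real (2 ^ Suc l * R))) ^ k"
        using R unfolding k_def by (intro card_hyperbolic_cross) simp
      also have "(2 + ln (real (2 ^ Suc l * R))) ^ k \<le> ((2 + ln (real R)) * (real l + 2)) ^ k"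
      proof (rule power_mono)
        have "ln (real (2 ^ Suc l * R)) = (real l + 1) * ln 2 + ln (real R)"
          using R by (simp add: ln_mult ln_realpow field_simps)
        moreover have "(real l + 1) * ln 2 \<le> real l + 1" using ln_2_less_1 by (simp add: mult_left_le)
        moreover have "ln (real R) * (real l + 1) \<ge> 0" using lnR by simp
        ultimately show "2 + ln (real (2 ^ Suc l * R)) \<le> (2 + ln (real R)) * (real l + 2)"
          by (simp add: algebra_simps)
        have "1 \<le> 2 ^ Suc l * R" using R by simp
        then have "1 \<le> real (2 ^ Suc l * R)" by linarith
        then show "0 \<le> 2 + ln (real (2 ^ Suc l * R))" by (smt (verit) ln_ge_zero)
      qed
      finally have "sum (hc_decay s) (A l) \<le>
        2 * real (2 ^ Suc l * R) * ((2 + ln (real R)) * (real l + 2)) ^ k * real (2 ^ l * R) powr (- 2 * s)"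
        by (simp add: mult_right_mono mult_left_mono)
      also have "\<dots> = 4 * ((2 + ln (real R)) ^ k * (real l + 2) ^ k) * (real (2 ^ l * R) * real (2 ^ l * R) powr (- 2 * s))"
        by (simp add: power_mult_distrib)
      also have "real (2 ^ l * R) * real (2 ^ l * R) powr (- 2 * s) = real (2 ^ l * R) powr (1 - 2 * s)"
        using r0 powr_add[of "real (2 ^ l * R)" 1 "-2 * s"] by simp
      also have "\<dots> = (2 powr (1 - 2 * s)) ^ l * real R powr (1 - 2 * s)"
        by (simp add: powr_mult powr_powr mult.commute flip: powr_realpow)
      finally show "sum (hc_decay s) (A l) \<le> c l * ((2 + ln (real R)) ^ k * real R powr (1 - 2 * s))"
        by (simp add: c_def mult_ac)
    qed
    also have "\<dots> = (\<Sum>l<L. c l) * ((2 + ln (real R)) ^ k * real R powr (1 - 2 * s))"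
      by (simp add: sum_distrib_right)
    also have "\<dots> \<le> C * ((2 + ln (real R)) ^ k * real R powr (1 - 2 * s))"
      using sum_le_suminf[OF \<open>summable c\<close>, of "{..<L}"] c0 lnR
      by (intro mult_right_mono) (auto simp: C_def intro: order_trans)
    finally show ?thesis by (simp add: mult_ac)
  qed
  ultimately show ?thesis using that[of C] unfolding k_def by blast
qed

lemma hc_decay_summable:
  assumes "s > 1/2"
  shows "(hc_decay s :: nat ^ 'd \<Rightarrow> real) summable_on A"
proof -
  obtain C where C: "C > 0" "\<And>R F. R \<ge> 1 \<Longrightarrow> finite F \<Longrightarrow> F \<inter> hyperbolic_cross R = {} \<Longrightarrow>
      sum (hc_decay s) (F :: (nat ^ 'd) set) \<le> C * (2 + ln (real R)) ^ (CARD('d) - 1) * real R powr (1 - 2 * s)"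
    using sum_hc_decay_tail_le[OF assms] by metis
  have "(hc_decay s :: nat ^ 'd \<Rightarrow> real) summable_on (- hyperbolic_cross 1)"
    by (rule nonneg_bdd_above_summable_on)
       (auto intro!: bdd_aboveI2 C(2)[of 1] simp: hc_decay_nonneg subset_eq)
  then have "(hc_decay s :: nat ^ 'd \<Rightarrow> real) summable_on (- hyperbolic_cross 1 \<union> hyperbolic_cross 1)"
    by (rule summable_on_Un_disjoint) (auto simp: finite_hyperbolic_cross)
  then show ?thesis by (rule summable_on_subset_banach) auto
qed

text \<open>
  The basis functions with indices \<open>2*n - 1\<close> and \<open>2*n\<close> have frequency \<open>n\<close>; the tensor product
  with index \<open>m\<close> is a combination of the exponentials with frequency vectors in \<open>freq_set m\<close>.
\<close>
definition freq :: "nat \<Rightarrow> nat" where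
  "freq m = (m + 1) div 2"

definition freq_set :: "nat ^ 'd \<Rightarrow> (int ^ 'd) set" where
  "freq_set m = {u. \<forall>j. u $ j \<in> {int (freq (m $ j)), - int (freq (m $ j))}}"

lemma freq_setD: "u \<in> freq_set m \<Longrightarrow> \<bar>u $ j\<bar> = int (freq (m $ j))"
  unfolding freq_set_def by (auto dest!: spec[of _ j])

lemma freq_le: "freq m \<le> m" by (simp add: freq_def)

text \<open>
  If a frequency differs from \<open>a\<close> or \<open>-a\<close>, up to its sign, by a nonzero multiple of \<open>p\<close>, then it is
  \<open>p * t - a\<close> or \<open>p * t + a\<close> with \<open>t \<ge> 1\<close>, and so at least \<open>p * t / 2\<close>. Each frequency belongs to
  at most two indices, which leaves four indices for every \<open>t\<close>.
\<close>
lemma sum_decay_congruent_le: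
  assumes s: "s > 1/2" and p: "p > 0" and a: "2 * a \<le> p" and M: "finite M"
    and cong: "\<And>m. m \<in> M \<Longrightarrow> \<exists>u u'. \<bar>u\<bar> = int a \<and> \<bar>u'\<bar> = int (freq m) \<and> u + u' \<noteq> 0 \<and> int p dvd u + u'"
  shows "(\<Sum>m\<in>M. real (max 1 m) powr (- 2 * s))
           \<le> 4 * 2 powr (2 * s) * (\<Sum>t. real t powr (- 2 * s)) * real p powr (- 2 * s)"
proof -
  let ?g = "\<lambda>m. real (max 1 m) powr (- 2 * s)"
  define X where "X t = (\<Union>v\<in>{p * t - a, p * t + a}. {2 * v - 1, 2 * v})" for t
  have cover: "\<exists>t\<in>{1..2 * m}. m \<in> X t \<and> p * t \<le> 2 * m" if "m \<in> M" for m
  proof -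
    obtain u u' where u: "\<bar>u\<bar> = int a" "\<bar>u'\<bar> = int (freq m)" "u + u' \<noteq> 0" "int p dvd u + u'"
      using cong[OF \<open>m \<in> M\<close>] by blast
    obtain t where t: "u + u' = int p * t" using u(4) by (rule dvdE)
    define T where "T = nat \<bar>t\<bar>"
    have T: "T \<ge> 1" using t u(3) by (auto simp: T_def)
    have pT: "p * T \<ge> p" using T by simp
    have abs: "\<bar>u + u'\<bar> = int (p * T)" by (simp add: t abs_mult T_def)
    then have "int (freq m) = int (p * T) - int a \<or> int (freq m) = int (p * T) + int a"
      using u(1,2) a pT by linarith
    then have f: "freq m = p * T - a \<or> freq m = p * T + a" using a pT by linarith
    have "m = 2 * freq m - 1 \<or> m = 2 * freq m" unfolding freq_def by presburger
    then have "m \<in> X T" using f unfolding X_def by auto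
    moreover have "p * T \<le> 2 * freq m" using f a pT by linarith
    then have le: "p * T \<le> 2 * m" using freq_le[of m] by linarith
    moreover have "T \<le> p * T" using p by simp
    then have "T \<le> 2 * m" using le by (rule order_trans)
    ultimately show ?thesis using T le by (intro bexI[of _ T]) auto
  qed
  obtain N where N: "\<And>m. m \<in> M \<Longrightarrow> m \<le> N" using M finite_nat_set_iff_bounded_le by auto
  define Y where "Y t = {m \<in> X t. p * t \<le> 2 * m}" for t
  have finY: "finite (Y t)" for t by (simp add: Y_def X_def)
  have "M \<subseteq> (\<Union>t\<in>{1..2*N}. Y t)"
  proof
    fix m assume "m \<in> M"
    then show "m \<in> (\<Union>t\<in>{1..2*N}. Y t)" using cover[of m] N[of m] by (fastforce simp: Y_def)
  qed
  then have "sum ?g M \<le> sum ?g (\<Union>t\<in>{1..2*N}. Y t)" using finY by (intro sum_mono2) auto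
  also have "\<dots> \<le> (\<Sum>t\<in>{1..2*N}. sum ?g (Y t))" by (intro sum_UN_le finY) auto
  also have "\<dots> \<le> (\<Sum>t\<in>{1..2*N}. (4 * 2 powr (2 * s) * real p powr (- 2 * s)) * real t powr (- 2 * s))"
  proof (intro sum_mono)
    fix t assume t: "t \<in> {1..2*N}"
    have "sum ?g (Y t) \<le> of_nat (card (Y t)) * ((real p * real t / 2) powr (- 2 * s))"
    proof (rule sum_bounded_above)
      fix m assume "m \<in> Y t"
      then have "real (p * t) \<le> real (2 * m)" unfolding Y_def by (simp only: of_nat_le_iff mem_Collect_eq)
      then have "real p * real t / 2 \<le> real (max 1 m)" by simp
      then show "?g m \<le> (real p * real t / 2) powr (- 2 * s)"
        using s p t by (intro powr_mono2') auto
    qed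
    also have "card (Y t) \<le> card (X t)" by (intro card_mono) (auto simp: X_def Y_def)
    also have "card (X t) \<le> 4"
    proof -
      have "X t = {2 * (p * t - a) - 1, 2 * (p * t - a), 2 * (p * t + a) - 1, 2 * (p * t + a)}"
        by (auto simp: X_def)
      also have "card \<dots> \<le> 4" by (intro card_insert_le_m1) auto
      finally show ?thesis .
    qed
    also have "(real p * real t / 2) powr (- 2 * s) = 2 powr (2 * s) * real p powr (- 2 * s) * real t powr (- 2 * s)"
      by (simp add: powr_mult powr_divide powr_minus field_simps)
    finally show "sum ?g (Y t) \<le> (4 * 2 powr (2 * s) * real p powr (- 2 * s)) * real t powr (- 2 * s)"
      by (simp add: mult_right_mono)
  qed
  also have "\<dots> = (4 * 2 powr (2 * s) * real p powr (- 2 * s)) * (\<Sum>t\<in>{1..2*N}. real t powr (- 2 * s))"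
    by (simp add: sum_distrib_left)
  also have "\<dots> \<le> (4 * 2 powr (2 * s) * real p powr (- 2 * s)) * (\<Sum>t. real t powr (- 2 * s))"
    using s by (intro mult_left_mono sum_le_suminf) (auto simp: summable_real_powr_iff)
  finally show ?thesis by (simp add: mult_ac)
qed

text \<open>
  The indices \<open>k\<close> that alias with \<open>h\<close> whatever the generator is, because a nonzero frequency of
  the product of the two basis functions vanishes modulo \<open>p\<close>.
\<close>
definition congruent_indices :: "nat \<Rightarrow> nat ^ 'd \<Rightarrow> (nat ^ 'd) set" where
  "congruent_indices p h = {k. \<exists>u\<in>freq_set h. \<exists>u'\<in>freq_set k. u + u' \<noteq> 0 \<and> (\<forall>j. int p dvd u $ j + u' $ j)}"

text \<open>
  Some coordinate of a congruent index is covered by \<open>sum_decay_congruent_le\<close>, which gains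
  \<open>p^(-2s)\<close>; the sums over the other coordinates are bounded by a constant.
\<close>
lemma sum_hc_decay_congruent_le:
  assumes s: "s > 1/2"
  obtains C where "C > 0" "\<And>p h F. p > 0 \<Longrightarrow> (\<And>j. 2 * freq (h $ j) \<le> p) \<Longrightarrow> finite F \<Longrightarrow>
     F \<subseteq> congruent_indices p h \<Longrightarrow> sum (hc_decay s) (F :: (nat ^ 'd) set) \<le> C * real p powr (- 2 * s)"
proof -
  let ?g = "\<lambda>m::nat. real (max 1 m) powr (- 2 * s)"
  define z where "z = (\<Sum>t. real t powr (- 2 * s))"
  have sm: "summable (\<lambda>t. real t powr (- 2 * s))" using s by (simp add: summable_real_powr_iff)
  have z0: "z \<ge> 0" unfolding z_def by (intro suminf_nonneg sm) simp
  have g_sum: "sum ?g {..N} \<le> 1 + z" for N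
  proof -
    have "sum ?g {..N} \<le> sum ?g (insert 0 {1..N})" by (intro sum_mono2) auto
    also have "\<dots> = 1 + sum ?g {1..N}" by simp
    also have "sum ?g {1..N} = (\<Sum>t\<in>{1..N}. real t powr (- 2 * s))" by (intro sum.cong) auto
    also have "\<dots> \<le> z" unfolding z_def by (intro sum_le_suminf sm) auto
    finally show ?thesis by simp
  qed
  define C where "C = real CARD('d) * ((4 * 2 powr (2 * s) * (z + 1)) * (1 + z) ^ (CARD('d) - 1))"
  have "C > 0" unfolding C_def using z0 by (intro mult_pos_pos zero_less_power) auto
  moreover have "sum (hc_decay s) F \<le> C * real p powr (- 2 * s)"
    if p: "p > 0" and h: "\<And>j. 2 * freq (h $ j) \<le> p" and F: "finite F" "F \<subseteq> congruent_indices p h"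
    for p h and F :: "(nat ^ 'd) set"
  proof -
    have "finite (\<Union>m\<in>F. range (vec_nth m))" using F(1) by auto
    then obtain N where N: "\<forall>x\<in>(\<Union>m\<in>F. range (vec_nth m)). x \<le> N"
      by (meson finite_nat_set_iff_bounded_le)
    define M where "M a = {m \<in> {..N}. \<exists>u u'. \<bar>u\<bar> = int a \<and> \<bar>u'\<bar> = int (freq m) \<and> u + u' \<noteq> 0 \<and> int p dvd u + u'}" for a
    define B where "B i = {k. \<forall>j. k $ j \<in> (if j = i then M (freq (h $ i)) else {..N})}" for i :: 'd
    have finB: "finite (B i)" for i unfolding B_def by (rule finite_vec_set) (auto simp: M_def)
    have "F \<subseteq> (\<Union>i. B i)"
    proof
      fix k assume k: "k \<in> F"
      then obtain u u' where u: "u \<in> freq_set h" "u' \<in> freq_set k" "u + u' \<noteq> 0" "\<forall>j. int p dvd u $ j + u' $ j"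
        using F(2) unfolding congruent_indices_def by blast
      from u(3) obtain i where i: "u $ i + u' $ i \<noteq> 0" by (auto simp: vec_eq_iff)
      have kN: "k $ j \<le> N" for j using N k by blast
      have "\<bar>u $ i\<bar> = int (freq (h $ i))" "\<bar>u' $ i\<bar> = int (freq (k $ i))"
        by (rule freq_setD[OF u(1)], rule freq_setD[OF u(2)])
      then have "k $ i \<in> M (freq (h $ i))" using i u(4) kN unfolding M_def by blast
      then have "k \<in> B i" using kN unfolding B_def by auto
      then show "k \<in> (\<Union>i. B i)" by blast
    qed
    then have "sum (hc_decay s) F \<le> sum (hc_decay s) (\<Union>i\<in>UNIV. B i)"
      using finB by (intro sum_mono2) (auto simp: hc_decay_nonneg)
    also have "\<dots> \<le> (\<Sum>i\<in>UNIV. sum (hc_decay s) (B i))" by (intro sum_UN_le finB) (auto simp: hc_decay_nonneg)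
    also have "\<dots> \<le> (\<Sum>i\<in>(UNIV::'d set). (4 * 2 powr (2 * s) * (z + 1)) * real p powr (- 2 * s) * (1 + z) ^ (CARD('d) - 1))"
    proof (intro sum_mono)
      fix i :: 'd
      have dec: "hc_decay s m = (\<Prod>j\<in>UNIV. ?g (m $ j))" for m :: "nat ^ 'd"
        unfolding hc_decay_def hc_weight_def of_nat_prod by (rule prod_powr_distrib)
      have "sum (hc_decay s) (B i) = (\<Prod>j\<in>UNIV. \<Sum>a\<in>(if j = i then M (freq (h $ i)) else {..N}). ?g a)"
        unfolding dec B_def by (subst prod_sum_vec) (auto simp: M_def)
      also have "\<dots> = sum ?g (M (freq (h $ i))) * (\<Prod>j\<in>UNIV-{i}. sum ?g {..N})"
        by (subst prod.remove[of _ i]) auto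
      also have "\<dots> \<le> ((4 * 2 powr (2 * s) * (z + 1)) * real p powr (- 2 * s)) * (\<Prod>j\<in>UNIV-{i}. 1 + z)"
      proof (intro mult_mono prod_mono conjI g_sum)
        have "sum ?g (M (freq (h $ i))) \<le> 4 * 2 powr (2 * s) * z * real p powr (- 2 * s)"
          unfolding z_def using s p h by (intro sum_decay_congruent_le) (auto simp: M_def)
        also have "\<dots> \<le> (4 * 2 powr (2 * s) * (z + 1)) * real p powr (- 2 * s)"
          by (intro mult_right_mono mult_left_mono) auto
        finally show "sum ?g (M (freq (h $ i))) \<le> (4 * 2 powr (2 * s) * (z + 1)) * real p powr (- 2 * s)" .
      qed (use z0 in \<open>auto intro!: sum_nonneg prod_nonneg zero_le_power\<close>)
      finally show "sum (hc_decay s) (B i) \<le> (4 * 2 powr (2 * s) * (z + 1)) * real p powr (- 2 * s) * (1 + z) ^ (CARD('d) - 1)"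
        by simp
    qed
    also have "\<dots> = C * real p powr (- 2 * s)" by (simp add: C_def)
    finally show ?thesis .
  qed
  ultimately show ?thesis using that[of C] by blast
qed

section \<open>The basis and the exponentials\<close>

definition texp :: "int ^ 'd \<Rightarrow> real ^ 'd \<Rightarrow> complex" where
  "texp v x = (\<Prod>j\<in>UNIV. cis (2 * pi * of_int (v $ j) * x $ j))"

lemma texp_add: "texp (u + v) x = texp u x * texp v x"
  by (simp add: texp_def prod.distrib[symmetric] cis_mult algebra_simps)

lemma texp_0 [simp]: "texp 0 x = 1"
  by (simp add: texp_def)

lemma norm_texp [simp]: "norm (texp v x) = 1"
  by (simp add: texp_def flip: prod_norm)

lemma cis_sum: "cis (\<Sum>i\<in>A. f i) = (\<Prod>i\<in>A. cis (f i))"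
  by (induction A rule: infinite_finite_induct) (auto simp flip: cis_mult)

text \<open>The Fourier coefficient of \<open>basis1 m\<close> at the frequency \<open>a\<close>, provided \<open>\<bar>a\<bar> = freq m\<close>.\<close>
definition basis1_coeff :: "nat \<Rightarrow> int \<Rightarrow> complex" where
  "basis1_coeff m a = (if m = 0 then 1 else if even m then of_real (sqrt 2 / 2)
                       else - \<i> * of_real (sqrt 2 / 2) * of_int (sgn a))"

definition basis_coeff :: "nat ^ 'd \<Rightarrow> int ^ 'd \<Rightarrow> complex" where
  "basis_coeff m u = (\<Prod>j\<in>UNIV. basis1_coeff (m $ j) (u $ j))"

lemma basis1_expansion:
  "complex_of_real (basis1 m t) =
     (\<Sum>a\<in>{int (freq m), - int (freq m)}. basis1_coeff m a * cis (2 * pi * of_int a * t))"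
proof (cases "m = 0")
  case True
  then show ?thesis by (simp add: freq_def basis1_def basis1_coeff_def)
next
  case False
  then have f: "int (freq m) \<noteq> - int (freq m)" "sgn (int (freq m)) = 1" by (auto simp: freq_def)
  have e: "even m \<Longrightarrow> m div 2 = freq m" by (simp add: freq_def)
  define \<theta> where "\<theta> = 2 * pi * real (freq m) * t"
  have "(\<Sum>a\<in>{int (freq m), - int (freq m)}. basis1_coeff m a * cis (2 * pi * of_int a * t))
      = basis1_coeff m (int (freq m)) * cis \<theta> + basis1_coeff m (- int (freq m)) * cis (- \<theta>)"
    using f by (simp add: \<theta>_def)
  also have "\<dots> = complex_of_real (basis1 m t)"
  proof (cases "even m")
    case True
    then show ?thesis using False e[OF True] f
      by (simp add: basis1_coeff_def basis1_def \<theta>_def[symmetric] complex_eq_iff)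
  next
    case odd: False
    then have "basis1 m t = sqrt 2 * sin \<theta>"
      using False by (simp only: basis1_def \<theta>_def freq_def if_False)
    then show ?thesis using False odd f
      by (simp add: basis1_coeff_def complex_eq_iff sgn_minus)
  qed
  finally show ?thesis ..
qed

lemma finite_freq_set [simp]: "finite (freq_set m)"
  unfolding freq_set_def by (rule finite_vec_set) auto

lemma card_freq_set: "card (freq_set (m :: nat ^ 'd)) \<le> 2 ^ CARD('d)"
proof -
  have "card (freq_set m) = (\<Prod>j\<in>UNIV. card {int (freq (m $ j)), - int (freq (m $ j))})"
    unfolding freq_set_def by (rule card_vec_set)
  also have "\<dots> \<le> (\<Prod>j\<in>(UNIV :: 'd set). 2)"
    by (intro prod_mono conjI) (auto intro: card_insert_le_m1)
  finally show ?thesis by simp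
qed

lemma basis_expansion:
  "complex_of_real (basis m x) = (\<Sum>u\<in>freq_set m. basis_coeff m u * texp u x)"
proof -
  have "complex_of_real (basis m x) = (\<Prod>j\<in>UNIV. \<Sum>a\<in>{int (freq (m $ j)), - int (freq (m $ j))}.
     basis1_coeff (m $ j) a * cis (2 * pi * of_int a * x $ j))"
    by (simp only: basis_def of_real_prod basis1_expansion)
  also have "\<dots> = (\<Sum>u\<in>freq_set m. \<Prod>j\<in>UNIV. basis1_coeff (m $ j) (u $ j) * cis (2 * pi * of_int (u $ j) * x $ j))"
    unfolding freq_set_def by (rule prod_sum_vec) auto
  finally show ?thesis by (simp add: prod.distrib basis_coeff_def texp_def)
qed

text \<open>Conversely, the coefficient of \<open>basis1 m\<close> in the exponential of frequency \<open>a\<close>.\<close>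
definition cis_coeff :: "int \<Rightarrow> nat \<Rightarrow> complex" where
  "cis_coeff a m = (if a = 0 then 1 else if even m then of_real (sqrt 2 / 2)
                    else \<i> * of_real (sqrt 2 / 2) * of_int (sgn a))"

lemma cis_expansion:
  "cis (2 * pi * of_int a * t) =
     (\<Sum>m\<in>{2 * nat \<bar>a\<bar>, 2 * nat \<bar>a\<bar> - 1}. cis_coeff a m * complex_of_real (basis1 m t))"
proof (cases "a = 0")
  case True
  then show ?thesis by (simp add: cis_coeff_def basis1_def)
next
  case False
  define n where "n = nat \<bar>a\<bar>"
  have n: "n > 0" "2 * n \<noteq> 2 * n - 1" using False by (auto simp: n_def)
  define \<theta> where "\<theta> = 2 * pi * real n * t"
  have o: "odd (2 * n - 1)" "2 * n - 1 \<noteq> 0" "(2 * n - 1 + 1) div 2 = n" using n by auto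
  have s2: "complex_of_real (sqrt 2) * complex_of_real (sqrt 2) = 2"
    by (simp flip: of_real_mult)
  have "(\<Sum>m\<in>{2 * n, 2 * n - 1}. cis_coeff a m * complex_of_real (basis1 m t))
      = cis_coeff a (2 * n) * complex_of_real (basis1 (2 * n) t)
        + cis_coeff a (2 * n - 1) * complex_of_real (basis1 (2 * n - 1) t)" using n by simp
  also have "basis1 (2 * n) t = sqrt 2 * cos \<theta>" using n by (simp add: basis1_def \<theta>_def)
  also have "basis1 (2 * n - 1) t = sqrt 2 * sin \<theta>" using o by (simp only: basis1_def \<theta>_def if_False)
  also have "cis_coeff a (2 * n) = of_real (sqrt 2 / 2)" using False by (simp add: cis_coeff_def)
  also have "cis_coeff a (2 * n - 1) = \<i> * of_real (sqrt 2 / 2) * of_int (sgn a)"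
    using False o by (simp add: cis_coeff_def)
  also have "of_real (sqrt 2 / 2) * of_real (sqrt 2 * cos \<theta>)
      + \<i> * of_real (sqrt 2 / 2) * of_int (sgn a) * complex_of_real (sqrt 2 * sin \<theta>)
      = cis (of_int (sgn a) * \<theta>)"
    using False s2 by (cases "a > 0") (auto simp: complex_eq_iff)
  also have "of_int (sgn a) * \<theta> = 2 * pi * of_int a * t"
    using False by (cases "a > 0") (auto simp: \<theta>_def n_def)
  finally show ?thesis by (simp add: n_def)
qed

lemma texp_expansion:
  "\<exists>B c. finite B \<and> (\<forall>x. texp v x = (\<Sum>m\<in>B. c m * complex_of_real (basis m x)))"
proof (intro exI conjI allI)
  define A where "A j = {2 * nat \<bar>v $ j\<bar>, 2 * nat \<bar>v $ j\<bar> - 1}" for j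
  let ?B = "{m. \<forall>j. m $ j \<in> A j}"
  show "finite ?B" by (rule finite_vec_set) (simp add: A_def)
  show "texp v x = (\<Sum>m\<in>?B. (\<Prod>j\<in>UNIV. cis_coeff (v $ j) (m $ j)) * complex_of_real (basis m x))" for x
    unfolding texp_def cis_expansion A_def[symmetric]
    by (subst prod_sum_vec) (auto simp: A_def prod.distrib basis_def)
qed

lemma abs_basis1_le: "\<bar>basis1 m t\<bar> \<le> sqrt 2"
proof -
  have "1 \<le> sqrt (2::real)" by simp
  moreover have "\<bar>sqrt 2 * y\<bar> \<le> sqrt 2" if "\<bar>y\<bar> \<le> 1" for y :: real
    using that by (simp add: abs_mult mult_left_le)
  ultimately show ?thesis by (auto simp: basis1_def)
qed

lemma basis_sq_le: "(basis m x)\<^sup>2 \<le> 2 ^ CARD('d)" for m :: "nat ^ 'd"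
proof -
  have "(basis m x)\<^sup>2 = (\<Prod>j\<in>UNIV. (basis1 (m $ j) (x $ j))\<^sup>2)"
    by (simp add: basis_def prod_power_distrib)
  also have "\<dots> \<le> (\<Prod>j\<in>(UNIV::'d set). 2)"
  proof (intro prod_mono conjI)
    fix j :: 'd
    have "\<bar>basis1 (m $ j) (x $ j)\<bar> ^ 2 \<le> sqrt 2 ^ 2"
      by (intro power_mono abs_basis1_le) auto
    then show "(basis1 (m $ j) (x $ j))\<^sup>2 \<le> 2" by simp
  qed simp
  finally show ?thesis by simp
qed

lemma abs_basis_le: "\<bar>basis m x\<bar> \<le> sqrt (2 ^ CARD('d))" for m :: "nat ^ 'd"
  using basis_sq_le[of m x] by (simp add: real_le_rsqrt)

lemma continuous_on_basis: "continuous_on A (basis m)"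
proof -
  have "continuous_on A (\<lambda>x. basis1 k (x $ j))" for k j
    unfolding basis1_def by (cases "k = 0"; cases "even k") (auto intro!: continuous_intros)
  then show ?thesis unfolding basis_def[abs_def] by (intro continuous_on_prod) auto
qed

lemma texp_periodic: "texp v (\<chi> j. frac (x $ j)) = texp v x"
proof -
  have "cis (2 * pi * of_int a * frac t) = cis (2 * pi * of_int a * t)" for a t
  proof -
    have "cis (2 * pi * of_int a * frac t) = cis (2 * pi * of_int a * t) * cis (2 * pi * of_int (- a * \<lfloor>t\<rfloor>))"
      by (simp add: cis_mult frac_def algebra_simps)
    also have "cis (2 * pi * of_int (- a * \<lfloor>t\<rfloor>)) = 1" by (rule cis_multiple_2pi) simp
    finally show ?thesis by simp
  qed
  then show ?thesis by (simp add: texp_def)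
qed

lemma basis_periodic: "basis m (\<chi> j. frac (x $ j)) = basis m x"
proof -
  have "complex_of_real (basis m (\<chi> j. frac (x $ j))) = complex_of_real (basis m x)"
    by (simp add: basis_expansion texp_periodic)
  then show ?thesis by (simp only: of_real_eq_iff)
qed

section \<open>Integrals over the torus and orthonormality\<close>

lemma integral_lborel_prod:
  fixes f :: "'a::euclidean_space \<Rightarrow> real \<Rightarrow> complex"
  assumes "\<And>b. b \<in> Basis \<Longrightarrow> integrable lborel (f b)"
  shows "(LINT x|lborel. (\<Prod>b\<in>Basis. f b (x \<bullet> b))) = (\<Prod>b\<in>Basis. LINT x|lborel. f b x)"
proof -
  interpret product_sigma_finite "\<lambda>_ :: 'a. lborel :: real measure" ..
  have [measurable]: "f b \<in> borel_measurable borel" if "b \<in> Basis" for b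
    using assms[OF that] by simp
  have "(LINT x|lborel. (\<Prod>b\<in>Basis. f b (x \<bullet> b)))
      = (LINT g|(\<Pi>\<^sub>M b\<in>Basis. lborel). (\<Prod>b\<in>Basis. f b ((\<Sum>b\<in>Basis. g b *\<^sub>R b) \<bullet> b)))"
    unfolding lborel_eq[where 'a = 'a] by (subst integral_distr) simp_all
  also have "\<dots> = (LINT g|(\<Pi>\<^sub>M b\<in>(Basis :: 'a set). lborel). (\<Prod>b\<in>Basis. f b (g b)))"
    by (intro Bochner_Integration.integral_cong refl prod.cong) (simp_all)
  also have "\<dots> = (\<Prod>b\<in>Basis. LINT x|lborel. f b x)"
    using assms by (intro product_integral_prod) auto
  finally show ?thesis .
qed

lemma integral_cis_unit_interval:
  fixes k :: int
  shows "integrable lborel (\<lambda>t. indicator {0..<1} t *\<^sub>R cis (2 * pi * of_int k * t))"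
    and "(LINT t|lborel. indicator {0..<1} t *\<^sub>R cis (2 * pi * of_int k * t)) = (if k = 0 then 1 else 0)"
proof -
  let ?f = "\<lambda>t. cis (2 * pi * of_int k * t)"
  have cont: "continuous_on A ?f" for A
    unfolding cis_conv_exp by (intro continuous_intros)
  have meas: "?f \<in> borel_measurable borel" using cont[of UNIV] by (rule borel_measurable_continuous_onI)
  have i1: "set_integrable lborel {0..1} ?f" by (intro borel_integrable_atLeastAtMost' cont)
  then show int: "integrable lborel (\<lambda>t. indicator {0..<1} t *\<^sub>R ?f t)"
    unfolding set_integrable_def[symmetric] by (rule set_integrable_subset) auto
  have "(LINT t|lborel. indicator {0..<1} t *\<^sub>R ?f t) = (LINT t|lborel. indicator {0..1} t *\<^sub>R ?f t)"
  proof (rule integral_cong_AE)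
    show "AE t in lborel. indicator {0..<1} t *\<^sub>R ?f t = indicator {0..1} t *\<^sub>R ?f t"
      using AE_lborel_singleton[of 1] by eventually_elim (auto split: split_indicator)
  qed (use meas in measurable)
  also have "\<dots> = (if k = 0 then 1 else 0)"
  proof (cases "k = 0")
    case True
    then show ?thesis by simp
  next
    case False
    define F where "F t = cis (2 * pi * of_int k * t) / (2 * pi * of_int k * \<i>)" for t
    have "(LINT t|lborel. indicator {0..1} t *\<^sub>R ?f t) = F 1 - F 0"
    proof (rule integral_FTC_atLeastAtMost)
      fix x :: real
      have "((\<lambda>t. cis (2 * pi * of_int k * t)) has_vector_derivative (2 * pi * of_int k * \<i>) * cis (2 * pi * of_int k * x)) (at x within {0..1})"
        unfolding cis_conv_exp
        by (rule has_vector_derivative_real_field derivative_eq_intros refl | simp)+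
      then show "(F has_vector_derivative ?f x) (at x within {0..1})"
        unfolding F_def using False by (auto intro!: derivative_eq_intros)
    qed (use cont in auto)
    also have "F 1 = F 0" using cis_multiple_2pi[of "of_int k"] by (simp add: F_def)
    finally show ?thesis using False by simp
  qed
  finally show "(LINT t|lborel. indicator {0..<1} t *\<^sub>R ?f t) = (if k = 0 then 1 else 0)" .
qed

lemma torus_borel [measurable]: "(torus :: (real ^ 'd) set) \<in> sets borel"
proof -
  have "(torus :: (real ^ 'd) set) = (\<Inter>j. {x. 0 \<le> x $ j} \<inter> {x. x $ j < 1})"
    by (auto simp: torus_def)
  also have "\<dots> \<in> sets borel"
    by (intro sets.countable_INT'' sets.Int)
       (auto intro!: borel_closed borel_open closed_halfspace_component_ge_cart open_halfspace_component_lt_cart)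
  finally show ?thesis .
qed

lemma torus_lmeasurable: "(torus :: (real ^ 'd) set) \<in> lmeasurable"
proof (rule bounded_set_imp_lmeasurable)
  have "(torus :: (real ^ 'd) set) \<subseteq> cbox 0 1"
    by (auto simp: torus_def mem_box_cart less_imp_le)
  then show "bounded (torus :: (real ^ 'd) set)" by (rule bounded_subset[OF bounded_cbox])
  show "(torus :: (real ^ 'd) set) \<in> sets lebesgue"
    using torus_borel by (simp add: sets_completionI_sets)
qed

lemma finite_measure_torus: "finite_measure (lebesgue_on (torus :: (real ^ 'd) set))"
  using torus_lmeasurable by (rule finite_measure_lebesgue_on)

lemma continuous_on_texp: "continuous_on A (texp v)"
  unfolding texp_def[abs_def] cis_conv_exp by (intro continuous_intros)

lemma integral_texp:
  fixes v :: "int ^ 'd"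
  shows "(LINT x|lebesgue_on torus. texp v x) = (if v = 0 then 1 else 0)"
proof -
  define V :: "real ^ 'd" where "V = (\<chi> j. of_int (v $ j))"
  define f where "f b t = indicator {0..<1} t *\<^sub>R cis (2 * pi * (V \<bullet> b) * t)" for b :: "real ^ 'd" and t :: real
  have V: "V \<bullet> axis j 1 = of_int (v $ j)" for j by (simp add: V_def inner_axis)
  have basis: "(Basis :: (real ^ 'd) set) = (\<lambda>j. axis j 1) ` UNIV"
    by (auto simp: Basis_vec_def)
  have inj: "inj (\<lambda>j :: 'd. axis j (1 :: real))" by (auto simp: inj_def axis_eq_axis)
  have f1: "f (axis j 1) = (\<lambda>t. indicator {0..<1} t *\<^sub>R cis (2 * pi * of_int (v $ j) * t))" for j
    by (rule ext) (simp add: f_def V)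
  have meas: "texp v \<in> borel_measurable borel"
    using continuous_on_texp[of UNIV] by (rule borel_measurable_continuous_onI)
  have "(LINT x|lebesgue_on torus. texp v x) = (LINT x|lebesgue. indicator torus x *\<^sub>R texp v x)"
    using torus_lmeasurable by (subst integral_restrict_space) auto
  also have "\<dots> = (LINT x|lborel. indicator torus x *\<^sub>R texp v x)"
    using meas by (intro integral_completion) (measurable)
  also have "(\<lambda>x. indicator torus x *\<^sub>R texp v x) = (\<lambda>x. \<Prod>b\<in>Basis. f b (x \<bullet> b))"
  proof
    fix x :: "real ^ 'd"
    have "(\<Prod>b\<in>Basis. f b (x \<bullet> b)) = (\<Prod>j\<in>UNIV. f (axis j 1) (x $ j))"
      unfolding basis by (subst prod.reindex[OF inj]) (simp add: inner_axis)
    also have "\<dots> = (\<Prod>j\<in>UNIV. complex_of_real (indicator {0..<1} (x $ j))) * texp v x"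
      by (simp add: f1 texp_def scaleR_conv_of_real prod.distrib)
    also have "(\<Prod>j\<in>UNIV. complex_of_real (indicator {0..<1} (x $ j))) = of_real (indicator torus x)"
      by (auto simp: torus_def indicator_def prod_zero_iff)
    finally show "indicator torus x *\<^sub>R texp v x = (\<Prod>b\<in>Basis. f b (x \<bullet> b))"
      by (simp add: scaleR_conv_of_real)
  qed
  also have "(LINT x|lborel. (\<Prod>b\<in>Basis. f b (x \<bullet> b))) = (\<Prod>b\<in>Basis. (LINT t|lborel. f b t))"
    by (rule integral_lborel_prod) (auto simp: basis f1 integral_cis_unit_interval)
  also have "\<dots> = (\<Prod>j\<in>UNIV. if v $ j = 0 then 1 else 0)"
    unfolding basis by (subst prod.reindex[OF inj]) (simp add: f1 integral_cis_unit_interval)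
  also have "\<dots> = (if v = 0 then 1 else 0)"
    by (auto simp: vec_eq_iff prod_zero_iff)
  finally show ?thesis .
qed

lemma torus_integrable_bounded:
  fixes f :: "real ^ 'd \<Rightarrow> 'b::{banach, second_countable_topology}"
  assumes "f \<in> borel_measurable (lebesgue_on torus)" "\<And>x. x \<in> torus \<Longrightarrow> norm (f x) \<le> B"
  shows "integrable (lebesgue_on torus) f"
proof -
  interpret finite_measure "lebesgue_on (torus :: (real ^ 'd) set)" by (rule finite_measure_torus)
  show ?thesis using assms by (intro integrable_const_bound[of _ B]) (auto intro!: AE_I2)
qed

lemma measurable_torus_continuous:
  fixes f :: "real ^ 'd \<Rightarrow> 'b::topological_space"
  assumes "continuous_on UNIV f" shows "f \<in> borel_measurable (lebesgue_on torus)"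
  using borel_measurable_continuous_onI[OF assms]
  by (intro measurable_restrict_space1 measurable_completion) simp

lemma integrable_texp: "integrable (lebesgue_on torus) (texp v)"
  by (rule torus_integrable_bounded[where B = 1])
     (auto intro!: measurable_torus_continuous continuous_on_texp)

lemma measure_torus: "measure (lebesgue_on (torus :: (real ^ 'd) set)) torus = 1"
proof -
  interpret finite_measure "lebesgue_on (torus :: (real ^ 'd) set)" by (rule finite_measure_torus)
  have "complex_of_real (measure (lebesgue_on (torus :: (real ^ 'd) set)) torus) = 1"
    using integral_texp[of "0 :: int ^ 'd"] by (simp add: scaleR_conv_of_real)
  then show ?thesis by (simp only: of_real_eq_1_iff)
qed

text \<open>
  The value at the product of two basis functions of the linear functional that maps an exponential
  to 1 or 0 according to a predicate \<open>P\<close> on its frequency. The integral over the torus is the case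
  \<open>v = 0\<close>; the mean over a rank-1 lattice is the case that \<open>p\<close> divides the inner product of \<open>v\<close>
  with the generator. Comparing the two predicates compares the two functionals.
\<close>
definition basis_corr :: "(int ^ 'd \<Rightarrow> bool) \<Rightarrow> nat ^ 'd \<Rightarrow> nat ^ 'd \<Rightarrow> complex" where
  "basis_corr P h k = (\<Sum>u\<in>freq_set h. \<Sum>u'\<in>freq_set k.
     basis_coeff h u * basis_coeff k u' * (if P (u + u') then 1 else 0))"

lemma L2_inner_basis_corr: "complex_of_real (L2_inner (basis h) (basis k)) = basis_corr (\<lambda>v. v = 0) h k"
proof -
  have "complex_of_real (L2_inner (basis h) (basis k))
      = (LINT x|lebesgue_on torus. complex_of_real (basis h x * basis k x))"
    unfolding L2_inner_def by (rule integral_complex_of_real[symmetric])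
  also have "\<dots> = (LINT x|lebesgue_on torus. (\<Sum>u\<in>freq_set h. \<Sum>u'\<in>freq_set k.
      (basis_coeff h u * basis_coeff k u') * texp (u + u') x))"
    by (simp add: basis_expansion sum_product texp_add mult_ac)
  also have "\<dots> = basis_corr (\<lambda>v. v = 0) h k"
    unfolding basis_corr_def by (simp add: Bochner_Integration.integral_sum integrable_texp integral_texp)
  finally show ?thesis .
qed

lemma basis1_corr:
  assumes "freq m = freq n"
  shows "(\<Sum>a\<in>{int (freq m), - int (freq m)}. basis1_coeff m a * basis1_coeff n (- a))
           = (if m = n then 1 else 0)"
proof (cases "freq m = 0")
  case True
  then have "m = 0" "n = 0" using assms by (auto simp: freq_def)
  then show ?thesis by (simp add: basis1_coeff_def freq_def)
next
  case False
  then have nz: "m \<noteq> 0" "n \<noteq> 0" using assms by (auto simp: freq_def)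
  have par: "m = n \<longleftrightarrow> (even m \<longleftrightarrow> even n)" using assms nz unfolding freq_def by presburger
  have s2: "complex_of_real (sqrt 2) * complex_of_real (sqrt 2) = 2"
    by (simp flip: of_real_mult)
  have "(\<Sum>a\<in>{int (freq m), - int (freq m)}. basis1_coeff m a * basis1_coeff n (- a))
     = basis1_coeff m (int (freq m)) * basis1_coeff n (- int (freq m))
       + basis1_coeff m (- int (freq m)) * basis1_coeff n (int (freq m))"
    using False by simp
  also have "\<dots> = (if m = n then 1 else 0)"
    unfolding par using nz False s2
    by (cases "even m"; cases "even n") (simp_all add: basis1_coeff_def sgn_minus field_simps)
  finally show ?thesis .
qed

text \<open>
  If all frequencies agree, then each \<open>u\<close> is paired with \<open>-u\<close> only and the sum factors into
  one-dimensional sums; in these a sine and a cosine of the same frequency cancel.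
\<close>
lemma basis_corr_eq_0: "basis_corr (\<lambda>v. v = 0) h k = (if h = k then 1 else 0)"
proof (cases "\<forall>j. freq (h $ j) = freq (k $ j)")
  case False
  then obtain j where j: "freq (h $ j) \<noteq> freq (k $ j)" by auto
  then have "h \<noteq> k" by auto
  have "u + u' \<noteq> 0" if "u \<in> freq_set h" "u' \<in> freq_set k" for u u'
  proof
    assume "u + u' = 0"
    then have "u' = - u" by (simp add: add_eq_0_iff)
    then have "\<bar>u' $ j\<bar> = \<bar>u $ j\<bar>" by simp
    then show False using freq_setD[OF that(1), of j] freq_setD[OF that(2), of j] j by simp
  qed
  then show ?thesis using \<open>h \<noteq> k\<close> unfolding basis_corr_def by (auto intro!: sum.neutral)
next
  case True
  then have eq: "freq_set k = freq_set h" by (simp add: freq_set_def)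
  have "basis_corr (\<lambda>v. v = 0) h k = (\<Sum>u\<in>freq_set h. basis_coeff h u * basis_coeff k (- u))"
    unfolding basis_corr_def
  proof (intro sum.cong refl)
    fix u assume u: "u \<in> freq_set h"
    then have m: "- u \<in> freq_set k" unfolding eq by (auto simp: freq_set_def)
    have "(\<Sum>u'\<in>freq_set k. basis_coeff h u * basis_coeff k u' * (if u + u' = 0 then 1 else 0))
       = (\<Sum>u'\<in>freq_set k. if u' = - u then basis_coeff h u * basis_coeff k u' else 0)"
      by (intro sum.cong refl) (auto simp: add_eq_0_iff)
    also have "\<dots> = basis_coeff h u * basis_coeff k (- u)" using m by (simp add: sum.delta)
    finally show "(\<Sum>u'\<in>freq_set k. basis_coeff h u * basis_coeff k u' * (if u + u' = 0 then 1 else 0))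
       = basis_coeff h u * basis_coeff k (- u)" .
  qed
  also have "\<dots> = (\<Sum>u\<in>freq_set h. \<Prod>j\<in>UNIV. basis1_coeff (h $ j) (u $ j) * basis1_coeff (k $ j) (- (u $ j)))"
    by (simp add: basis_coeff_def prod.distrib)
  also have "\<dots> = (\<Prod>j\<in>UNIV. \<Sum>a\<in>{int (freq (h $ j)), - int (freq (h $ j))}.
      basis1_coeff (h $ j) a * basis1_coeff (k $ j) (- a))"
    unfolding freq_set_def by (rule prod_sum_vec[symmetric]) auto
  also have "\<dots> = (\<Prod>j\<in>UNIV. if h $ j = k $ j then 1 else 0)"
    using True by (intro prod.cong refl basis1_corr) auto
  also have "\<dots> = (if h = k then 1 else 0)" by (auto simp: vec_eq_iff prod_zero_iff)
  finally show ?thesis .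
qed

lemma L2_inner_basis: "L2_inner (basis h) (basis k) = (if h = k then 1 else 0)"
proof -
  have "complex_of_real (L2_inner (basis h) (basis k)) = complex_of_real (if h = k then 1 else 0)"
    by (simp add: L2_inner_basis_corr basis_corr_eq_0)
  then show ?thesis by (simp only: of_real_eq_iff)
qed

section \<open>Rank-1 lattices and aliasing\<close>

definition lattice_point :: "nat \<Rightarrow> int ^ 'd \<Rightarrow> nat \<Rightarrow> real ^ 'd" where
  "lattice_point p z i = (\<chi> j. frac (real i * of_int (z $ j) / real p))"

definition lattice_mean :: "nat \<Rightarrow> int ^ 'd \<Rightarrow> (real ^ 'd \<Rightarrow> real) \<Rightarrow> real" where
  "lattice_mean p z f = (\<Sum>i<p. f (lattice_point p z i)) / real p"

definition idot :: "int ^ 'd \<Rightarrow> int ^ 'd \<Rightarrow> int" where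
  "idot v z = (\<Sum>j\<in>UNIV. v $ j * z $ j)"

lemma lattice_point_torus: "lattice_point p z i \<in> torus"
  by (simp add: lattice_point_def torus_def frac_lt_1)

lemma texp_lattice_point: "texp v (lattice_point p z i) = cis (2 * pi * of_int (idot v z) / real p) ^ i"
proof -
  have "texp v (lattice_point p z i) = texp v (\<chi> j. frac ((\<chi> j. real i * of_int (z $ j) / real p) $ j))"
    by (simp add: lattice_point_def)
  also have "\<dots> = cis (\<Sum>j\<in>UNIV. 2 * pi * of_int (v $ j) * (real i * of_int (z $ j) / real p))"
    by (simp only: texp_periodic) (simp add: texp_def cis_sum)
  also have "(\<Sum>j\<in>UNIV. 2 * pi * of_int (v $ j) * (real i * of_int (z $ j) / real p))
      = real i * (2 * pi * of_int (idot v z) / real p)"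
    by (simp add: idot_def sum_distrib_left sum_divide_distrib mult_ac)
  finally show ?thesis by (simp only: Complex.DeMoivre)
qed

lemma sum_roots_of_unity:
  assumes p: "p > 0"
  shows "(\<Sum>i<p. cis (2 * pi * of_int a / real p) ^ i) = (if int p dvd a then of_nat p else 0)"
proof (cases "int p dvd a")
  case True
  then obtain b where "a = int p * b" by (rule dvdE)
  then have "cis (2 * pi * of_int a / real p) = 1"
    using p cis_multiple_2pi[of "of_int b"] by (simp add: mult.assoc)
  then show ?thesis using True by simp
next
  case False
  let ?w = "cis (2 * pi * of_int a / real p)"
  have "?w \<noteq> 1"
  proof
    assume "?w = 1"
    then have "cos (2 * pi * of_int a / real p) = 1" by (simp add: complex_eq_iff)
    then obtain n :: int where "2 * pi * of_int a / real p = of_int n * 2 * pi"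
      by (auto simp: cos_one_2pi_int)
    then have "of_int a = real p * of_int n" using p by (simp add: field_simps)
    then have "a = int p * n" by (metis of_int_eq_iff of_int_mult of_int_of_nat_eq)
    then show False using False by simp
  qed
  moreover have "?w ^ p = 1"
    using p cis_multiple_2pi[of "of_int a"] by (simp add: Complex.DeMoivre)
  ultimately show ?thesis using False by (simp add: geometric_sum)
qed

lemma lattice_mean_basis_corr:
  assumes p: "p > 0"
  shows "complex_of_real (lattice_mean p z (\<lambda>x. basis h x * basis k x))
           = basis_corr (\<lambda>v. int p dvd idot v z) h k"
proof -
  have "complex_of_real (\<Sum>i<p. basis h (lattice_point p z i) * basis k (lattice_point p z i))
     = (\<Sum>i<p. \<Sum>u\<in>freq_set h. \<Sum>u'\<in>freq_set k.
         (basis_coeff h u * basis_coeff k u') * texp (u + u') (lattice_point p z i))"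
    by (simp add: basis_expansion sum_product texp_add mult_ac)
  also have "\<dots> = (\<Sum>u\<in>freq_set h. \<Sum>u'\<in>freq_set k.
         (basis_coeff h u * basis_coeff k u') * (\<Sum>i<p. texp (u + u') (lattice_point p z i)))"
    by (subst sum.swap, subst sum.swap) (simp add: sum_distrib_left)
  also have "\<dots> = basis_corr (\<lambda>v. int p dvd idot v z) h k * of_nat p"
    unfolding texp_lattice_point sum_roots_of_unity[OF p] basis_corr_def sum_distrib_right
    by (intro sum.cong refl) auto
  finally show ?thesis using p by (simp add: lattice_mean_def)
qed

text \<open>
  The only way in which a lattice can fail to reproduce the inner product of two basis functions:
  a nonconstant exponential in their product is constant on the lattice.
\<close>
definition aliases :: "nat \<Rightarrow> int ^ 'd \<Rightarrow> nat ^ 'd \<Rightarrow> nat ^ 'd \<Rightarrow> bool" where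
  "aliases p z h k \<longleftrightarrow> (\<exists>u\<in>freq_set h. \<exists>u'\<in>freq_set k. u + u' \<noteq> 0 \<and> int p dvd idot (u + u') z)"

lemma lattice_mean_basis:
  assumes "p > 0" "\<not> aliases p z h k"
  shows "lattice_mean p z (\<lambda>x. basis h x * basis k x) = (if h = k then 1 else 0)"
proof -
  have "basis_corr (\<lambda>v. int p dvd idot v z) h k = basis_corr (\<lambda>v. v = 0) h k"
    unfolding basis_corr_def
  proof (intro sum.cong refl)
    fix u u' assume "u \<in> freq_set h" "u' \<in> freq_set k"
    then have "int p dvd idot (u + u') z \<longleftrightarrow> u + u' = 0"
      using assms(2) unfolding aliases_def by (cases "u + u' = 0") (auto simp: idot_def)
    then show "basis_coeff h u * basis_coeff k u' * (if int p dvd idot (u + u') z then 1 else 0)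
       = basis_coeff h u * basis_coeff k u' * (if u + u' = 0 then 1 else 0)" by simp
  qed
  then have "complex_of_real (lattice_mean p z (\<lambda>x. basis h x * basis k x)) = complex_of_real (if h = k then 1 else 0)"
    by (simp add: lattice_mean_basis_corr[OF assms(1)] basis_corr_eq_0)
  then show ?thesis by (simp only: of_real_eq_iff)
qed

text \<open>
  Without aliasing the basis functions are orthonormal for the discrete inner product of the
  lattice, so this is Bessel's inequality there: the squared distance of \<open>g\<close> from its projection
  is nonnegative.
\<close>
lemma lattice_mean_Bessel:
  assumes p: "p > 0" and I: "finite I"
    and orth: "\<And>h h'. h \<in> I \<Longrightarrow> h' \<in> I \<Longrightarrow> \<not> aliases p z h h'"
  shows "(\<Sum>h\<in>I. (lattice_mean p z (\<lambda>x. basis h x * g x))\<^sup>2) \<le> lattice_mean p z (\<lambda>x. (g x)\<^sup>2)"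
proof -
  define c where "c h = lattice_mean p z (\<lambda>x. basis h x * g x)" for h
  define x where "x i = lattice_point p z i" for i
  have cc: "(\<Sum>i<p. basis h (x i) * g (x i)) = real p * c h" for h
    using p by (simp add: c_def lattice_mean_def x_def)
  have bb: "(\<Sum>i<p. basis h (x i) * basis h' (x i)) = real p * (if h = h' then 1 else 0)" if "h \<in> I" "h' \<in> I" for h h'
    using lattice_mean_basis[OF p orth[OF that]] p by (auto simp: lattice_mean_def x_def field_simps)
  have "0 \<le> (\<Sum>i<p. (g (x i) - (\<Sum>h\<in>I. c h * basis h (x i)))\<^sup>2)" by (intro sum_nonneg) auto
  also have "\<dots> = (\<Sum>i<p. (g (x i))\<^sup>2) - 2 * (\<Sum>i<p. g (x i) * (\<Sum>h\<in>I. c h * basis h (x i)))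
     + (\<Sum>i<p. (\<Sum>h\<in>I. c h * basis h (x i))\<^sup>2)"
    by (simp add: power2_diff sum.distrib sum_subtractf sum_distrib_left mult_ac)
  also have "(\<Sum>i<p. g (x i) * (\<Sum>h\<in>I. c h * basis h (x i))) = (\<Sum>h\<in>I. c h * (\<Sum>i<p. basis h (x i) * g (x i)))"
    unfolding sum_distrib_left by (subst sum.swap) (simp add: mult_ac)
  also have "\<dots> = real p * (\<Sum>h\<in>I. (c h)\<^sup>2)"
    unfolding cc by (simp add: sum_distrib_left power2_eq_square mult_ac)
  also have "(\<Sum>i<p. (\<Sum>h\<in>I. c h * basis h (x i))\<^sup>2)
     = (\<Sum>i<p. \<Sum>h\<in>I. \<Sum>h'\<in>I. c h * c h' * (basis h (x i) * basis h' (x i)))"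
    by (simp add: power2_eq_square sum_product mult_ac)
  also have "\<dots> = (\<Sum>h\<in>I. \<Sum>h'\<in>I. c h * c h' * (\<Sum>i<p. basis h (x i) * basis h' (x i)))"
    by (subst sum.swap, subst sum.swap) (simp add: sum_distrib_left)
  also have "\<dots> = (\<Sum>h\<in>I. \<Sum>h'\<in>I. if h' = h then real p * (c h * c h') else 0)"
    by (intro sum.cong refl) (simp add: bb)
  also have "\<dots> = real p * (\<Sum>h\<in>I. (c h)\<^sup>2)"
    using I by (simp add: power2_eq_square sum_distrib_left)
  finally have "real p * (\<Sum>h\<in>I. (c h)\<^sup>2) \<le> (\<Sum>i<p. (g (x i))\<^sup>2)" by simp
  then have "(\<Sum>h\<in>I. (c h)\<^sup>2) \<le> lattice_mean p z (\<lambda>x. (g x)\<^sup>2)"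
    using p by (simp add: lattice_mean_def x_def field_simps)
  then show ?thesis by (simp only: c_def)
qed

section \<open>Pointwise Fourier expansion\<close>

definition torus_bounded :: "(real ^ 'd \<Rightarrow> real) \<Rightarrow> bool" where
  "torus_bounded f \<longleftrightarrow> f \<in> borel_measurable (lebesgue_on torus) \<and> (\<exists>B. \<forall>x\<in>torus. \<bar>f x\<bar> \<le> B)"

lemma torus_bounded_integrable: "torus_bounded f \<Longrightarrow> integrable (lebesgue_on torus) f"
  unfolding torus_bounded_def by (metis real_norm_def torus_integrable_bounded)

lemma torus_bounded_mult:
  assumes "torus_bounded f" "torus_bounded g" shows "torus_bounded (\<lambda>x. f x * g x)"
proof -
  obtain A B where "\<forall>x\<in>torus. \<bar>f x\<bar> \<le> A" "\<forall>x\<in>torus. \<bar>g x\<bar> \<le> B"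
    using assms by (auto simp: torus_bounded_def)
  then have "\<forall>x\<in>torus. \<bar>f x * g x\<bar> \<le> A * B"
    unfolding abs_mult by (meson abs_ge_zero mult_mono order_trans)
  then show ?thesis using assms unfolding torus_bounded_def by (auto intro: borel_measurable_times)
qed

lemma torus_bounded_diff:
  assumes "torus_bounded f" "torus_bounded g" shows "torus_bounded (\<lambda>x. f x - g x)"
proof -
  obtain A B where "\<forall>x\<in>torus. \<bar>f x\<bar> \<le> A" "\<forall>x\<in>torus. \<bar>g x\<bar> \<le> B"
    using assms by (auto simp: torus_bounded_def)
  then have "\<forall>x\<in>torus. \<bar>f x - g x\<bar> \<le> A + B" by (meson abs_triangle_ineq4 add_mono order_trans)
  then show ?thesis using assms unfolding torus_bounded_def by (auto intro: borel_measurable_diff)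
qed

lemma torus_subset_cbox: "torus \<subseteq> cbox 0 (1 :: real ^ 'd)"
  by (auto simp: torus_def mem_box_cart less_imp_le)

lemma torus_bounded_continuous:
  assumes "continuous_on UNIV f" shows "torus_bounded f"
proof -
  have "compact (f ` cbox 0 1)"
    by (rule compact_continuous_image) (use assms continuous_on_subset in auto)
  then obtain B where "\<forall>x\<in>cbox 0 1. \<bar>f x\<bar> \<le> B"
    using compact_imp_bounded bounded_real by (metis (no_types, lifting) image_eqI)
  then show ?thesis unfolding torus_bounded_def
    using measurable_torus_continuous[OF assms] torus_subset_cbox by blast
qed

lemma torus_bounded_basis: "torus_bounded (basis m)"
  by (intro torus_bounded_continuous continuous_on_basis)

lemma torus_bounded_cmult: "torus_bounded f \<Longrightarrow> torus_bounded (\<lambda>x. c * f x)"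
  by (rule torus_bounded_mult) (rule torus_bounded_continuous, simp)

lemma torus_bounded_sum:
  "(\<And>i. i \<in> A \<Longrightarrow> torus_bounded (f i)) \<Longrightarrow> torus_bounded (\<lambda>x. \<Sum>i\<in>A. f i x)"
proof (induction A rule: infinite_finite_induct)
  case (insert i A)
  then have "torus_bounded (\<lambda>x. (\<lambda>x. f i x) x - (\<lambda>x. - 1 * (\<Sum>i\<in>A. f i x)) x)"
    by (intro torus_bounded_diff torus_bounded_cmult) auto
  then show ?case using insert by simp
qed (auto intro!: torus_bounded_continuous)

lemma abs_integral_torus_le:
  fixes f :: "real ^ 'd \<Rightarrow> real"
  assumes "torus_bounded f" "\<And>x. x \<in> torus \<Longrightarrow> \<bar>f x\<bar> \<le> B"
  shows "\<bar>LINT x|lebesgue_on torus. f x\<bar> \<le> B"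
proof -
  interpret finite_measure "lebesgue_on (torus :: (real ^ 'd) set)" by (rule finite_measure_torus)
  have "\<bar>LINT x|lebesgue_on torus. f x\<bar> \<le> (LINT x|lebesgue_on torus. \<bar>f x\<bar>)"
    using integral_norm_bound[of _ f] by simp
  also have "\<dots> \<le> (LINT x|lebesgue_on (torus :: (real ^ 'd) set). B)"
    using assms by (intro Bochner_Integration.integral_mono integrable_abs torus_bounded_integrable)
      (auto intro: torus_bounded_continuous)
  also have "\<dots> = B" using measure_torus[where 'd = 'd] by simp
  finally show ?thesis .
qed

text \<open>
  Generated by exponentials rather than by the basis, because closure under products is then
  immediate.
\<close>
inductive trig_poly :: "(real ^ 'd \<Rightarrow> complex) \<Rightarrow> bool" where
  monomial: "trig_poly (\<lambda>x. c * texp v x)"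
| add: "trig_poly f \<Longrightarrow> trig_poly g \<Longrightarrow> trig_poly (\<lambda>x. f x + g x)"

lemma trig_poly_mult:
  assumes "trig_poly f" "trig_poly g" shows "trig_poly (\<lambda>x. f x * g x)"
  using assms(1)
proof induction
  case (monomial c v)
  show ?case using assms(2)
  proof induction
    case (monomial c' v')
    have "(\<lambda>x. c * texp v x * (c' * texp v' x)) = (\<lambda>x. (c * c') * texp (v + v') x)"
      by (simp add: texp_add mult_ac)
    then show ?case by (simp only: trig_poly.monomial)
  next
    case (add f g)
    then show ?case using trig_poly.add by (simp add: distrib_left)
  qed
next
  case (add f g)
  then show ?case using trig_poly.add by (simp add: distrib_right)
qed

lemma integral_trig_poly_eq_0:
  fixes g :: "real ^ 'd \<Rightarrow> real"
  assumes g: "torus_bounded g" and orth: "\<And>m. L2_inner g (basis m) = 0" and P: "trig_poly P"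
  shows "integrable (lebesgue_on torus) (\<lambda>x. of_real (g x) * P x) \<and>
         (LINT x|lebesgue_on torus. of_real (g x) * P x) = 0"
  using P
proof induction
  case (monomial c v)
  obtain B :: "(nat ^ 'd) set" and d where B: "finite B" and
    e: "\<And>x. texp v x = (\<Sum>m\<in>B. d m * complex_of_real (basis m x))"
    using texp_expansion[of v] by blast
  have eq: "of_real (g x) * (c * texp v x) = (\<Sum>m\<in>B. (c * d m) * complex_of_real (g x * basis m x))" for x
    by (simp add: e sum_distrib_left mult_ac)
  have int: "integrable (lebesgue_on torus) (\<lambda>x. complex_of_real (g x * basis m x))" for m
    by (intro integrable_of_real torus_bounded_integrable torus_bounded_mult g torus_bounded_basis)
  have "(LINT x|lebesgue_on torus. complex_of_real (g x * basis m x)) = 0" for m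
    using orth[of m] by (simp only: integral_complex_of_real L2_inner_def) simp
  then show ?case unfolding eq
    using int by (auto intro!: Bochner_Integration.integrable_sum integrable_mult_right
        simp: Bochner_Integration.integral_sum simp del: of_real_mult)
next
  case (add P Q)
  then show ?case by (simp add: distrib_left)
qed

text \<open>
  The Stone-Weierstrass theorem needs a compact space whose points are separated. The unit cube is
  unsuitable as periodic functions do not separate opposite faces, so the torus is realised as a
  product of unit circles.
\<close>
definition circle_map :: "real ^ 'd \<Rightarrow> complex ^ 'd" where
  "circle_map x = (\<chi> j. cis (2 * pi * x $ j))"

lemma Arg2pi_cis_frac: "Arg2pi (cis (2 * pi * t)) / (2 * pi) = frac t"
proof -
  have "Arg2pi (cis (2 * pi * t)) = 2 * pi * frac t"
  proof (rule Arg2pi_unique)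
    have "cis (2 * pi * t) = cis (2 * pi * frac t) * cis (2 * pi * of_int \<lfloor>t\<rfloor>)"
      by (simp add: cis_mult frac_def algebra_simps)
    also have "cis (2 * pi * of_int \<lfloor>t\<rfloor>) = 1" by (rule cis_multiple_2pi) simp
    finally show "of_real 1 * exp (\<i> * of_real (2 * pi * frac t)) = cis (2 * pi * t)"
      by (simp add: cis_conv_exp)
  qed (auto simp: frac_lt_1)
  then show ?thesis by simp
qed

text \<open>
  By Stone-Weierstrass \<open>g\<close> is a uniform limit of trigonometric polynomials \<open>q\<close>. Since \<open>g\<close> is
  orthogonal to each \<open>q\<close>, the integral of \<open>g\<^sup>2\<close> equals that of \<open>g (g - q)\<close>, which is arbitrarily
  small; so the continuous function \<open>g\<close> vanishes on the open cube and by periodicity everywhere.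
\<close>
lemma periodic_eq_0_if_orthogonal:
  fixes g :: "real ^ 'd \<Rightarrow> real"
  assumes cont: "continuous_on UNIV g" and per: "\<And>x. g (\<chi> j. frac (x $ j)) = g x"
    and orth: "\<And>m. L2_inner g (basis m) = 0"
  shows "g x = 0"
proof -
  define S where "S = circle_map ` cbox 0 (1 :: real ^ 'd)"
  \<comment> \<open>The function on the product of circles induced by \<open>g\<close>. The argument jumps on each circle, so
    continuity comes from \<open>S\<close> being a quotient of the cube: preimages of closed sets are compact.\<close>
  define G where "G w = g (\<chi> j. Arg2pi (w $ j) / (2 * pi))" for w :: "complex ^ 'd"
  define P where "P f \<longleftrightarrow> continuous_on S f \<and> trig_poly (\<lambda>x. complex_of_real (f (circle_map x)))" for f
  have contE: "continuous_on A circle_map" for A :: "(real ^ 'd) set"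
    unfolding circle_map_def cis_conv_exp by (intro continuous_intros)
  have S: "compact S" unfolding S_def by (intro compact_continuous_image contE compact_cbox)
  have GE: "G (circle_map x) = g x" for x
    using per[of x] by (simp add: G_def circle_map_def Arg2pi_cis_frac)
  have contG: "continuous_on S G"
    unfolding continuous_on_closed_vimage[OF compact_imp_closed[OF S]]
  proof (intro allI impI)
    fix C :: "real set" assume "closed C"
    have "G -` C \<inter> S = circle_map ` (cbox 0 1 \<inter> g -` C)" by (auto simp: S_def GE)
    moreover have "closed (g -` C)" using cont \<open>closed C\<close> by (simp add: continuous_on_closed_vimage)
    then have "compact (cbox 0 1 \<inter> g -` C)" by (intro compact_Int_closed compact_cbox)
    ultimately have "compact (G -` C \<inter> S)" using compact_continuous_image[OF contE] by metis
    then show "closed (G -` C \<inter> S)" by (rule compact_imp_closed)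
  qed
  have gb: "torus_bounded g" using cont by (rule torus_bounded_continuous)
  then obtain B where B: "\<And>x. x \<in> torus \<Longrightarrow> \<bar>g x\<bar> \<le> B" by (auto simp: torus_bounded_def)
  have approx: "L2_inner g g \<le> B * e" if e: "e > 0" for e
  proof -
    have "\<exists>h. P h \<and> (\<forall>w\<in>S. \<bar>G w - h w\<bar> < e)"
    proof (rule Stone_Weierstrass_HOL[OF S, where P = P])
      fix c :: real
      have "(\<lambda>x. complex_of_real c) = (\<lambda>x :: real ^ 'd. of_real c * texp 0 x)" by simp
      then show "P (\<lambda>x. c)" unfolding P_def using trig_poly.monomial[of "of_real c" 0] by simp
    next
      fix f h assume "P f \<and> P h"
      then show "P (\<lambda>x. f x + h x)" "P (\<lambda>x. f x * h x)" unfolding P_def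
        by (auto intro!: continuous_intros trig_poly.add trig_poly_mult)
    next
      fix w w' assume w: "w \<in> S \<and> w' \<in> S \<and> w \<noteq> w'"
      then obtain j where "w $ j \<noteq> w' $ j" by (auto simp: vec_eq_iff)
      then have "Re (w $ j) \<noteq> Re (w' $ j) \<or> Im (w $ j) \<noteq> Im (w' $ j)" by (simp add: complex_eq_iff)
      moreover have tj: "texp (axis j 1) x = cis (2 * pi * x $ j)"
         "texp (axis j (-1)) x = cis (- (2 * pi * x $ j))" for x :: "real ^ 'd"
      proof -
        have "(\<Prod>i\<in>UNIV. cis (2 * pi * of_int (axis j a $ i) * x $ i))
           = (\<Prod>i\<in>UNIV. if i = j then cis (2 * pi * of_int a * x $ j) else 1)" for a
          by (intro prod.cong) (auto simp: axis_def)
        then show "texp (axis j 1) x = cis (2 * pi * x $ j)"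
         "texp (axis j (-1)) x = cis (- (2 * pi * x $ j))" by (simp_all add: texp_def)
      qed
      have "P (\<lambda>w. Re (w $ j))" unfolding P_def
      proof
        have "(\<lambda>x :: real ^ 'd. complex_of_real (Re (circle_map x $ j)))
          = (\<lambda>x. (1/2) * texp (axis j 1) x + (1/2) * texp (axis j (-1)) x)"
          by (auto simp: circle_map_def tj complex_eq_iff)
        then show "trig_poly (\<lambda>x :: real ^ 'd. complex_of_real (Re (circle_map x $ j)))"
          by (simp only: trig_poly.add trig_poly.monomial)
      qed (intro continuous_intros)
      moreover have "P (\<lambda>w. Im (w $ j))" unfolding P_def
      proof
        have "(\<lambda>x :: real ^ 'd. complex_of_real (Im (circle_map x $ j)))
          = (\<lambda>x. (-\<i>/2) * texp (axis j 1) x + (\<i>/2) * texp (axis j (-1)) x)"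
          by (auto simp: circle_map_def tj complex_eq_iff)
        then show "trig_poly (\<lambda>x :: real ^ 'd. complex_of_real (Im (circle_map x $ j)))"
          by (simp only: trig_poly.add trig_poly.monomial)
      qed (intro continuous_intros)
      ultimately show "\<exists>f. P f \<and> f w \<noteq> f w'" by blast
    qed (use contG e in \<open>auto simp: P_def\<close>)
    then obtain h where h: "P h" "\<And>w. w \<in> S \<Longrightarrow> \<bar>G w - h w\<bar> < e" by blast
    define q where "q x = h (circle_map x)" for x
    have q_close: "\<bar>g x - q x\<bar> \<le> e" if "x \<in> torus" for x
      using h(2)[of "circle_map x"] torus_subset_cbox that by (auto simp: S_def GE q_def less_imp_le)
    have q: "integrable (lebesgue_on torus) (\<lambda>x. complex_of_real (g x * q x))"
       "(LINT x|lebesgue_on torus. complex_of_real (g x * q x)) = 0"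
      using integral_trig_poly_eq_0[OF gb orth, of "\<lambda>x. complex_of_real (q x)"] h(1)
      by (simp_all add: P_def q_def)
    have int: "integrable (lebesgue_on torus) (\<lambda>x. g x * q x)" using integrable_Re[OF q(1)] by simp
    have int0: "(LINT x|lebesgue_on torus. g x * q x) = 0" using q(2) by (simp only: integral_complex_of_real of_real_eq_0_iff)
    have gg: "integrable (lebesgue_on torus) (\<lambda>x. g x * g x)"
      by (intro torus_bounded_integrable torus_bounded_mult gb)
    have "L2_inner g g = (LINT x|lebesgue_on torus. g x * g x - g x * q x)"
      unfolding L2_inner_def using int gg int0 by (simp add: Bochner_Integration.integral_diff)
    also have "\<dots> \<le> (LINT x|lebesgue_on (torus :: (real ^ 'd) set). B * e)"
    proof (rule Bochner_Integration.integral_mono)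
      fix x assume "x \<in> space (lebesgue_on (torus :: (real ^ 'd) set))"
      then have x: "x \<in> torus" by simp
      have "\<bar>g x * (g x - q x)\<bar> \<le> B * e"
        unfolding abs_mult using B[OF x] q_close[OF x] by (intro mult_mono) auto
      then show "g x * g x - g x * q x \<le> B * e" by (simp add: algebra_simps)
    qed (use int gg finite_measure.integrable_const[OF finite_measure_torus] in auto)
    also have "\<dots> = B * e" using measure_torus[where 'd = 'd] by simp
    finally show ?thesis .
  qed
  have B0: "B \<ge> 0" using B[of 0] by (force simp: torus_def)
  have "L2_inner g g \<le> 0"
  proof (rule field_le_epsilon)
    fix e :: real assume "e > 0"
    then have "L2_inner g g \<le> B * (e / (B + 1))" using B0 by (intro approx) auto
    also have "\<dots> \<le> e" using B0 \<open>e > 0\<close> by (simp add: field_simps)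
    finally show "L2_inner g g \<le> 0 + e" by simp
  qed
  moreover have "L2_inner g g \<ge> 0" unfolding L2_inner_def by (intro integral_nonneg_AE) auto
  ultimately have "L2_inner g g = 0" by simp
  then have "AE x in lebesgue_on torus. g x * g x = 0"
    unfolding L2_inner_def
    by (subst (asm) integral_nonneg_eq_0_iff_AE) (auto intro!: torus_bounded_integrable torus_bounded_mult gb)
  then have ae: "AE x in lebesgue. x \<in> torus \<longrightarrow> g x = 0"
    using torus_lmeasurable by (subst (asm) AE_restrict_space_iff) auto
  let ?N = "{x \<in> box 0 1. g x \<noteq> 0}"
  have "open (g -` (- {0}))" by (intro open_vimage cont open_Compl closed_singleton)
  then have "open (box 0 1 \<inter> g -` (- {0}))" by (intro open_Int open_box)
  moreover have Neq: "?N = box 0 1 \<inter> g -` (- {0})" by auto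
  ultimately have "open ?N" by simp
  moreover have "negligible ?N"
  proof -
    obtain N where N: "N \<in> null_sets lebesgue" "{x. \<not> (x \<in> torus \<longrightarrow> g x = 0)} \<subseteq> N"
      using ae by (auto simp: eventually_ae_filter)
    have "box 0 1 \<subseteq> (torus :: (real ^ 'd) set)" by (auto simp: torus_def mem_box_cart less_imp_le)
    then have "?N \<subseteq> N" using N(2) by blast
    then show ?thesis using N(1) by (meson negligible_iff_null_sets negligible_subset)
  qed
  ultimately have "?N = {}" using open_not_negligible by blast
  then have box0: "g x = 0" if "x \<in> box 0 1" for x using that by auto
  have "(\<chi> j. 1 / 2) \<in> box 0 (1 :: real ^ 'd)" by (simp add: mem_box_cart)
  then have ne: "box 0 (1 :: real ^ 'd) \<noteq> {}" by blast
  have "g (\<chi> j. frac (x $ j)) = 0"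
  proof (rule continuous_constant_on_closure[of "box 0 (1 :: real ^ 'd)"])
    show "continuous_on (closure (box 0 1)) g" using cont continuous_on_subset by blast
    show "(\<chi> j. frac (x $ j)) \<in> closure (box 0 1)"
      using ne by (auto simp: closure_box mem_box_cart frac_lt_1 less_imp_le)
  qed (use box0 in auto)
  then show ?thesis by (simp add: per)
qed

definition basis_series :: "(nat ^ 'd \<Rightarrow> real) \<Rightarrow> real ^ 'd \<Rightarrow> real" where
  "basis_series a x = (\<Sum>\<^sub>\<infinity>m. a m * basis m x)"

context
  fixes a :: "nat ^ 'd \<Rightarrow> real"
  assumes a: "(\<lambda>m. \<bar>a m\<bar>) summable_on UNIV"
begin

lemma abs_basis_term_le: "\<bar>a m * basis m x\<bar> \<le> sqrt (2 ^ CARD('d)) * \<bar>a m\<bar>"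
  using abs_basis_le[of m x] by (simp add: abs_mult mult.commute[of "sqrt _"] mult_left_mono)

lemma has_sum_basis_series: "((\<lambda>m. a m * basis m x) has_sum basis_series a x) UNIV"
proof -
  have "(\<lambda>m. sqrt (2 ^ CARD('d)) * \<bar>a m\<bar>) summable_on UNIV" using a by (rule summable_on_cmult_right)
  then have "(\<lambda>m. norm (a m * basis m x)) summable_on UNIV"
    by (rule summable_on_comparison_test) (use abs_basis_term_le in auto)
  then have "(\<lambda>m. a m * basis m x) summable_on UNIV" by (rule abs_summable_summable)
  then show ?thesis unfolding basis_series_def by (rule has_sum_infsum)
qed

lemma basis_series_truncation:
  assumes "finite F"
  shows "\<bar>basis_series a x - (\<Sum>m\<in>F. a m * basis m x)\<bar>
           \<le> sqrt (2 ^ CARD('d)) * ((\<Sum>\<^sub>\<infinity>m. \<bar>a m\<bar>) - (\<Sum>m\<in>F. \<bar>a m\<bar>))"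
proof -
  have "((\<lambda>m. a m * basis m x) has_sum (basis_series a x - (\<Sum>m\<in>F. a m * basis m x))) (UNIV - F)"
    using assms by (intro has_sum_Diff has_sum_basis_series has_sum_finite) auto
  moreover have "((\<lambda>m. sqrt (2 ^ CARD('d)) * \<bar>a m\<bar>) has_sum
      (sqrt (2 ^ CARD('d)) * ((\<Sum>\<^sub>\<infinity>m. \<bar>a m\<bar>) - (\<Sum>m\<in>F. \<bar>a m\<bar>)))) (UNIV - F)"
    using assms a by (intro has_sum_cmult_right has_sum_Diff has_sum_infsum has_sum_finite) auto
  ultimately have "norm (basis_series a x - (\<Sum>m\<in>F. a m * basis m x))
    \<le> sqrt (2 ^ CARD('d)) * ((\<Sum>\<^sub>\<infinity>m. \<bar>a m\<bar>) - (\<Sum>m\<in>F. \<bar>a m\<bar>))"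
    by (rule norm_infsum_le) (use abs_basis_term_le in auto)
  then show ?thesis by simp
qed

lemma truncation_bound_tendsto_0:
  "((\<lambda>F. C * ((\<Sum>\<^sub>\<infinity>m. \<bar>a m\<bar>) - (\<Sum>m\<in>F. \<bar>a m\<bar>))) \<longlongrightarrow> 0) (finite_subsets_at_top UNIV)"
proof -
  have "((\<lambda>F. C * ((\<Sum>\<^sub>\<infinity>m. \<bar>a m\<bar>) - (\<Sum>m\<in>F. \<bar>a m\<bar>))) \<longlongrightarrow> C * ((\<Sum>\<^sub>\<infinity>m. \<bar>a m\<bar>) - (\<Sum>\<^sub>\<infinity>m. \<bar>a m\<bar>)))
     (finite_subsets_at_top UNIV)"
    by (intro tendsto_intros infsum_tendsto a)
  then show ?thesis by simp
qed

lemma continuous_on_basis_series: "continuous_on UNIV (basis_series a)"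
proof (rule uniform_limit_theorem)
  show "\<forall>\<^sub>F F in finite_subsets_at_top UNIV. continuous_on UNIV (\<lambda>x. \<Sum>m\<in>F. a m * basis m x)"
    by (intro always_eventually allI continuous_intros continuous_on_basis)
  show "uniform_limit UNIV (\<lambda>F x. \<Sum>m\<in>F. a m * basis m x) (basis_series a) (finite_subsets_at_top UNIV)"
    unfolding uniform_limit_iff
  proof (intro allI impI)
    fix e :: real assume "e > 0"
    then have "\<forall>\<^sub>F F in finite_subsets_at_top UNIV.
      sqrt (2 ^ CARD('d)) * ((\<Sum>\<^sub>\<infinity>m. \<bar>a m\<bar>) - (\<Sum>m\<in>F. \<bar>a m\<bar>)) < e"
      by (rule order_tendstoD(2)[OF truncation_bound_tendsto_0])
    moreover have "\<forall>\<^sub>F F in finite_subsets_at_top (UNIV :: (nat ^ 'd) set). finite F"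
      by (rule eventually_finite_subsets_at_top_weakI) simp
    ultimately show "\<forall>\<^sub>F F in finite_subsets_at_top UNIV. \<forall>x\<in>UNIV. dist (\<Sum>m\<in>F. a m * basis m x) (basis_series a x) < e"
    proof eventually_elim
      case (elim F)
      then show ?case using basis_series_truncation[of F]
        by (auto simp: dist_real_def abs_minus_commute intro: le_less_trans)
    qed
  qed
qed simp

lemma basis_series_periodic: "basis_series a (\<chi> j. frac (x $ j)) = basis_series a x"
  by (simp add: basis_series_def basis_periodic)

text \<open>
  The partial sums converge uniformly, so integration against a bounded function may be done
  term by term.
\<close>
lemma L2_inner_basis_series:
  assumes q: "torus_bounded q"
  shows "((\<lambda>m. a m * L2_inner (basis m) q) has_sum L2_inner (basis_series a) q) UNIV"
proof -
  obtain B where B: "\<And>x. x \<in> torus \<Longrightarrow> \<bar>q x\<bar> \<le> B" using q by (auto simp: torus_bounded_def)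
  have B0: "B \<ge> 0" using B[of 0] by (force simp: torus_def)
  let ?C = "sqrt (2 ^ CARD('d)) * B"
  have close: "\<bar>(\<Sum>m\<in>F. a m * L2_inner (basis m) q) - L2_inner (basis_series a) q\<bar>
    \<le> ?C * ((\<Sum>\<^sub>\<infinity>m. \<bar>a m\<bar>) - (\<Sum>m\<in>F. \<bar>a m\<bar>))" if F: "finite F" for F
  proof -
    let ?S = "\<lambda>x. \<Sum>m\<in>F. a m * basis m x"
    have tb: "torus_bounded ?S" by (intro torus_bounded_sum torus_bounded_cmult torus_bounded_basis)
    have tbs: "torus_bounded (basis_series a)" by (intro torus_bounded_continuous continuous_on_basis_series)
    have "(\<Sum>m\<in>F. a m * L2_inner (basis m) q) = (LINT x|lebesgue_on torus. (\<Sum>m\<in>F. a m * (basis m x * q x)))"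
      unfolding L2_inner_def
      by (subst Bochner_Integration.integral_sum)
         (auto intro!: integrable_mult_right torus_bounded_integrable torus_bounded_mult torus_bounded_basis q)
    also have "(\<lambda>x. \<Sum>m\<in>F. a m * (basis m x * q x)) = (\<lambda>x. ?S x * q x)"
      by (simp add: sum_distrib_right mult.assoc)
    finally have "(\<Sum>m\<in>F. a m * L2_inner (basis m) q) - L2_inner (basis_series a) q
       = (LINT x|lebesgue_on torus. ?S x * q x - basis_series a x * q x)"
      unfolding L2_inner_def using tb tbs q
      by (simp add: Bochner_Integration.integral_diff torus_bounded_integrable torus_bounded_mult)
    also have "(\<lambda>x. ?S x * q x - basis_series a x * q x) = (\<lambda>x. (?S x - basis_series a x) * q x)"
      by (simp add: left_diff_distrib)
    finally have eq: "(\<Sum>m\<in>F. a m * L2_inner (basis m) q) - L2_inner (basis_series a) q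
       = (LINT x|lebesgue_on torus. (?S x - basis_series a x) * q x)" .
    show ?thesis unfolding eq
    proof (rule abs_integral_torus_le)
      fix x :: "real ^ 'd" assume x: "x \<in> torus"
      have "\<bar>?S x - basis_series a x\<bar> * \<bar>q x\<bar>
         \<le> (sqrt (2 ^ CARD('d)) * ((\<Sum>\<^sub>\<infinity>m. \<bar>a m\<bar>) - (\<Sum>m\<in>F. \<bar>a m\<bar>))) * B"
        using basis_series_truncation[OF F, of x] B[OF x]
        by (intro mult_mono') (auto simp: abs_minus_commute)
      then show "\<bar>(?S x - basis_series a x) * q x\<bar> \<le> ?C * ((\<Sum>\<^sub>\<infinity>m. \<bar>a m\<bar>) - (\<Sum>m\<in>F. \<bar>a m\<bar>))"
        by (simp add: abs_mult mult_ac)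
    qed (intro torus_bounded_mult torus_bounded_diff tb tbs q)
  qed
  show ?thesis unfolding has_sum_def
  proof (rule Lim_null[THEN iffD2], rule Lim_null_comparison[OF _ truncation_bound_tendsto_0[of ?C]])
    show "\<forall>\<^sub>F F in finite_subsets_at_top UNIV.
      norm ((\<Sum>m\<in>F. a m * L2_inner (basis m) q) - L2_inner (basis_series a) q)
        \<le> ?C * ((\<Sum>\<^sub>\<infinity>m. \<bar>a m\<bar>) - (\<Sum>m\<in>F. \<bar>a m\<bar>))"
      by (rule eventually_finite_subsets_at_top_weakI) (use close in auto)
  qed
qed

lemma L2_inner_basis_series_basis: "L2_inner (basis_series a) (basis k) = a k"
proof -
  have "((\<lambda>m. a m * L2_inner (basis m) (basis k)) has_sum a k) UNIV"
    by (rule has_sum_finite_neutralI[of "{k}"]) (auto simp: L2_inner_basis)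
  then show ?thesis
    using L2_inner_basis_series[OF torus_bounded_basis, of k] has_sum_unique by blast
qed

lemma Parseval_basis_series: "((\<lambda>m. (a m)\<^sup>2) has_sum L2_inner (basis_series a) (basis_series a)) UNIV"
proof -
  have "L2_inner (basis m) (basis_series a) = a m" for m
    using L2_inner_basis_series_basis[of m] by (simp add: L2_inner_def mult.commute)
  then show ?thesis
    using L2_inner_basis_series[OF torus_bounded_continuous[OF continuous_on_basis_series]]
    by (simp add: power2_eq_square)
qed

end

lemma L2_inner_diff_left:
  assumes "torus_bounded f" "torus_bounded g" "torus_bounded q"
  shows "L2_inner (\<lambda>x. f x - g x) q = L2_inner f q - L2_inner g q"
  unfolding L2_inner_def left_diff_distrib using assms
  by (intro Bochner_Integration.integral_diff torus_bounded_integrable torus_bounded_mult)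

lemma L2_inner_cong_torus:
  assumes "\<And>x. x \<in> torus \<Longrightarrow> f x = f' x" "\<And>x. x \<in> torus \<Longrightarrow> g x = g' x"
  shows "L2_inner f g = L2_inner f' g'"
  unfolding L2_inner_def by (rule Bochner_Integration.integral_cong) (auto simp: assms)

lemma frac_torus: "x \<in> torus \<Longrightarrow> (\<chi> j. frac (x $ j)) = x"
  by (auto simp: torus_def vec_eq_iff frac_eq)

text \<open>
  The series is continuous and periodic and has the same coefficients as \<open>f\<close>, so the difference is
  orthogonal to the basis.
\<close>
lemma eq_basis_series_of_coefficients:
  assumes f: "torus_continuous f" and a: "(\<lambda>m. \<bar>L2_inner f (basis m)\<bar>) summable_on UNIV"
    and x: "x \<in> torus"
  shows "f x = basis_series (\<lambda>m. L2_inner f (basis m)) x"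
proof -
  let ?a = "\<lambda>m. L2_inner f (basis m)"
  let ?f = "\<lambda>x. f (\<chi> j. frac (x $ j))"
  let ?g = "\<lambda>x. ?f x - basis_series ?a x"
  have cf: "continuous_on UNIV ?f" using f by (simp add: torus_continuous_def)
  have cs: "continuous_on UNIV (basis_series ?a)" by (rule continuous_on_basis_series[OF a])
  have "?g x = 0"
  proof (rule periodic_eq_0_if_orthogonal)
    show "continuous_on UNIV ?g" using cf cs by (rule continuous_on_diff)
    show "?g (\<chi> j. frac (x $ j)) = ?g x" for x by (simp add: basis_series_periodic[OF a])
    show "L2_inner ?g (basis m) = 0" for m
    proof -
      have "L2_inner ?g (basis m) = L2_inner ?f (basis m) - L2_inner (basis_series ?a) (basis m)"
        by (intro L2_inner_diff_left torus_bounded_basis torus_bounded_continuous cf cs)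
      also have "L2_inner ?f (basis m) = ?a m" by (rule L2_inner_cong_torus) (auto simp: frac_torus)
      finally show ?thesis by (simp add: L2_inner_basis_series_basis[OF a])
    qed
  qed
  then show ?thesis using frac_torus[OF x] by simp
qed

section \<open>Most generators are good for a given index\<close>

definition generators :: "nat \<Rightarrow> (int ^ 'd) set" where
  "generators p = {z. \<forall>j. z $ j \<in> {0..<int p}}"

lemma finite_generators [simp]: "finite (generators p)"
  unfolding generators_def by (rule finite_vec_set) simp

text \<open>
  If \<open>p\<close> does not divide \<open>v $ j\<close>, then a solution \<open>z\<close> is determined by its other coordinates.
  Hence the \<open>p\<close> cyclic shifts of the \<open>j\<close>-th coordinate map the solutions to pairwise disjoint sets
  of generators.
\<close>
lemma card_annihilated_generators_le:
  fixes v :: "int ^ 'd"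
  assumes p: "prime p" and v: "\<not> (\<forall>j. int p dvd v $ j)"
  shows "card {z \<in> generators p. int p dvd idot v z} * p \<le> card (generators p :: (int ^ 'd) set)"
proof -
  obtain j where j: "\<not> int p dvd v $ j" using v by auto
  have p0: "int p > 0" using p prime_gt_0_nat by simp
  let ?A = "{z \<in> generators p. int p dvd idot v z}"
  \<comment> \<open>The shift of the \<open>j\<close>-th coordinate, as a function on pairs of a solution and an amount.\<close>
  define sh where "sh zt = (\<chi> i. if i = j then (fst zt $ j + snd zt) mod int p else fst zt $ i)"
    for zt :: "(int ^ 'd) \<times> int"
  have split: "idot v z = v $ j * z $ j + (\<Sum>i\<in>UNIV-{j}. v $ i * z $ i)" for z
    unfolding idot_def by (subst sum.remove[of _ j]) auto
  have "inj_on sh (?A \<times> {0..<int p})"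
  proof (rule inj_onI, clarify)
    fix z t z' t'
    assume A: "z \<in> generators p" "int p dvd idot v z" "t \<in> {0..<int p}"
      "z' \<in> generators p" "int p dvd idot v z'" "t' \<in> {0..<int p}" and eq: "sh (z, t) = sh (z', t')"
    have off: "z $ i = z' $ i" if "i \<noteq> j" for i
      using arg_cong[OF eq, of "\<lambda>w. w $ i"] that by (simp add: sh_def)
    have at: "(z $ j + t) mod int p = (z' $ j + t') mod int p"
      using arg_cong[OF eq, of "\<lambda>w. w $ j"] by (simp add: sh_def)
    have "(\<Sum>i\<in>UNIV-{j}. v $ i * z $ i) = (\<Sum>i\<in>UNIV-{j}. v $ i * z' $ i)"
      by (intro sum.cong) (auto simp: off)
    then have "idot v z - idot v z' = v $ j * (z $ j - z' $ j)" by (simp add: split algebra_simps)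
    then have "int p dvd v $ j * (z $ j - z' $ j)" using A by (metis dvd_diff)
    then have "int p dvd z $ j - z' $ j" using j p by (simp add: prime_dvd_mult_iff)
    then have "z $ j mod int p = z' $ j mod int p" by (simp add: mod_eq_dvd_iff)
    moreover have zj: "z $ j \<in> {0..<int p}" "z' $ j \<in> {0..<int p}" using A unfolding generators_def by auto
    ultimately have zz: "z $ j = z' $ j" by simp
    then have "z = z'" using off by (metis vec_eq_iff)
    moreover have "int p dvd (z $ j + t) - (z' $ j + t')" using at by (simp add: mod_eq_dvd_iff)
    then have "t mod int p = t' mod int p" using zz by (simp add: mod_eq_dvd_iff)
    then have "t = t'" using A by simp
    ultimately show "z = z' \<and> t = t'" by simp
  qed
  moreover have "sh ` (?A \<times> {0..<int p}) \<subseteq> generators p"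
    using p0 by (auto simp: sh_def generators_def)
  ultimately have "card (?A \<times> {0..<int p}) \<le> card (generators p :: (int ^ 'd) set)"
    by (intro card_inj_on_le) auto
  then show ?thesis by (simp add: card_cartesian_product)
qed

lemma card_aliasing_generators_le:
  fixes h k :: "nat ^ 'd"
  assumes p: "prime p" and k: "k \<notin> congruent_indices p h"
  shows "card {z \<in> generators p. aliases p z h k} * p \<le> 4 ^ CARD('d) * card (generators p :: (int ^ 'd) set)"
proof -
  define Q where "Q = {(u, u') \<in> freq_set h \<times> freq_set k. u + u' \<noteq> 0}"
  let ?A = "\<lambda>w. {z \<in> generators p. int p dvd idot (fst w + snd w) z}"
  have finQ: "finite Q" unfolding Q_def by (rule finite_subset[of _ "freq_set h \<times> freq_set k"]) auto
  have "{z \<in> generators p. aliases p z h k} \<subseteq> (\<Union>w\<in>Q. ?A w)"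
    unfolding aliases_def Q_def by fastforce
  then have "card {z \<in> generators p. aliases p z h k} \<le> card (\<Union>w\<in>Q. ?A w)"
    using finQ by (intro card_mono) auto
  also have "\<dots> \<le> (\<Sum>w\<in>Q. card (?A w))" by (rule card_UN_le[OF finQ])
  finally have "card {z \<in> generators p. aliases p z h k} * p \<le> (\<Sum>w\<in>Q. card (?A w) * p)"
    by (simp add: sum_distrib_right[symmetric])
  also have "\<dots> \<le> (\<Sum>w\<in>Q. card (generators p :: (int ^ 'd) set))"
  proof (intro sum_mono card_annihilated_generators_le p)
    fix w assume "w \<in> Q"
    then show "\<not> (\<forall>j. int p dvd (fst w + snd w) $ j)"
      using k unfolding congruent_indices_def Q_def by (auto split: prod.splits)
  qed
  also have "\<dots> = card Q * card (generators p :: (int ^ 'd) set)" by simp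
  also have "card Q \<le> card (freq_set h \<times> freq_set k)" unfolding Q_def by (intro card_mono) auto
  also have "\<dots> \<le> 2 ^ CARD('d) * 2 ^ CARD('d)"
    unfolding card_cartesian_product by (intro mult_mono card_freq_set) auto
  also have "\<dots> = 4 ^ CARD('d)" by (simp flip: power_mult_distrib)
  finally show ?thesis by simp
qed

text \<open>
  Bounding all finite partial sums of the decay over the aliasing indices is the same as bounding
  the infinite sum, and keeps the counting below finite.
\<close>
definition bad_generator :: "real \<Rightarrow> real \<Rightarrow> nat \<Rightarrow> nat \<Rightarrow> nat ^ 'd \<Rightarrow> int ^ 'd \<Rightarrow> bool" where
  "bad_generator s \<tau> R p h z \<longleftrightarrow> (\<exists>k\<in>hyperbolic_cross R. aliases p z h k) \<or>
     (\<exists>F. finite F \<and> F \<inter> hyperbolic_cross R = {} \<and> (\<forall>k\<in>F. aliases p z h k) \<and> sum (hc_decay s) F > \<tau>)"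

lemma not_congruent_in_cross:
  assumes "h \<in> hyperbolic_cross R" "k \<in> hyperbolic_cross R" "2 * R < p"
  shows "k \<notin> congruent_indices p h"
proof
  assume "k \<in> congruent_indices p h"
  then obtain u u' where u: "u \<in> freq_set h" "u' \<in> freq_set k" "u + u' \<noteq> 0" "\<forall>j. int p dvd u $ j + u' $ j"
    unfolding congruent_indices_def by blast
  from u(3) obtain i where i: "u $ i + u' $ i \<noteq> 0" by (auto simp: vec_eq_iff)
  have "freq (h $ i) \<le> R" "freq (k $ i) \<le> R"
    using assms(1,2) freq_le[of "h $ i"] freq_le[of "k $ i"] component_le_hc_weight[of h i] component_le_hc_weight[of k i]
    by (auto simp: hyperbolic_cross_def)
  then have "\<bar>u $ i + u' $ i\<bar> < int p"
    using freq_setD[OF u(1), of i] freq_setD[OF u(2), of i] assms(3) by linarith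
  moreover have "int p dvd u $ i + u' $ i" using u(4) by blast
  ultimately show False using i by (meson dvd_imp_le_int linorder_not_le zdvd_not_zless abs_ge_zero dvd_abs_iff zero_less_abs_iff)
qed

text \<open>
  Both ways of being bad occur for at most one generator in 32. Aliasing inside the cross: there are
  at most \<open>2 R (2 + ln R)^(d-1)\<close> partners, each aliasing for a fraction \<open>4^d / p\<close> of the generators.
  A large decay sum: by the tail bound and the congruence bound its mean over all generators is at
  most 1/32 of the threshold, so Markov's inequality applies.
\<close>
lemma bad_generators_rare:
  assumes s: "s > 1/2"
  obtains C where "C > 0" "\<And>R p h. R \<ge> 1 \<Longrightarrow> prime p \<Longrightarrow> h \<in> hyperbolic_cross R \<Longrightarrow>
     64 * 4 ^ CARD('d) * real R * (2 + ln (real R)) ^ (CARD('d) - 1) \<le> real p \<Longrightarrow>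
     16 * card {z \<in> generators p. bad_generator s (C * real R powr (- 2 * s)) R p (h :: nat ^ 'd) z}
       \<le> card (generators p :: (int ^ 'd) set)"
proof -
  obtain C1 where C1: "C1 > 0" "\<And>R F. R \<ge> 1 \<Longrightarrow> finite F \<Longrightarrow> F \<inter> hyperbolic_cross R = {} \<Longrightarrow>
      sum (hc_decay s) (F :: (nat ^ 'd) set) \<le> C1 * (2 + ln (real R)) ^ (CARD('d) - 1) * real R powr (1 - 2 * s)"
    using sum_hc_decay_tail_le[OF s] by metis
  obtain C2 where C2: "C2 > 0" "\<And>p h F. p > 0 \<Longrightarrow> (\<And>j. 2 * freq (h $ j) \<le> p) \<Longrightarrow> finite F \<Longrightarrow>
     F \<subseteq> congruent_indices p h \<Longrightarrow> sum (hc_decay s) (F :: (nat ^ 'd) set) \<le> C2 * real p powr (- 2 * s)"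
    using sum_hc_decay_congruent_le[OF s] by metis
  define c4 where "c4 = (4 :: real) ^ CARD('d)"
  have c4: "c4 \<ge> 1" by (simp add: c4_def)
  define C where "C = 32 * (c4 * C1 + C2)"
  have "C > 0" using C1(1) C2(1) c4 by (simp add: C_def add_pos_pos)
  moreover have "16 * card {z \<in> generators p. bad_generator s (C * real R powr (- 2 * s)) R p h z}
       \<le> card (generators p :: (int ^ 'd) set)"
    if R: "R \<ge> 1" and p: "prime p" and h: "h \<in> hyperbolic_cross R"
      and large: "64 * 4 ^ CARD('d) * real R * (2 + ln (real R)) ^ (CARD('d) - 1) \<le> real p"
    for R p and h :: "nat ^ 'd"
  proof -
    let ?Z = "generators p :: (int ^ 'd) set" and ?I = "hyperbolic_cross R :: (nat ^ 'd) set"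
    define \<tau> where "\<tau> = C * real R powr (- 2 * s)"
    define l where "l = (2 + ln (real R)) ^ (CARD('d) - 1)"
    have l1: "l \<ge> 1" unfolding l_def using R by (intro one_le_power) (smt (verit) ln_ge_zero real_of_nat_ge_one_iff)
    have pl: "64 * c4 * real R * l \<le> real p" using large by (simp add: l_def c4_def)
    have "real R * 1 * 1 \<le> real R * l * c4" using l1 c4 R by (intro mult_mono) auto
    then have pR: "64 * real R \<le> real p" using pl by (simp add: mult_ac)
    have "1 * (real R * l) \<le> c4 * (real R * l)" using l1 c4 by (intro mult_right_mono) auto
    moreover have "64 * (c4 * (real R * l)) \<le> real p" using pl by (simp add: mult_ac)
    moreover have "0 \<le> real R * l" using l1 by simp
    ultimately have pRl: "real R * l \<le> real p" by linarith
    have p0: "p > 0" using p prime_gt_0_nat by simp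
    have tau0: "\<tau> > 0" using \<open>C > 0\<close> R by (simp add: \<tau>_def)
    define A where "A k = {z \<in> ?Z. aliases p z h k}" for k
    have finA: "finite (A k)" for k by (simp add: A_def)
    have cardA: "real (card (A k)) \<le> c4 / real p * real (card ?Z)" if "k \<notin> congruent_indices p h" for k
    proof -
      have "card (A k) * p \<le> 4 ^ CARD('d) * card ?Z"
        unfolding A_def by (rule card_aliasing_generators_le[OF p that])
      then have "real (card (A k) * p) \<le> real (4 ^ CARD('d) * card ?Z)" by (simp only: of_nat_le_iff)
      then show ?thesis using p0 by (simp add: c4_def field_simps)
    qed
    let ?B1 = "\<Union>k\<in>?I. A k"
    have "card ?B1 \<le> (\<Sum>k\<in>?I. card (A k))" by (rule card_UN_le[OF finite_hyperbolic_cross])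
    then have "real (card ?B1) \<le> (\<Sum>k\<in>?I. real (card (A k)))" by (metis of_nat_le_iff of_nat_sum)
    also have "\<dots> \<le> (\<Sum>k\<in>?I. c4 / real p * real (card ?Z))"
    proof (intro sum_mono cardA)
      have "2 * R < p" using pR R by linarith
      then show "k \<notin> congruent_indices p h" if "k \<in> ?I" for k
        using not_congruent_in_cross[OF h that] by blast
    qed
    also have "\<dots> = real (card ?I) * (c4 / real p * real (card ?Z))" by simp
    also have "\<dots> \<le> (2 * real R * l) * (c4 / real p * real (card ?Z))"
      using card_hyperbolic_cross[OF R, where 'd = 'd] c4 by (intro mult_right_mono) (auto simp: l_def)
    also have "\<dots> = (2 * c4 * real R * l) / real p * real (card ?Z)" by (simp add: field_simps)
    also have "\<dots> \<le> 1 / 32 * real (card ?Z)"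
      using pl p0 by (intro mult_right_mono) (simp_all add: field_simps)
    finally have B1: "32 * real (card ?B1) \<le> real (card ?Z)" by simp
    define B2 where "B2 = {z \<in> ?Z. \<exists>F. finite F \<and> F \<inter> ?I = {} \<and> (\<forall>k\<in>F. aliases p z h k) \<and> sum (hc_decay s) F > \<tau>}"
    have "\<forall>z\<in>B2. \<exists>F. finite F \<and> F \<inter> ?I = {} \<and> (\<forall>k\<in>F. aliases p z h k) \<and> sum (hc_decay s) F > \<tau>"
      by (simp add: B2_def)
    from bchoice[OF this] obtain F where F: "\<And>z. z \<in> B2 \<Longrightarrow>
        finite (F z) \<and> F z \<inter> ?I = {} \<and> (\<forall>k\<in>F z. aliases p z h k) \<and> sum (hc_decay s) (F z) > \<tau>"
      by blast
    have finB2: "finite B2" by (simp add: B2_def)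
    \<comment> \<open>A finite set that witnesses the large decay sums of all bad generators at once; Markov's
      inequality is the double counting of the decay over \<open>FF\<close>.\<close>
    define FF where "FF = (\<Union>z\<in>B2. F z)"
    have FF: "finite FF" "FF \<inter> ?I = {}" using F finB2 by (auto simp: FF_def)
    have "\<tau> * real (card B2) = (\<Sum>z\<in>B2. \<tau>)" by simp
    also have "\<dots> \<le> (\<Sum>z\<in>B2. \<Sum>k\<in>FF. if z \<in> A k then hc_decay s k else 0)"
    proof (intro sum_mono)
      fix z assume z: "z \<in> B2"
      have "\<tau> \<le> sum (hc_decay s) (F z)" using F[OF z] by simp
      also have "\<dots> = (\<Sum>k\<in>F z. if z \<in> A k then hc_decay s k else 0)"
        using F[OF z] z by (intro sum.cong) (auto simp: A_def B2_def)
      also have "\<dots> \<le> (\<Sum>k\<in>FF. if z \<in> A k then hc_decay s k else 0)"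
        using FF z by (intro sum_mono2) (auto simp: FF_def hc_decay_nonneg)
      finally show "\<tau> \<le> (\<Sum>k\<in>FF. if z \<in> A k then hc_decay s k else 0)" .
    qed
    also have "\<dots> \<le> (\<Sum>z\<in>?Z. \<Sum>k\<in>FF. if z \<in> A k then hc_decay s k else 0)"
      by (intro sum_mono2) (auto simp: B2_def intro!: sum_nonneg hc_decay_nonneg)
    also have "\<dots> = (\<Sum>k\<in>FF. \<Sum>z\<in>?Z. if z \<in> A k then hc_decay s k else 0)" by (rule sum.swap)
    also have "\<dots> = (\<Sum>k\<in>FF. real (card (A k)) * hc_decay s k)"
    proof (intro sum.cong refl)
      fix k
      have "(\<Sum>z\<in>?Z. if z \<in> A k then hc_decay s k else 0) = (\<Sum>z\<in>A k. hc_decay s k)"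
        by (intro sum.mono_neutral_cong_right) (auto simp: A_def)
      then show "(\<Sum>z\<in>?Z. if z \<in> A k then hc_decay s k else 0) = real (card (A k)) * hc_decay s k" by simp
    qed
    also have "\<dots> \<le> (\<Sum>k\<in>FF. c4 / real p * real (card ?Z) * hc_decay s k
        + (if k \<in> congruent_indices p h then real (card ?Z) * hc_decay s k else 0))"
    proof (intro sum_mono)
      fix k
      have "real (card (A k)) \<le> real (card ?Z)" by (intro of_nat_mono card_mono) (auto simp: A_def)
      moreover have "0 \<le> c4 / real p * real (card ?Z)" using c4 by simp
      ultimately have "real (card (A k)) \<le> c4 / real p * real (card ?Z)
          + (if k \<in> congruent_indices p h then real (card ?Z) else 0)" using cardA[of k] by auto
      from mult_right_mono[OF this hc_decay_nonneg[of s k]]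
      show "real (card (A k)) * hc_decay s k \<le> c4 / real p * real (card ?Z) * hc_decay s k
        + (if k \<in> congruent_indices p h then real (card ?Z) * hc_decay s k else 0)"
        by (auto simp: distrib_right split: if_splits)
    qed
    also have "\<dots> = (\<Sum>k\<in>FF. c4 / real p * real (card ?Z) * hc_decay s k)
        + (\<Sum>k\<in>FF. if k \<in> congruent_indices p h then real (card ?Z) * hc_decay s k else 0)"
      by (rule sum.distrib)
    also have "(\<Sum>k\<in>FF. if k \<in> congruent_indices p h then real (card ?Z) * hc_decay s k else 0)
        = (\<Sum>k\<in>FF \<inter> congruent_indices p h. real (card ?Z) * hc_decay s k)"
      by (rule sum.inter_restrict[OF FF(1), symmetric])
    also have "(\<Sum>k\<in>FF. c4 / real p * real (card ?Z) * hc_decay s k) + \<dots>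
       = real (card ?Z) * (c4 / real p * sum (hc_decay s) FF + sum (hc_decay s) (FF \<inter> congruent_indices p h))"
      by (simp add: sum_distrib_left sum_divide_distrib distrib_left mult_ac)
    also have "\<dots> \<le> real (card ?Z) * (c4 * C1 * real R powr (- 2 * s) + C2 * real R powr (- 2 * s))"
    proof (intro mult_left_mono add_mono)
      have "sum (hc_decay s) FF \<le> C1 * l * real R powr (1 - 2 * s)"
        unfolding l_def by (rule C1(2)[OF R FF])
      also have "real R powr (1 - 2 * s) = real R * real R powr (- 2 * s)"
        using R powr_add[of "real R" 1 "- 2 * s"] by simp
      finally have "c4 / real p * sum (hc_decay s) FF \<le> c4 / real p * (C1 * l * (real R * real R powr (- 2 * s)))"
        using c4 by (intro mult_left_mono) auto
      also have "\<dots> = c4 * C1 * real R powr (- 2 * s) * (real R * l / real p)" by simp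
      also have "\<dots> \<le> c4 * C1 * real R powr (- 2 * s) * 1"
        using pRl p0 c4 C1(1) by (intro mult_left_mono) auto
      finally show "c4 / real p * sum (hc_decay s) FF \<le> c4 * C1 * real R powr (- 2 * s)" by simp
      have "2 * freq (h $ j) \<le> p" for j
        using h freq_le[of "h $ j"] component_le_hc_weight[of h j] pR by (simp add: hyperbolic_cross_def)
      then have "sum (hc_decay s) (FF \<inter> congruent_indices p h) \<le> C2 * real p powr (- 2 * s)"
        using p0 FF(1) by (intro C2(2)[of p h]) auto
      also have "\<dots> \<le> C2 * real R powr (- 2 * s)"
        using pR R s C2(1) by (intro mult_left_mono powr_mono2') auto
      finally show "sum (hc_decay s) (FF \<inter> congruent_indices p h) \<le> C2 * real R powr (- 2 * s)" .
    qed simp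
    also have "\<dots> = \<tau> * (1 / 32 * real (card ?Z))" by (simp add: \<tau>_def C_def algebra_simps)
    finally have B2: "32 * real (card B2) \<le> real (card ?Z)" using tau0 by simp
    have "{z \<in> ?Z. bad_generator s \<tau> R p h z} \<subseteq> ?B1 \<union> B2"
      unfolding bad_generator_def A_def B2_def by blast
    then have "card {z \<in> ?Z. bad_generator s \<tau> R p h z} \<le> card ?B1 + card B2"
      using card_mono[of "?B1 \<union> B2"] card_Un_le[of ?B1 B2] finA finB2 finite_hyperbolic_cross
      by (meson finite_UN finite_UnI le_trans)
    then show ?thesis using B1 B2 unfolding \<tau>_def by linarith
  qed
  ultimately show ?thesis using that[of C] by blast
qed

section \<open>Choosing few generators that serve all indices\<close>

text \<open>
  A derandomised Chernoff bound. Each \<open>h\<close> carries the weight \<open>16^b\<close>, where \<open>b\<close> counts the bad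
  choices so far. A random choice multiplies the total weight by at most 2 in the mean, so
  some choice does; after \<open>L\<close> steps the total is at most \<open>2^L * card I < 4^L\<close>, whereas a single \<open>h\<close>
  with more than \<open>L/2\<close> bad choices would weigh more than \<open>4^L\<close>.
\<close>
lemma exists_rarely_bad_sequence:
  fixes Z :: "'z set" and I :: "'h set" and bad :: "'h \<Rightarrow> 'z \<Rightarrow> bool"
  assumes Z: "finite Z" "Z \<noteq> {}" and I: "finite I"
    and bad: "\<And>h. h \<in> I \<Longrightarrow> 16 * card {z \<in> Z. bad h z} \<le> card Z"
    and L: "card I < 2 ^ L"
  shows "\<exists>zs. (\<forall>l<L. zs l \<in> Z) \<and> (\<forall>h\<in>I. 2 * card {l. l < L \<and> bad h (zs l)} \<le> L)"
proof -
  define w where "w h z = (if bad h z then 16 else 1 :: nat)" for h z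
  have step: "\<exists>z\<in>Z. (\<Sum>h\<in>I. c h * w h z) \<le> 2 * (\<Sum>h\<in>I. c h)" for c :: "'h \<Rightarrow> nat"
  proof (rule ccontr)
    assume "\<not> ?thesis"
    then have less: "\<And>z. z \<in> Z \<Longrightarrow> 2 * (\<Sum>h\<in>I. c h) < (\<Sum>h\<in>I. c h * w h z)" by auto
    have wsum: "(\<Sum>z\<in>Z. w h z) \<le> 2 * card Z" if "h \<in> I" for h
    proof -
      have "(\<Sum>z\<in>Z. w h z) \<le> (\<Sum>z\<in>Z. 1 + (if bad h z then 16 else 0))"
        by (intro sum_mono) (auto simp: w_def)
      also have "\<dots> = card Z + (\<Sum>z\<in>Z. if bad h z then 16 else 0)"
        by (simp only: sum.distrib) simp
      also have "(\<Sum>z\<in>Z. if bad h z then 16 else (0::nat)) = (\<Sum>z\<in>{z \<in> Z. bad h z}. 16)"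
        using Z(1) by (simp only: sum.inter_filter)
      also have "card Z + \<dots> = card Z + 16 * card {z \<in> Z. bad h z}" by simp
      finally show ?thesis using bad[OF that] by simp
    qed
    have "card Z * (2 * (\<Sum>h\<in>I. c h)) = (\<Sum>z\<in>Z. 2 * (\<Sum>h\<in>I. c h))" by simp
    also have "\<dots> < (\<Sum>z\<in>Z. \<Sum>h\<in>I. c h * w h z)" using Z less by (intro sum_strict_mono) auto
    also have "\<dots> = (\<Sum>h\<in>I. c h * (\<Sum>z\<in>Z. w h z))"
      by (subst sum.swap) (simp add: sum_distrib_left)
    also have "\<dots> \<le> (\<Sum>h\<in>I. c h * (2 * card Z))" by (intro sum_mono mult_left_mono wsum) auto
    also have "\<dots> = card Z * (2 * (\<Sum>h\<in>I. c h))"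
      by (simp add: sum_distrib_left sum_distrib_right mult_ac)
    finally show False by simp
  qed
  have "\<exists>zs. (\<forall>l<n. zs l \<in> Z) \<and> (\<Sum>h\<in>I. \<Prod>l<n. w h (zs l)) \<le> 2 ^ n * card I" for n
  proof (induction n)
    case 0
    show ?case by simp
  next
    case (Suc n)
    then obtain zs where zs: "\<forall>l<n. zs l \<in> Z" "(\<Sum>h\<in>I. \<Prod>l<n. w h (zs l)) \<le> 2 ^ n * card I" by blast
    obtain z where z: "z \<in> Z" "(\<Sum>h\<in>I. (\<Prod>l<n. w h (zs l)) * w h z) \<le> 2 * (\<Sum>h\<in>I. \<Prod>l<n. w h (zs l))"
      using step[of "\<lambda>h. \<Prod>l<n. w h (zs l)"] by blast
    have "(\<Sum>h\<in>I. \<Prod>l<Suc n. w h ((zs(n := z)) l)) = (\<Sum>h\<in>I. (\<Prod>l<n. w h (zs l)) * w h z)"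
      by simp
    then show ?case using zs z by (intro exI[of _ "zs(n := z)"]) auto
  qed
  then obtain zs where zs: "\<forall>l<L. zs l \<in> Z" "(\<Sum>h\<in>I. \<Prod>l<L. w h (zs l)) \<le> 2 ^ L * card I" by blast
  have "2 * card {l. l < L \<and> bad h (zs l)} \<le> L" if h: "h \<in> I" for h
  proof (rule ccontr)
    let ?b = "card {l. l < L \<and> bad h (zs l)}"
    assume "\<not> ?thesis"
    then have "(4::nat) ^ L \<le> 4 ^ (2 * ?b)" by (intro power_increasing) auto
    also have "\<dots> = 16 ^ ?b" by (simp add: power_mult)
    also have "\<dots> = (\<Prod>l\<in>{l. l < L \<and> bad h (zs l)}. 16)" by simp
    also have "\<dots> = (\<Prod>l\<in>{l. l < L \<and> bad h (zs l)}. w h (zs l))" by (simp add: w_def)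
    also have "\<dots> = (\<Prod>l<L. w h (zs l))" by (intro prod.mono_neutral_left) (auto simp: w_def)
    also have "\<dots> \<le> (\<Sum>h\<in>I. \<Prod>l<L. w h (zs l))" using h I by (intro member_le_sum) auto
    also have "\<dots> \<le> 2 ^ L * card I" by (rule zs(2))
    also have "\<dots> < 2 ^ L * 2 ^ L" using L by simp
    also have "\<dots> = 4 ^ L" by (simp flip: power_mult_distrib)
    finally show False by simp
  qed
  then show ?thesis using zs(1) by blast
qed

section \<open>The unit ball and the approximation error\<close>

lemma inverse_hc_decay_le:
  assumes "s > 0"
  shows "1 / hc_decay s m \<le> (\<Prod>j\<in>UNIV. 1 + real (m $ j) powr (2 * s))"
proof -
  have "1 / hc_decay s m = real (hc_weight m) powr (2 * s)"
    by (simp add: hc_decay_def powr_minus field_simps)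
  also have "\<dots> = (\<Prod>j\<in>UNIV. real (max 1 (m $ j)) powr (2 * s))"
    unfolding hc_weight_def of_nat_prod by (rule prod_powr_distrib)
  also have "\<dots> \<le> (\<Prod>j\<in>UNIV. 1 + real (m $ j) powr (2 * s))"
    using assms by (intro prod_mono) (auto simp: max_def)
  finally show ?thesis .
qed

lemma H_mix_unit_ball_coefficients:
  assumes s: "s > 1/2" and f: "f \<in> H_mix s" "mix_norm s f \<le> 1" and F: "finite F"
  shows "(\<Sum>m\<in>F. (L2_inner f (basis m))\<^sup>2 / hc_decay s m) \<le> 1"
proof -
  have sm: "mix_term s f summable_on UNIV" using f(1) by (simp add: H_mix_def)
  have nn: "mix_term s f m \<ge> 0" for m
    unfolding mix_term_def by (intro mult_nonneg_nonneg prod_nonneg) auto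
  have "(\<Sum>m\<in>F. (L2_inner f (basis m))\<^sup>2 / hc_decay s m) \<le> (\<Sum>m\<in>F. mix_term s f m)"
  proof (intro sum_mono)
    fix m
    have "1 / hc_decay s m * (L2_inner f (basis m))\<^sup>2 \<le> mix_term s f m"
      unfolding mix_term_def using s by (intro mult_right_mono inverse_hc_decay_le) auto
    then show "(L2_inner f (basis m))\<^sup>2 / hc_decay s m \<le> mix_term s f m" by simp
  qed
  also have "\<dots> \<le> (\<Sum>\<^sub>\<infinity>m. mix_term s f m)"
    using sm F nn by (intro finite_sum_le_infsum) auto
  also have "\<dots> \<le> 1"
    using f(2) unfolding mix_norm_def by simp
  finally show ?thesis .
qed

lemma H_mix_unit_ball_coefficients_summable:
  fixes f :: "real ^ 'd \<Rightarrow> real"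
  assumes s: "s > 1/2" and f: "f \<in> H_mix s" "mix_norm s f \<le> 1"
  shows "(\<lambda>m. \<bar>L2_inner f (basis m)\<bar>) summable_on UNIV"
proof -
  let ?a = "\<lambda>m. L2_inner f (basis m)"
  have "(\<lambda>m. (?a m)\<^sup>2 / hc_decay s m) summable_on UNIV"
    by (rule nonneg_bdd_above_summable_on)
       (auto intro!: bdd_aboveI2 H_mix_unit_ball_coefficients[OF s f] divide_nonneg_nonneg hc_decay_nonneg)
  then have sm: "(\<lambda>m. hc_decay s m + (?a m)\<^sup>2 / hc_decay s m) summable_on UNIV"
    by (intro summable_on_add hc_decay_summable s)
  show ?thesis
  proof (rule summable_on_comparison_test[OF sm])
    fix m :: "nat ^ 'd"
    define d where "d = hc_decay s m"
    have d: "d > 0" unfolding d_def by (rule hc_decay_pos)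
    \<comment> \<open>The inequality of arithmetic and geometric means, with a constant lost.\<close>
    have "0 \<le> (d - \<bar>?a m\<bar>)\<^sup>2" by simp
    also have "\<dots> = d\<^sup>2 - 2 * d * \<bar>?a m\<bar> + (?a m)\<^sup>2" by (simp add: power2_diff)
    finally have "2 * d * \<bar>?a m\<bar> \<le> d\<^sup>2 + (?a m)\<^sup>2" by simp
    moreover have "d * \<bar>?a m\<bar> \<ge> 0" using d by simp
    ultimately have "d * \<bar>?a m\<bar> \<le> d\<^sup>2 + (?a m)\<^sup>2" by linarith
    then show "\<bar>?a m\<bar> \<le> hc_decay s m + (?a m)\<^sup>2 / hc_decay s m"
      using d unfolding d_def[symmetric] by (simp add: field_simps power2_eq_square)
  qed simp
qed

text \<open>
  By Parseval's identity the squared error is the error of the estimated coefficients plus the sum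
  of \<open>a(m)\<^sup>2\<close> over the omitted ones, and the latter is at most \<open>\<delta>\<close> times the squared norm.
\<close>
lemma L2_norm_approximation_le:
  fixes f :: "real ^ 'd \<Rightarrow> real"
  assumes s: "s > 1/2" and f: "f \<in> H_mix s" "mix_norm s f \<le> 1" and I: "finite I"
    and c: "(\<Sum>h\<in>I. (L2_inner f (basis h) - c h)\<^sup>2) \<le> E"
    and \<delta>: "\<And>m. m \<notin> I \<Longrightarrow> hc_decay s m \<le> \<delta>" "\<delta> \<ge> 0"
  shows "L2_norm (\<lambda>x. f x - (\<Sum>h\<in>I. c h * basis h x)) \<le> sqrt (E + \<delta>)"
proof -
  let ?a = "\<lambda>m. L2_inner f (basis m)"
  define c' where "c' m = (if m \<in> I then c m else 0)" for m
  define r where "r m = ?a m - c' m" for m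
  have a: "(\<lambda>m. \<bar>?a m\<bar>) summable_on UNIV" by (rule H_mix_unit_ball_coefficients_summable[OF s f])
  have c'sum: "((\<lambda>m. c' m * basis m x) has_sum (\<Sum>h\<in>I. c h * basis h x)) UNIV" for x
    by (rule has_sum_finite_neutralI[OF I]) (auto simp: c'_def)
  have "((\<lambda>m. \<bar>c' m\<bar>) has_sum (\<Sum>h\<in>I. \<bar>c h\<bar>)) UNIV"
    by (rule has_sum_finite_neutralI[OF I]) (auto simp: c'_def)
  then have "(\<lambda>m. \<bar>?a m\<bar> + \<bar>c' m\<bar>) summable_on UNIV"
    by (intro summable_on_add a has_sum_imp_summable)
  then have r: "(\<lambda>m. \<bar>r m\<bar>) summable_on UNIV"
    by (rule summable_on_comparison_test) (auto simp: r_def abs_triangle_ineq4)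
  have tc: "torus_continuous f" using f(1) by (simp add: H_mix_def)
  have eq: "f x - (\<Sum>h\<in>I. c h * basis h x) = basis_series r x" if x: "x \<in> torus" for x
  proof -
    have "((\<lambda>m. ?a m * basis m x + - (c' m * basis m x)) has_sum (f x + - (\<Sum>h\<in>I. c h * basis h x))) UNIV"
      unfolding eq_basis_series_of_coefficients[OF tc a x]
      by (intro has_sum_add has_sum_basis_series a) (simp add: has_sum_uminus c'sum)
    then have "((\<lambda>m. r m * basis m x) has_sum (f x - (\<Sum>h\<in>I. c h * basis h x))) UNIV"
      by (simp add: r_def left_diff_distrib)
    then show ?thesis using has_sum_basis_series[OF r] has_sum_unique by blast
  qed
  have "L2_inner (\<lambda>x. f x - (\<Sum>h\<in>I. c h * basis h x)) (\<lambda>x. f x - (\<Sum>h\<in>I. c h * basis h x))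
      = L2_inner (basis_series r) (basis_series r)"
    by (rule L2_inner_cong_torus) (auto simp: eq)
  also have "\<dots> \<le> E + \<delta>"
  proof (rule has_sum_le_finite_sums[OF Parseval_basis_series[OF r]])
    fix F :: "(nat ^ 'd) set" assume F: "finite F"
    have "(\<Sum>m\<in>F. (r m)\<^sup>2) \<le> (\<Sum>m\<in>I \<union> (F - I). (r m)\<^sup>2)" using F I by (intro sum_mono2) auto
    also have "\<dots> = (\<Sum>m\<in>I. (r m)\<^sup>2) + (\<Sum>m\<in>F - I. (r m)\<^sup>2)"
      using F I by (intro sum.union_disjoint) auto
    also have "(\<Sum>m\<in>I. (r m)\<^sup>2) = (\<Sum>h\<in>I. (?a h - c h)\<^sup>2)" by (simp add: r_def c'_def)
    also have "\<dots> \<le> E" by (rule c)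
    also have "(\<Sum>m\<in>F - I. (r m)\<^sup>2) \<le> (\<Sum>m\<in>F - I. \<delta> * ((?a m)\<^sup>2 / hc_decay s m))"
    proof (intro sum_mono)
      fix m assume m: "m \<in> F - I"
      have "(r m)\<^sup>2 = hc_decay s m * ((?a m)\<^sup>2 / hc_decay s m)"
        using m hc_decay_pos[of s m] by (simp add: r_def c'_def)
      also have "\<dots> \<le> \<delta> * ((?a m)\<^sup>2 / hc_decay s m)"
        using m by (intro mult_right_mono \<delta>(1)) (auto intro!: divide_nonneg_nonneg hc_decay_nonneg)
      finally show "(r m)\<^sup>2 \<le> \<delta> * ((?a m)\<^sup>2 / hc_decay s m)" .
    qed
    also have "\<dots> = \<delta> * (\<Sum>m\<in>F - I. (?a m)\<^sup>2 / hc_decay s m)" by (simp add: sum_distrib_left)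
    also have "\<dots> \<le> \<delta> * 1"
      using F by (intro mult_left_mono H_mix_unit_ball_coefficients[OF s f] \<delta>(2)) auto
    finally show "(\<Sum>m\<in>F. (r m)\<^sup>2) \<le> E + \<delta>" by simp
  qed
  finally show ?thesis unfolding L2_norm_def by simp
qed

lemma sampling_number_le:
  assumes "\<And>i. i \<in> {1..n} \<Longrightarrow> x i \<in> torus" "\<And>i. i \<in> {1..n} \<Longrightarrow> \<phi> i \<in> L2_torus"
    and "\<And>f. f \<in> H \<Longrightarrow> N f \<le> 1 \<Longrightarrow> L2_norm (\<lambda>y. f y - (\<Sum>i=1..n. f (x i) * \<phi> i y)) \<le> e"
  shows "sampling_number H N n \<le> ennreal e"
proof -
  have "sampling_number H N n \<le> (INF \<phi> \<in> {1..n} \<rightarrow> L2_torus. SUP f \<in> {f \<in> H. N f \<le> 1}.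
          ennreal (L2_norm (\<lambda>y. f y - (\<Sum>i=1..n. f (x i) * \<phi> i y))))"
    unfolding sampling_number_def by (rule INF_lower) (use assms(1) in auto)
  also have "\<dots> \<le> (SUP f \<in> {f \<in> H. N f \<le> 1}. ennreal (L2_norm (\<lambda>y. f y - (\<Sum>i=1..n. f (x i) * \<phi> i y))))"
    by (rule INF_lower) (use assms(2) in auto)
  also have "\<dots> \<le> ennreal e" by (rule SUP_least) (use assms(3) in \<open>auto intro: ennreal_leI\<close>)
  finally show ?thesis .
qed

text \<open>
  Approximation by zero. This settles those \<open>n\<close> for which \<open>n / (ln n)^d\<close> is too small for a
  nonempty hyperbolic cross.
\<close>
lemma sampling_number_H_mix_le_1:
  assumes s: "s > 1/2"
  shows "sampling_number (H_mix s :: (real ^ 'd \<Rightarrow> real) set) (mix_norm s) n \<le> ennreal 1"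
proof (rule sampling_number_le[where x = "\<lambda>_. 0" and \<phi> = "\<lambda>_ _. 0"])
  fix f :: "real ^ 'd \<Rightarrow> real" assume f: "f \<in> H_mix s" "mix_norm s f \<le> 1"
  have dec: "hc_decay s m \<le> 1" for m :: "nat ^ 'd"
    using powr_mono2'[of "- 2 * s" 1 "real (hc_weight m)"] hc_weight_ge_1[of m] s by (simp add: hc_decay_def)
  have "L2_norm (\<lambda>x. f x - (\<Sum>h\<in>{}. 0 * basis h x)) \<le> sqrt (0 + 1)"
    using f by (intro L2_norm_approximation_le[OF s]) (auto simp: dec)
  then show "L2_norm (\<lambda>y. f y - (\<Sum>i=1..n. f 0 * 0)) \<le> 1" by simp
qed (auto simp: torus_def L2_torus_def)

text \<open>
  The factor \<open>d\<close> is summed only where \<open>e\<close> is nonzero. For lattices \<open>e\<close> is supported on the aliasing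
  indices, where the sum of the decay is under control.
\<close>
lemma weighted_Cauchy_Schwarz_on_support:
  fixes b d e :: "'a \<Rightarrow> real"
  assumes "finite F" and d: "\<And>k. k \<in> F \<Longrightarrow> d k > 0"
  shows "(\<Sum>k\<in>F. b k * e k)\<^sup>2 \<le> (\<Sum>k\<in>{k \<in> F. e k \<noteq> 0}. d k) * (\<Sum>k\<in>F. (b k)\<^sup>2 / d k * (e k)\<^sup>2)"
proof -
  let ?G = "{k \<in> F. e k \<noteq> 0}"
  have "(\<Sum>k\<in>F. b k * e k) = (\<Sum>k\<in>?G. sqrt (d k) * (b k * e k / sqrt (d k)))"
    using assms by (intro sum.mono_neutral_cong_right) (auto dest: d)
  then have "(\<Sum>k\<in>F. b k * e k)\<^sup>2 \<le> (\<Sum>k\<in>?G. (sqrt (d k))\<^sup>2) * (\<Sum>k\<in>?G. (b k * e k / sqrt (d k))\<^sup>2)"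
    by (simp only: Cauchy_Schwarz_ineq_sum)
  also have "(\<Sum>k\<in>?G. (sqrt (d k))\<^sup>2) = (\<Sum>k\<in>?G. d k)"
    by (intro sum.cong refl) (auto dest: d simp: less_imp_le)
  also have "(\<Sum>k\<in>?G. (b k * e k / sqrt (d k))\<^sup>2) = (\<Sum>k\<in>F. (b k)\<^sup>2 / d k * (e k)\<^sup>2)"
    using assms by (intro sum.mono_neutral_cong_left)
      (auto dest: d simp: power_mult_distrib power_divide less_imp_le)
  finally show ?thesis .
qed

section \<open>Averaging over the good lattices\<close>

definition good_lattices :: "real \<Rightarrow> real \<Rightarrow> nat \<Rightarrow> nat \<Rightarrow> (nat \<Rightarrow> int ^ 'd) \<Rightarrow> nat \<Rightarrow> nat ^ 'd \<Rightarrow> nat set" where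
  "good_lattices s \<tau> R p zs L h = {l \<in> {..<L}. \<not> bad_generator s \<tau> R p h (zs l)}"

definition averaged_coeff ::
  "nat \<Rightarrow> (nat \<Rightarrow> int ^ 'd) \<Rightarrow> (nat ^ 'd \<Rightarrow> nat set) \<Rightarrow> (real ^ 'd \<Rightarrow> real) \<Rightarrow> nat ^ 'd \<Rightarrow> real" where
  "averaged_coeff p zs G f h = (\<Sum>l\<in>G h. lattice_mean p (zs l) (\<lambda>x. basis h x * f x)) / real (card (G h))"

lemma lattice_mean_sum: "lattice_mean p z (\<lambda>x. \<Sum>k\<in>F. a k * g k x) = (\<Sum>k\<in>F. a k * lattice_mean p z (g k))"
proof -
  have "(\<Sum>i<p. \<Sum>k\<in>F. a k * g k (lattice_point p z i)) = (\<Sum>k\<in>F. a k * (\<Sum>i<p. g k (lattice_point p z i)))"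
    by (subst sum.swap) (simp add: sum_distrib_left)
  then show ?thesis
    by (simp only: lattice_mean_def sum_divide_distrib[of _ F] times_divide_eq_right)
qed

lemma lattice_mean_mono:
  assumes "\<And>x. f x \<le> g x" shows "lattice_mean p z f \<le> lattice_mean p z g"
  unfolding lattice_mean_def using assms by (intro divide_right_mono sum_mono) auto

text \<open>
  By the Cauchy-Schwarz inequality, the squared error \<open>(e l h)\<^sup>2\<close> of one good lattice is at most \<open>\<tau>\<close>
  times the sum of \<open>v(k) D(h,k)\<^sup>2\<close>, where \<open>v(k) = a(k)\<^sup>2 W(k)^(2s)\<close>. Averaging over at least \<open>L/2\<close> lattices costs the factor \<open>2/L\<close>. Now the order of
  summation is exchanged: for fixed \<open>l\<close> and \<open>k\<close> the sum over \<open>h\<close> is bounded by Bessel's inequality,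
  and the remaining sum over the \<open>L\<close> lattices cancels the \<open>1/L\<close>.
\<close>
lemma averaged_coeff_partial_sum_error:
  fixes a :: "nat ^ 'd \<Rightarrow> real"
  assumes p: "p > 0" and L: "L > 0" and F: "finite F" "hyperbolic_cross R \<subseteq> F"
    and G: "G = good_lattices s \<tau> R p zs L"
    and maj: "\<And>h. h \<in> hyperbolic_cross R \<Longrightarrow> L \<le> 2 * card (G h)"
    and a: "(\<Sum>k\<in>F - hyperbolic_cross R. (a k)\<^sup>2 / hc_decay s k) \<le> 1"
    and \<tau>: "\<tau> \<ge> 0"
  shows "(\<Sum>h\<in>hyperbolic_cross R. (a h - averaged_coeff p zs G (\<lambda>x. \<Sum>k\<in>F. a k * basis k x) h)\<^sup>2)
           \<le> 2 * 2 ^ CARD('d) * \<tau>"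
proof -
  let ?I = "hyperbolic_cross R :: (nat ^ 'd) set" and ?S = "\<lambda>x. \<Sum>k\<in>F. a k * basis k x"
  define D where "D l h k = lattice_mean p (zs l) (\<lambda>x. basis h x * basis k x)" for l h k
  define e where "e l h = (\<Sum>k\<in>F - ?I. a k * D l h k)" for l h
  define v where "v k = (a k)\<^sup>2 / hc_decay s k" for k
  have v0: "v k \<ge> 0" for k by (simp add: v_def hc_decay_nonneg)
  have finI: "finite ?I" by (rule finite_hyperbolic_cross)
  have no_alias: "\<not> aliases p (zs l) h k" if "h \<in> ?I" "l \<in> G h" "k \<in> ?I" for l h k
    using that unfolding G good_lattices_def bad_generator_def by blast
  have mean: "lattice_mean p (zs l) (\<lambda>x. basis h x * ?S x) = a h + e l h" if h: "h \<in> ?I" "l \<in> G h" for l h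
  proof -
    have "lattice_mean p (zs l) (\<lambda>x. basis h x * ?S x) = lattice_mean p (zs l) (\<lambda>x. \<Sum>k\<in>F. a k * (basis h x * basis k x))"
      by (simp add: sum_distrib_left mult_ac)
    also have "\<dots> = (\<Sum>k\<in>F. a k * D l h k)" unfolding D_def by (rule lattice_mean_sum)
    also have "\<dots> = e l h + (\<Sum>k\<in>?I. a k * D l h k)" unfolding e_def by (rule sum.subset_diff[OF F(2,1)])
    also have "(\<Sum>k\<in>?I. a k * D l h k) = (\<Sum>k\<in>?I. if k = h then a k else 0)"
    proof (intro sum.cong refl)
      fix k assume "k \<in> ?I"
      then have "D l h k = (if h = k then 1 else 0)"
        unfolding D_def by (intro lattice_mean_basis p no_alias h)
      then show "a k * D l h k = (if k = h then a k else 0)" by simp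
    qed
    also have "\<dots> = a h" using h(1) finI by simp
    finally show ?thesis by simp
  qed
  have e_sq: "(e l h)\<^sup>2 \<le> \<tau> * (\<Sum>k\<in>F - ?I. v k * (D l h k)\<^sup>2)" if h: "h \<in> ?I" "l \<in> G h" for l h
  proof -
    let ?A = "{k \<in> F - ?I. D l h k \<noteq> 0}"
    have "\<forall>k\<in>?A. aliases p (zs l) h k"
    proof
      fix k assume k: "k \<in> ?A"
      show "aliases p (zs l) h k"
      proof (rule ccontr)
        assume "\<not> aliases p (zs l) h k"
        then have "D l h k = (if h = k then 1 else 0)" unfolding D_def by (rule lattice_mean_basis[OF p])
        then show False using k h(1) by (auto split: if_splits)
      qed
    qed
    moreover have "\<not> bad_generator s \<tau> R p h (zs l)" using h(2) by (auto simp: G good_lattices_def)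
    moreover have "finite ?A" "?A \<inter> ?I = {}" using F(1) by auto
    ultimately have "sum (hc_decay s) ?A \<le> \<tau>" unfolding bad_generator_def by (meson not_le)
    moreover have "(e l h)\<^sup>2 \<le> sum (hc_decay s) ?A * (\<Sum>k\<in>F - ?I. v k * (D l h k)\<^sup>2)"
      unfolding e_def v_def using F(1) by (intro weighted_Cauchy_Schwarz_on_support hc_decay_pos) auto
    ultimately show ?thesis
      by (elim order_trans) (intro mult_right_mono sum_nonneg mult_nonneg_nonneg v0, auto)
  qed
  have avg: "(a h - averaged_coeff p zs G ?S h)\<^sup>2 \<le> 2 / real L * (\<Sum>l\<in>G h. (e l h)\<^sup>2)" if h: "h \<in> ?I" for h
  proof -
    define N where "N = real (card (G h))"
    have N: "real L \<le> 2 * N" using maj[OF h] unfolding N_def by linarith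
    then have N0: "N > 0" using L by simp
    have "averaged_coeff p zs G ?S h = (\<Sum>l\<in>G h. a h + e l h) / N"
      unfolding averaged_coeff_def N_def using mean[OF h] by simp
    also have "\<dots> = a h + (\<Sum>l\<in>G h. e l h) / N" using N0 by (simp add: sum.distrib N_def add_divide_distrib)
    finally have "(a h - averaged_coeff p zs G ?S h)\<^sup>2 = (\<Sum>l\<in>G h. 1 * e l h)\<^sup>2 / N\<^sup>2" by (simp add: power_divide)
    also have "\<dots> \<le> ((\<Sum>l\<in>G h. 1\<^sup>2) * (\<Sum>l\<in>G h. (e l h)\<^sup>2)) / N\<^sup>2"
      by (intro divide_right_mono Cauchy_Schwarz_ineq_sum) auto
    also have "\<dots> = 1 / N * (\<Sum>l\<in>G h. (e l h)\<^sup>2)" using N0 by (simp add: N_def power2_eq_square)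
    also have "\<dots> \<le> 2 / real L * (\<Sum>l\<in>G h. (e l h)\<^sup>2)"
      using N N0 L by (intro mult_right_mono sum_nonneg) (auto simp: field_simps)
    finally show ?thesis .
  qed
  have "(\<Sum>h\<in>?I. (a h - averaged_coeff p zs G ?S h)\<^sup>2) \<le> (\<Sum>h\<in>?I. 2 / real L * (\<Sum>l\<in>G h. (e l h)\<^sup>2))"
    by (intro sum_mono avg)
  also have "\<dots> \<le> (\<Sum>h\<in>?I. 2 / real L * (\<Sum>l\<in>G h. \<tau> * (\<Sum>k\<in>F - ?I. v k * (D l h k)\<^sup>2)))"
    by (intro sum_mono mult_left_mono e_sq) auto
  also have "\<dots> = 2 / real L * \<tau> * (\<Sum>h\<in>?I. \<Sum>l\<in>G h. \<Sum>k\<in>F - ?I. v k * (D l h k)\<^sup>2)"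
    by (simp add: sum_distrib_left mult_ac)
  also have "(\<Sum>h\<in>?I. \<Sum>l\<in>G h. \<Sum>k\<in>F - ?I. v k * (D l h k)\<^sup>2)
     = (\<Sum>l<L. \<Sum>h\<in>{h \<in> ?I. l \<in> G h}. \<Sum>k\<in>F - ?I. v k * (D l h k)\<^sup>2)"
  proof -
    have "G h = {l \<in> {..<L}. l \<in> G h}" for h unfolding G good_lattices_def by blast
    then have "(\<Sum>h\<in>?I. \<Sum>l\<in>G h. \<Sum>k\<in>F - ?I. v k * (D l h k)\<^sup>2)
      = (\<Sum>h\<in>?I. \<Sum>l\<in>{l \<in> {..<L}. l \<in> G h}. \<Sum>k\<in>F - ?I. v k * (D l h k)\<^sup>2)" by simp
    also have "\<dots> = (\<Sum>l<L. \<Sum>h\<in>{h \<in> ?I. l \<in> G h}. \<Sum>k\<in>F - ?I. v k * (D l h k)\<^sup>2)"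
      by (rule sum.swap_restrict[OF finI]) simp
    finally show ?thesis .
  qed
  also have "2 / real L * \<tau> * (\<Sum>l<L. \<Sum>h\<in>{h \<in> ?I. l \<in> G h}. \<Sum>k\<in>F - ?I. v k * (D l h k)\<^sup>2)
     \<le> 2 / real L * \<tau> * (\<Sum>l<L. 2 ^ CARD('d))"
  proof (rule mult_left_mono[OF sum_mono])
    fix l
    let ?J = "{h \<in> ?I. l \<in> G h}"
    have "(\<Sum>h\<in>?J. (D l h k)\<^sup>2) \<le> 2 ^ CARD('d)" for k
    proof -
      have "(\<Sum>h\<in>?J. (D l h k)\<^sup>2) \<le> lattice_mean p (zs l) (\<lambda>x. (basis k x)\<^sup>2)"
        unfolding D_def using finI no_alias by (intro lattice_mean_Bessel p) auto
      also have "\<dots> \<le> lattice_mean p (zs l) (\<lambda>x. 2 ^ CARD('d))"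
        by (intro lattice_mean_mono basis_sq_le)
      also have "\<dots> = 2 ^ CARD('d)" using p by (simp add: lattice_mean_def)
      finally show ?thesis .
    qed
    then have "(\<Sum>k\<in>F - ?I. v k * (\<Sum>h\<in>?J. (D l h k)\<^sup>2)) \<le> (\<Sum>k\<in>F - ?I. v k * 2 ^ CARD('d))"
      by (intro sum_mono mult_left_mono v0)
    also have "\<dots> = 2 ^ CARD('d) * (\<Sum>k\<in>F - ?I. v k)" by (simp add: sum_distrib_right mult.commute)
    also have "\<dots> \<le> 2 ^ CARD('d) * 1" using a unfolding v_def by (intro mult_left_mono) auto
    finally show "(\<Sum>h\<in>?J. \<Sum>k\<in>F - ?I. v k * (D l h k)\<^sup>2) \<le> 2 ^ CARD('d)"
      by (subst sum.swap) (simp add: sum_distrib_left)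
  qed (use \<tau> in simp)
  finally show ?thesis using L by (simp add: mult_ac)
qed

text \<open>
  The estimator uses finitely many samples, so it is continuous under the pointwise convergence of
  the partial sums of the Fourier series.
\<close>
lemma averaged_coeff_error:
  fixes f :: "real ^ 'd \<Rightarrow> real"
  assumes s: "s > 1/2" and f: "f \<in> H_mix s" "mix_norm s f \<le> 1"
    and p: "p > 0" and L: "L > 0" and G: "G = good_lattices s \<tau> R p zs L"
    and maj: "\<And>h. h \<in> hyperbolic_cross R \<Longrightarrow> L \<le> 2 * card (G h)"
    and \<tau>: "\<tau> \<ge> 0"
  shows "(\<Sum>h\<in>hyperbolic_cross R. (L2_inner f (basis h) - averaged_coeff p zs G f h)\<^sup>2)
           \<le> 2 * 2 ^ CARD('d) * \<tau>"
proof -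
  let ?I = "hyperbolic_cross R :: (nat ^ 'd) set" and ?a = "\<lambda>m. L2_inner f (basis m)"
  have a: "(\<lambda>m. \<bar>?a m\<bar>) summable_on UNIV" by (rule H_mix_unit_ball_coefficients_summable[OF s f])
  have tc: "torus_continuous f" using f(1) by (simp add: H_mix_def)
  have lim: "((\<lambda>F. \<Sum>k\<in>F. ?a k * basis k x) \<longlongrightarrow> f x) (finite_subsets_at_top UNIV)" if "x \<in> torus" for x
    using has_sum_basis_series[OF a, of x] eq_basis_series_of_coefficients[OF tc a that]
    by (simp add: has_sum_def)
  show ?thesis
  proof (rule tendsto_upperbound)
    show "((\<lambda>F. \<Sum>h\<in>?I. (?a h - averaged_coeff p zs G (\<lambda>x. \<Sum>k\<in>F. ?a k * basis k x) h)\<^sup>2) \<longlongrightarrow>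
        (\<Sum>h\<in>?I. (?a h - averaged_coeff p zs G f h)\<^sup>2)) (finite_subsets_at_top UNIV)"
      unfolding averaged_coeff_def lattice_mean_def divide_inverse
      by (intro tendsto_intros lim lattice_point_torus)
    show "\<forall>\<^sub>F F in finite_subsets_at_top UNIV.
      (\<Sum>h\<in>?I. (?a h - averaged_coeff p zs G (\<lambda>x. \<Sum>k\<in>F. ?a k * basis k x) h)\<^sup>2) \<le> 2 * 2 ^ CARD('d) * \<tau>"
      unfolding eventually_finite_subsets_at_top
    proof (intro exI[of _ ?I] conjI allI impI)
      fix F :: "(nat ^ 'd) set" assume "finite F \<and> ?I \<subseteq> F \<and> F \<subseteq> UNIV"
      then show "(\<Sum>h\<in>?I. (?a h - averaged_coeff p zs G (\<lambda>x. \<Sum>k\<in>F. ?a k * basis k x) h)\<^sup>2) \<le> 2 * 2 ^ CARD('d) * \<tau>"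
        by (intro averaged_coeff_partial_sum_error[OF p L _ _ G maj _ \<tau>] H_mix_unit_ball_coefficients[OF s f]) auto
    qed (auto simp: finite_hyperbolic_cross)
  qed simp
qed

lemma sampling_number_H_mix_le_lattices:
  assumes s: "s > 1/2" and R: "R \<ge> 1" and p: "p > 0" and L: "L > 0"
    and maj: "\<And>h :: nat ^ 'd. h \<in> hyperbolic_cross R \<Longrightarrow> L \<le> 2 * card (good_lattices s \<tau> R p zs L h)"
    and \<tau>: "\<tau> \<ge> 0" and n: "L * p \<le> n"
  shows "sampling_number (H_mix s :: (real ^ 'd \<Rightarrow> real) set) (mix_norm s) n
           \<le> ennreal (sqrt (2 * 2 ^ CARD('d) * \<tau> + real R powr (- 2 * s)))"
proof -
  let ?I = "hyperbolic_cross R :: (nat ^ 'd) set"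
  define G where "G = (good_lattices s \<tau> R p zs L :: nat ^ 'd \<Rightarrow> nat set)"
  \<comment> \<open>Node \<open>q = l * p + t\<close> is the \<open>t\<close>-th point of the \<open>l\<close>-th lattice. The nodes of the sampling
    operator are numbered from 1, and those beyond \<open>L * p\<close> get the zero function.\<close>
  define pt where "pt q = lattice_point p (zs (q div p)) (q mod p)" for q
  define \<psi> where "\<psi> q y = (\<Sum>h\<in>?I. (if q div p \<in> G h then basis h (pt q) / (real p * real (card (G h))) else 0) * basis h y)" for q y
  define x where "x i = (if i - 1 < L * p then pt (i - 1) else 0)" for i
  define \<phi> where "\<phi> i = (if i - 1 < L * p then \<psi> (i - 1) else (\<lambda>y. 0))" for i
  have recon: "(\<Sum>i=1..n. f (x i) * \<phi> i y) = (\<Sum>h\<in>?I. averaged_coeff p zs G f h * basis h y)" for f :: "real ^ 'd \<Rightarrow> real" and y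
  proof -
    let ?c = "\<lambda>h l t. if l \<in> G h then f (lattice_point p (zs l) t) * basis h (lattice_point p (zs l) t) / (real p * real (card (G h))) else 0"
    have "(\<Sum>i=1..n. f (x i) * \<phi> i y) = (\<Sum>q<n. f (x (Suc q)) * \<phi> (Suc q) y)"
      by (rule sum.reindex_bij_witness[of _ Suc "\<lambda>i. i - 1"]) auto
    also have "\<dots> = (\<Sum>q<L*p. f (x (Suc q)) * \<phi> (Suc q) y)"
      using n by (intro sum.mono_neutral_right) (auto simp: \<phi>_def)
    also have "\<dots> = (\<Sum>q<L*p. f (pt q) * \<psi> q y)" by (intro sum.cong) (auto simp: x_def \<phi>_def)
    also have "\<dots> = (\<Sum>l<L. \<Sum>q = l * p..<l * p + p. f (pt q) * \<psi> q y)"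
      by (rule sum.nat_group[symmetric])
    also have "\<dots> = (\<Sum>l<L. \<Sum>t<p. f (pt (l * p + t)) * \<psi> (l * p + t) y)"
    proof (rule sum.cong[OF refl])
      fix l
      show "(\<Sum>q = l * p..<l * p + p. f (pt q) * \<psi> q y) = (\<Sum>t<p. f (pt (l * p + t)) * \<psi> (l * p + t) y)"
        by (rule sum.reindex_bij_witness[of _ "\<lambda>t. l * p + t" "\<lambda>q. q - l * p"]) auto
    qed
    also have "\<dots> = (\<Sum>l<L. \<Sum>t<p. \<Sum>h\<in>?I. ?c h l t * basis h y)"
    proof (intro sum.cong refl)
      fix l t assume "t \<in> {..<p}"
      then have "(l * p + t) div p = l" "(l * p + t) mod p = t" by auto
      then show "f (pt (l * p + t)) * \<psi> (l * p + t) y = (\<Sum>h\<in>?I. ?c h l t * basis h y)"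
        unfolding \<psi>_def pt_def sum_distrib_left by (intro sum.cong refl) auto
    qed
    also have "\<dots> = (\<Sum>l<L. \<Sum>h\<in>?I. \<Sum>t<p. ?c h l t * basis h y)" by (intro sum.cong refl sum.swap)
    also have "\<dots> = (\<Sum>h\<in>?I. \<Sum>l<L. \<Sum>t<p. ?c h l t * basis h y)" by (rule sum.swap)
    also have "\<dots> = (\<Sum>h\<in>?I. averaged_coeff p zs G f h * basis h y)"
    proof (intro sum.cong refl)
      fix h
      have Gh: "G h = {l \<in> {..<L}. l \<in> G h}" unfolding G_def good_lattices_def by blast
      have "(\<Sum>l<L. \<Sum>t<p. ?c h l t) = (\<Sum>l<L. if l \<in> G h then lattice_mean p (zs l) (\<lambda>x. basis h x * f x) / real (card (G h)) else 0)"
        by (intro sum.cong refl) (simp add: lattice_mean_def sum_divide_distrib mult_ac)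
      also have "\<dots> = (\<Sum>l\<in>{l \<in> {..<L}. l \<in> G h}. lattice_mean p (zs l) (\<lambda>x. basis h x * f x) / real (card (G h)))"
        by (rule sum.inter_filter[symmetric]) simp
      also have "\<dots> = averaged_coeff p zs G f h"
        unfolding averaged_coeff_def Gh[symmetric] by (simp add: sum_divide_distrib)
      finally have "(\<Sum>l<L. \<Sum>t<p. ?c h l t) = averaged_coeff p zs G f h" .
      then show "(\<Sum>l<L. \<Sum>t<p. ?c h l t * basis h y) = averaged_coeff p zs G f h * basis h y"
        by (simp only: sum_distrib_right[symmetric])
    qed
    finally show ?thesis .
  qed
  show ?thesis
  proof (rule sampling_number_le[where x = x and \<phi> = \<phi>])
    have "(0 :: real ^ 'd) \<in> torus" by (simp add: torus_def)
    then show "x i \<in> torus" for i by (simp add: x_def pt_def lattice_point_torus)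
    have tb: "torus_bounded (\<phi> i)" for i
    proof (cases "i - 1 < L * p")
      case True
      then show ?thesis unfolding \<phi>_def \<psi>_def[abs_def]
        by (simp only: if_True) (intro torus_bounded_sum torus_bounded_cmult torus_bounded_basis)
    qed (simp add: \<phi>_def torus_bounded_continuous)
    show "\<phi> i \<in> L2_torus" for i
      using tb[of i] torus_bounded_integrable[OF torus_bounded_mult[OF tb[of i] tb[of i]]]
      by (auto simp: L2_torus_def torus_bounded_def power2_eq_square)
    fix f :: "real ^ 'd \<Rightarrow> real" assume f: "f \<in> H_mix s" "mix_norm s f \<le> 1"
    show "L2_norm (\<lambda>y. f y - (\<Sum>i=1..n. f (x i) * \<phi> i y)) \<le> sqrt (2 * 2 ^ CARD('d) * \<tau> + real R powr (- 2 * s))"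
      unfolding recon
    proof (rule L2_norm_approximation_le[OF s f finite_hyperbolic_cross])
      show "(\<Sum>h\<in>?I. (L2_inner f (basis h) - averaged_coeff p zs G f h)\<^sup>2) \<le> 2 * 2 ^ CARD('d) * \<tau>"
        by (rule averaged_coeff_error[OF s f p L G_def _ \<tau>]) (unfold G_def, rule maj)
      show "hc_decay s m \<le> real R powr (- 2 * s)" if "m \<notin> ?I" for m
        using that R s unfolding hc_decay_def hyperbolic_cross_def by (intro powr_mono2') auto
    qed simp
  qed
qed

section \<open>The sampling numbers\<close>

text \<open>
  The parameters: \<open>R\<close> is the integer part of \<open>X = n / (D (ln n)^d)\<close>, the prime \<open>p\<close> is of the order
  \<open>R (2 + ln R)^(d-1)\<close>, and \<open>L\<close> is the least number with \<open>n < 2^L\<close>, so that \<open>2^L\<close> exceeds the size of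
  the cross. The constant \<open>D\<close> is made such that \<open>L * p \<le> n\<close>; the estimates \<open>2 + ln R \<le> 4 ln n\<close> and
  \<open>L \<le> 3 ln n\<close> used for this hold from \<open>n = 2\<close> on because \<open>ln 2 \<ge> 2/3\<close>.
\<close>
theorem corollary3:
  fixes s :: real
  assumes "s > 1/2"
  shows "\<exists>K>0. \<forall>n\<ge>2.
           sampling_number (H_mix s :: (real ^ 'd \<Rightarrow> real) set) (mix_norm s) n
             \<le> ennreal (K * real n powr (- s) * ln (real n) powr (s * real CARD('d)))"
proof -
  have s: "s > 1/2" by (rule assms)
  obtain Cp where Cp: "Cp \<ge> 1" "\<And>x. x \<ge> 1 \<Longrightarrow> \<exists>p. prime p \<and> x \<le> real p \<and> real p \<le> Cp * x"
    by (rule prime_between_multiples) blast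
  obtain Cb where Cb: "Cb > 0" "\<And>R p h. R \<ge> 1 \<Longrightarrow> prime p \<Longrightarrow> h \<in> hyperbolic_cross R \<Longrightarrow>
     64 * 4 ^ CARD('d) * real R * (2 + ln (real R)) ^ (CARD('d) - 1) \<le> real p \<Longrightarrow>
     16 * card {z \<in> generators p. bad_generator s (Cb * real R powr (- 2 * s)) R p (h :: nat ^ 'd) z}
       \<le> card (generators p :: (int ^ 'd) set)"
    using bad_generators_rare[OF s] by blast
  define d where "d = CARD('d)"
  have d: "d \<ge> 1" by (simp add: d_def Suc_le_eq)
  define c where "c = (64 :: real) * 4 ^ d"
  have c: "c \<ge> 1" unfolding c_def using one_le_power[of "4::real" d] by linarith
  define D where "D = 3 * Cp * c * 4 ^ d"
  have "1 \<le> Cp * c" using mult_mono[of 1 Cp 1 c] Cp(1) c by simp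
  then have D: "D \<ge> 3 * 4 ^ d" unfolding D_def by simp
  then have D0: "D > 0" by (rule less_le_trans[rotated]) simp
  define M where "M = sqrt (2 * 2 ^ d * Cb + 1)"
  have M: "M \<ge> 1" using Cb(1) by (simp add: M_def)
  define K where "K = M * (2 * D) powr s"
  have K0: "K > 0" using M D0 by (simp add: K_def)
  have "sampling_number (H_mix s :: (real ^ 'd \<Rightarrow> real) set) (mix_norm s) n
             \<le> ennreal (K * real n powr (- s) * ln (real n) powr (s * real d))" if n: "n \<ge> 2" for n
  proof -
    define l where "l = ln (real n)"
    have "ln 2 \<le> l" using n unfolding l_def by (intro ln_mono) auto
    then have l: "l \<ge> 2 / 3" using ln2_ge_two_thirds by linarith
    define X where "X = real n / (D * l ^ d)"
    have X0: "X > 0" using n D0 l by (simp add: X_def)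
    have Xpow: "(X / 2) powr (- s) = (2 * D) powr s * real n powr (- s) * l powr (s * real d)"
    proof -
      have "(X / 2) powr (- s) = (real n / (2 * D * l powr real d)) powr (- s)"
        using l by (simp add: X_def powr_realpow mult_ac)
      also have "\<dots> = (2 * D) powr s * real n powr (- s) * (l powr real d) powr s"
        using n D0 l by (simp add: powr_divide powr_mult powr_minus field_simps)
      finally show ?thesis by (simp add: powr_powr mult.commute)
    qed
    then have bound: "K * real n powr (- s) * l powr (s * real d) = M * (X / 2) powr (- s)"
      by (simp add: K_def mult_ac)
    show ?thesis unfolding l_def[symmetric] bound
    proof (cases "X < 1")
      case True
      have "1 * 1 \<le> M * (X / 2) powr (- s)"
        using True X0 s powr_mono2'[of "- s" "X / 2" 1] M by (intro mult_mono) auto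
      then show "sampling_number (H_mix s :: (real ^ 'd \<Rightarrow> real) set) (mix_norm s) n \<le> ennreal (M * (X / 2) powr (- s))"
        by (intro order_trans[OF sampling_number_H_mix_le_1[OF s] ennreal_leI]) simp
    next
      case False
      define R where "R = nat \<lfloor>X\<rfloor>"
      have R1: "R \<ge> 1" "real R \<le> X" "X \<le> real R + 1" using False unfolding R_def by linarith+
      moreover from R1(1) have "1 \<le> real R" by simp
      ultimately have R: "R \<ge> 1" "real R \<le> X" "X / 2 \<le> real R" by simp_all
      have "3 * 1 \<le> 3 * (4 * l) ^ d" using l by (intro mult_left_mono one_le_power) auto
      also have "\<dots> = 3 * 4 ^ d * l ^ d" by (simp add: power_mult_distrib)
      also have "\<dots> \<le> D * l ^ d" using D l by (intro mult_right_mono) auto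
      finally have "X \<le> real n" using n unfolding X_def by (simp add: divide_le_eq mult_left_mono)
      then have Rn: "real R \<le> real n" using R by linarith
      define w where "w = (2 + ln (real R)) ^ (d - 1)"
      have lnR: "0 \<le> ln (real R)" "ln (real R) \<le> l" using R Rn unfolding l_def by auto
      have w1: "w \<ge> 1" unfolding w_def using lnR by (intro one_le_power) auto
      have w2: "w \<le> (4 * l) ^ (d - 1)" unfolding w_def using lnR l by (intro power_mono) auto
      \<comment> \<open>The factor \<open>w\<close> has the exponent \<open>d - 1\<close>; the number \<open>L\<close> of lattices supplies the missing
        logarithm.\<close>
      define x where "x = c * real R * w"
      have "1 * 1 * 1 \<le> c * real R * w" using c R w1 by (intro mult_mono) auto
      then obtain p where p: "prime p" "x \<le> real p" "real p \<le> Cp * x"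
        using Cp(2)[of x] by (auto simp: x_def)
      have p0: "p > 0" using p(1) prime_gt_0_nat by simp
      define L where "L = nat \<lfloor>log 2 (real n)\<rfloor> + 1"
      have "log 2 (real n) \<ge> 0" using n by simp
      then have L: "L > 0" "log 2 (real n) < real L" "real L \<le> log 2 (real n) + 1"
        unfolding L_def by linarith+
      have nL: "real n < 2 ^ L"
        using L(2) n by (simp add: log_less_iff powr_realpow)
      have "log 2 (real n) \<le> 3 / 2 * l"
      proof -
        have "l * (1 / ln 2) \<le> l * (3 / 2)"
          using ln2_ge_two_thirds l by (intro mult_left_mono) (auto simp: field_simps)
        then show ?thesis by (simp add: log_def l_def)
      qed
      then have L3: "real L \<le> 3 * l" using L(3) l by linarith
      have "real (L * p) \<le> (3 * l) * (Cp * (c * real R * (4 * l) ^ (d - 1)))"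
        unfolding of_nat_mult
      proof (intro mult_mono L3)
        have "Cp * x \<le> Cp * (c * real R * (4 * l) ^ (d - 1))"
          unfolding x_def using w2 Cp(1) c by (intro mult_left_mono) auto
        then show "real p \<le> Cp * (c * real R * (4 * l) ^ (d - 1))" using p(3) by linarith
      qed (use l in auto)
      also have "\<dots> \<le> (3 * (4 * l)) * (Cp * (c * real R * (4 * l) ^ (d - 1)))"
        using l Cp(1) c by (intro mult_right_mono) auto
      also have "\<dots> = 3 * Cp * c * (4 * l) ^ d * real R"
        using d by (cases d) (auto simp: mult_ac)
      also have "\<dots> = real R * (D * l ^ d)" by (simp add: D_def power_mult_distrib)
      also have "\<dots> \<le> X * (D * l ^ d)" using R D0 l by (intro mult_right_mono) auto
      also have "\<dots> = real n" using D0 l by (simp add: X_def)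
      finally have Lp: "L * p \<le> n" by (simp only: of_nat_le_iff)
      let ?I = "hyperbolic_cross R :: (nat ^ 'd) set"
      have "p \<le> L * p" using L(1) by simp
      then have "real p \<le> real (L * p)" by (simp only: of_nat_le_iff)
      have "real (card ?I) \<le> 2 * real R * w"
        using card_hyperbolic_cross[OF R(1), where 'd = 'd] by (simp add: w_def d_def)
      also have "\<dots> \<le> c * real R * w"
      proof (intro mult_right_mono)
        show "2 \<le> c" unfolding c_def using one_le_power[of "4::real" d] by linarith
      qed (use w1 in auto)
      also have "\<dots> \<le> real p" using p(2) by (simp add: x_def)
      also note \<open>real p \<le> real (L * p)\<close>
      also have "real (L * p) \<le> real n" using Lp by (simp only: of_nat_le_iff)
      also have "\<dots> < 2 ^ L" by (rule nL)
      finally have I: "card ?I < 2 ^ L" by (metis of_nat_less_iff of_nat_numeral of_nat_power)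
      define \<tau> where "\<tau> = Cb * real R powr (- 2 * s)"
      let ?Z = "generators p :: (int ^ 'd) set"
      have "?Z \<noteq> {}" using p0 by (auto simp: generators_def intro: exI[of _ 0])
      moreover have "16 * card {z \<in> ?Z. bad_generator s \<tau> R p h z} \<le> card ?Z" if "h \<in> ?I" for h
        unfolding \<tau>_def using p(2) by (intro Cb(2)[OF R(1) p(1) that]) (simp add: x_def c_def w_def d_def)
      ultimately obtain zs where zs: "\<forall>h\<in>?I. 2 * card {l. l < L \<and> bad_generator s \<tau> R p h (zs l)} \<le> L"
        using exists_rarely_bad_sequence[of ?Z ?I "bad_generator s \<tau> R p" L] I
        by (auto simp: finite_hyperbolic_cross)
      have maj: "L \<le> 2 * card (good_lattices s \<tau> R p zs L h)" if h: "h \<in> ?I" for h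
      proof -
        let ?B = "{l. l < L \<and> bad_generator s \<tau> R p h (zs l)}"
        have "{..<L} = good_lattices s \<tau> R p zs L h \<union> ?B" by (auto simp: good_lattices_def)
        then have "L = card (good_lattices s \<tau> R p zs L h \<union> ?B)" by (metis card_lessThan)
        also have "\<dots> \<le> card (good_lattices s \<tau> R p zs L h) + card ?B" by (rule card_Un_le)
        finally show ?thesis using zs h by fastforce
      qed
      have "sampling_number (H_mix s :: (real ^ 'd \<Rightarrow> real) set) (mix_norm s) n
           \<le> ennreal (sqrt (2 * 2 ^ CARD('d) * \<tau> + real R powr (- 2 * s)))"
        using Cb(1) by (intro sampling_number_H_mix_le_lattices[OF s R(1) p0 L(1) maj _ Lp]) (auto simp: \<tau>_def)
      also have "2 * 2 ^ CARD('d) * \<tau> + real R powr (- 2 * s) = M\<^sup>2 * (real R powr (- s))\<^sup>2"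
      proof -
        have "M\<^sup>2 = 2 * 2 ^ d * Cb + 1" unfolding M_def using Cb(1) by simp
        moreover have "(real R powr (- s))\<^sup>2 = real R powr (- 2 * s)"
          using R by (simp add: power2_eq_square flip: powr_add)
        ultimately show ?thesis by (simp add: \<tau>_def d_def algebra_simps)
      qed
      also have "sqrt (M\<^sup>2 * (real R powr (- s))\<^sup>2) = M * real R powr (- s)"
        using M by (simp add: real_sqrt_mult)
      also have "ennreal \<dots> \<le> ennreal (M * (X / 2) powr (- s))"
        using R X0 s M by (intro ennreal_leI mult_left_mono powr_mono2') auto
      finally show "sampling_number (H_mix s :: (real ^ 'd \<Rightarrow> real) set) (mix_norm s) n \<le> ennreal (M * (X / 2) powr (- s))" .
    qed
  qed
  then show ?thesis using K0 unfolding d_def by blast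
qed

end
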